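(* Let $p\in\{1,2\}$. Suppose that the Gaussian process $X$ satisfies the regularity assumption $\mathcal R(p)$ with parameters $(r_0,\beta_0)$ and that it is observed along a regular sequence design whose density $\psi$ satisfies the design assumption $\mathcal D$ (both defined in the context). Then there is a positive constant $C_1(r_0)$ such that, as $n\to\infty$, $$\mathbb P(\widehat r_0\neq r_0)=\mathcal O\big(\exp(-\varphi_n(p))\big)\qquad\text{and}\qquad \mathbb E(\widehat r_0-r_0)^2=\mathcal O\big(m_n^3\exp(-\varphi_n(p))\big),$$ where $$\varphi_n(1)=C_1(r_0)\Big(n\,\mathbf 1_{]0,\frac12[}(\beta_0)+\frac{n}{\ln n}\,\mathbf 1_{\{\frac12\}}(\beta_0)+n^{2-2\beta_0}\,\mathbf 1_{]\frac12,1[}(\beta_0)\Big),\qquad \varphi_n(2)=C_1(r_0)\,n .$$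
   Context: $X=\{X(t),t\in[0,T]\}$, $T>0$, is a real Gaussian process with mean $\mu(t)=\mathbb E X(t)$ and covariance $\mathbb K(s,t)=\mathrm{Cov}(X(s),X(t))$; $\mathbb K^{(a,b)}(s,t)=\partial^{a+b}\mathbb K/\partial s^a\partial t^b$. Regularity assumption $\mathcal R(p)$ ($p=1$ or $2$): (i) for some nonnegative integer $r_0$, $X$ is $r_0$-times differentiable in quadratic mean, with derivative $X^{(r_0)}$ ($X^{(0)}=X$); (ii) for some $\beta_0\in]0,1[$ and some positive continuous function $d_0$ on $[0,T]$, $$\lim_{h\to0}\ \sup_{s,t\in[0,T],\,|s-t|\le h,\,s\ne t}\Big|\frac{\mathbb E(X^{(r_0)}(s)-X^{(r_0)}(t))^2}{|s-t|^{2\beta_0}}-d_0(t)\Big|=0;$$ (iii-$p$) $\mathbb K^{(r_0+p,r_0+p)}(s,t)$ exists on $[0,T]^2\setminus\{s=t\}$ and satisfies $|\mathbb K^{(r_0+p,r_0+p)}(s,t)|\le D_p|s-t|^{-(2p-2\beta_0)}$ there for some $D_p>0$; moreover $\mu\in C^{r_0+1}([0,T])$. Regular sequence design: $X$ is observed at $0=t_{0,n}<t_{1,n}<\dots<t_{n,n}\le T$, $t_k:=t_{k,n}$, defined by $\int_0^{t_k}\psi(s)\,ds=k\delta_n/T$, $k=0,\dots,n$, where $\psi$ is a fixed positive continuous probability density on $[0,T]$ and $\delta_n>0$, $\delta_n\to0$, $n\delta_n\to T$ from below. Design assumption $\mathcal D$: $\inf_{t\in[0,T]}\psi(t)>0$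 and, for some $L>0$ and $\alpha\in]0,1]$, $|\psi(s)-\psi(t)|\le L|s-t|^\alpha$ for all $s,t\in[0,T]$. Divided differences: for positive integers $r,u$ and $k=0,\dots,n_r:=n-ur$, $$b_{ikr}^{(u)}=\prod_{m=0,m\ne i}^r (t_{k+iu}-t_{k+mu})^{-1},\quad D_{r,k}^{(u)}X=\sum_{i=0}^r b_{ikr}^{(u)}X(t_{k+iu}),\quad \overline{(D_r^{(u)}X)^2}=\frac1{n_r+1}\sum_{k=0}^{n_r}(D_{r,k}^{(u)}X)^2.$$ Estimator of $r_0$: $\widehat r_0=\min\{r\in\{2,\dots,m_n\}:\overline{(D_r^{(1)}X)^2}\ge n^2b_n\}-2$, and $\widehat r_0=l_0$ if this set is empty, where $l_0\notin\{0,1,2,\dots\}$ is an arbitrary fixed value. Here $(m_n)$ is a sequence of integers, $m_n\le n$, with $m_n\to\infty$ (or, if an upper bound $B$ for $r_0$ is known, $m_n=B+2$), and $(b_n)$ is a positive sequence such that $n^{-2(1-\beta)}b_n\to0$ and $n^{2\beta}b_n\to\infty$ for all $\beta\in]0,1[$. *)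

theory Defs
  imports "HOL-Probability.Probability" "HOL-Library.Landau_Symbols"
begin

section \<open>Gaussian processes\<close>

text \<open>Degenerate (almost surely constant) variables count as Gaussian, whereas
  \<^const>\<open>normal_density\<close> describes only positive variance.\<close>

definition gaussian_rv :: "'a measure \<Rightarrow> ('a \<Rightarrow> real) \<Rightarrow> bool" where
  "gaussian_rv M Y \<longleftrightarrow> Y \<in> borel_measurable M \<and>
     ((\<exists>c \<sigma>. 0 < \<sigma> \<and> distributed M lborel Y (\<lambda>x. ennreal (normal_density c \<sigma> x))) \<or>
      (\<exists>c. AE \<omega> in M. Y \<omega> = c))"

definition gaussian_process :: "'a measure \<Rightarrow> real set \<Rightarrow> (real \<Rightarrow> 'a \<Rightarrow> real) \<Rightarrow> bool" where
  "gaussian_process M I X \<longleftrightarrow>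
     (\<forall>J a. finite J \<and> J \<subseteq> I \<longrightarrow> gaussian_rv M (\<lambda>\<omega>. \<Sum>t\<in>J. a t * X t \<omega>))"

definition mean_fun :: "'a measure \<Rightarrow> (real \<Rightarrow> 'a \<Rightarrow> real) \<Rightarrow> real \<Rightarrow> real" where
  "mean_fun M X t = (\<integral>\<omega>. X t \<omega> \<partial>M)"

definition cov_fun :: "'a measure \<Rightarrow> (real \<Rightarrow> 'a \<Rightarrow> real) \<Rightarrow> real \<Rightarrow> real \<Rightarrow> real" where
  "cov_fun M X s t = (\<integral>\<omega>. (X s \<omega> - mean_fun M X s) * (X t \<omega> - mean_fun M X t) \<partial>M)"


section \<open>Derivatives\<close>

text \<open>Square integrability is required explicitly because the Bochner integral of a
  non-integrable function is 0.\<close>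

definition second_order :: "'a measure \<Rightarrow> real set \<Rightarrow> (real \<Rightarrow> 'a \<Rightarrow> real) \<Rightarrow> bool" where
  "second_order M I X \<longleftrightarrow>
     (\<forall>t\<in>I. X t \<in> borel_measurable M \<and> integrable M (\<lambda>\<omega>. (X t \<omega>)\<^sup>2))"

definition has_qm_deriv ::
  "'a measure \<Rightarrow> real set \<Rightarrow> (real \<Rightarrow> 'a \<Rightarrow> real) \<Rightarrow> (real \<Rightarrow> 'a \<Rightarrow> real) \<Rightarrow> bool" where
  "has_qm_deriv M I X Y \<longleftrightarrow> second_order M I X \<and> second_order M I Y \<and>
     (\<forall>t\<in>I. ((\<lambda>s. \<integral>\<omega>. ((X s \<omega> - X t \<omega>) / (s - t) - Y t \<omega>)\<^sup>2 \<partial>M) \<longlongrightarrow> 0) (at t within I))"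

primrec has_nth_qm_deriv ::
  "'a measure \<Rightarrow> real set \<Rightarrow> nat \<Rightarrow> (real \<Rightarrow> 'a \<Rightarrow> real) \<Rightarrow> (real \<Rightarrow> 'a \<Rightarrow> real) \<Rightarrow> bool" where
  "has_nth_qm_deriv M I 0 X Y \<longleftrightarrow> (\<forall>t\<in>I. Y t = X t)"
| "has_nth_qm_deriv M I (Suc r) X Y \<longleftrightarrow>
     (\<exists>Z. has_nth_qm_deriv M I r X Z \<and> has_qm_deriv M I Z Y)"

text \<open>Derivatives relative to \<open>S\<close>, hence one-sided at end points of intervals.\<close>

primrec has_nth_deriv_on ::
  "nat \<Rightarrow> (real \<Rightarrow> real) \<Rightarrow> (real \<Rightarrow> real) \<Rightarrow> real set \<Rightarrow> bool" where
  "has_nth_deriv_on 0 f g S \<longleftrightarrow> (\<forall>x\<in>S. g x = f x)"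
| "has_nth_deriv_on (Suc k) f g S \<longleftrightarrow>
     (\<exists>h. has_nth_deriv_on k f h S \<and> (\<forall>x\<in>S. (h has_real_derivative g x) (at x within S)))"

definition Ck_on :: "nat \<Rightarrow> (real \<Rightarrow> real) \<Rightarrow> real set \<Rightarrow> bool" where
  "Ck_on k f S \<longleftrightarrow> (\<exists>g. has_nth_deriv_on k f g S \<and> continuous_on S g)"

text \<open>\<open>G\<close> is \<open>\<partial>\<^sup>a\<^sup>+\<^sup>b K / \<partial>s\<^sup>a \<partial>t\<^sup>b\<close> on the square \<open>I \<times> I\<close> without its diagonal: the
  derivatives in \<open>t\<close> are taken first.\<close>

definition has_mixed_deriv_off_diag ::
  "real set \<Rightarrow> nat \<Rightarrow> nat \<Rightarrow> (real \<Rightarrow> real \<Rightarrow> real) \<Rightarrow> (real \<Rightarrow> real \<Rightarrow> real) \<Rightarrow> bool" where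
  "has_mixed_deriv_off_diag I a b K G \<longleftrightarrow>
     (\<exists>H. (\<forall>s\<in>I. has_nth_deriv_on b (\<lambda>t. K s t) (\<lambda>t. H s t) (I - {s})) \<and>
          (\<forall>t\<in>I. has_nth_deriv_on a (\<lambda>s. H s t) (\<lambda>s. G s t) (I - {t})))"


section \<open>Assumptions on the process and the design\<close>

text \<open>The assumption \<open>R(p)\<close> with parameters \<open>(r0, \<beta>0)\<close>; \<open>Y\<close> is the quadratic mean
  derivative of order \<open>r0\<close>, which is unique up to null sets. The supremum is taken in
  \<^typ>\<open>ereal\<close>, so that it is meaningful when infinite.\<close>

definition regularity ::
  "'a measure \<Rightarrow> real \<Rightarrow> (real \<Rightarrow> 'a \<Rightarrow> real) \<Rightarrow> nat \<Rightarrow> nat \<Rightarrow> real \<Rightarrow> bool" where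
  "regularity M T X p r0 \<beta>0 \<longleftrightarrow>
     (\<exists>Y. has_nth_qm_deriv M {0..T} r0 X Y \<and>
        0 < \<beta>0 \<and> \<beta>0 < 1 \<and>
        (\<exists>d0. continuous_on {0..T} d0 \<and> (\<forall>t\<in>{0..T}. 0 < d0 t) \<and>
          ((\<lambda>h. SUP (s, t) \<in> {(s, t). s \<in> {0..T} \<and> t \<in> {0..T} \<and> \<bar>s - t\<bar> \<le> h \<and> s \<noteq> t}.
              ereal \<bar>(\<integral>\<omega>. (Y s \<omega> - Y t \<omega>)\<^sup>2 \<partial>M) / \<bar>s - t\<bar> powr (2 * \<beta>0) - d0 t\<bar>)
            \<longlongrightarrow> 0) (at_right 0))) \<and>
     (\<exists>G D. has_mixed_deriv_off_diag {0..T} (r0 + p) (r0 + p) (cov_fun M X) G \<and> 0 < D \<and>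
        (\<forall>s\<in>{0..T}. \<forall>t\<in>{0..T}. s \<noteq> t \<longrightarrow>
           \<bar>G s t\<bar> \<le> D * \<bar>s - t\<bar> powr (- (2 * real p - 2 * \<beta>0)))) \<and>
     Ck_on (r0 + 1) (mean_fun M X) {0..T}"

definition design_density :: "real \<Rightarrow> (real \<Rightarrow> real) \<Rightarrow> bool" where
  "design_density T \<psi> \<longleftrightarrow>
     continuous_on {0..T} \<psi> \<and> (\<forall>s\<in>{0..T}. 0 < \<psi> s) \<and> (\<psi> has_integral 1) {0..T}"

text \<open>\<open>t n k\<close> is the \<open>k\<close>-th observation time of the design of size \<open>n\<close>; designs are
  indexed by \<open>n \<ge> 1\<close>.\<close>

definition regular_design ::
  "real \<Rightarrow> (real \<Rightarrow> real) \<Rightarrow> (nat \<Rightarrow> real) \<Rightarrow> (nat \<Rightarrow> nat \<Rightarrow> real) \<Rightarrow> bool" where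
  "regular_design T \<psi> \<delta> t \<longleftrightarrow>
     design_density T \<psi> \<and>
     (\<forall>n\<ge>1. 0 < \<delta> n \<and> real n * \<delta> n \<le> T) \<and>
     \<delta> \<longlonglongrightarrow> 0 \<and> (\<lambda>n. real n * \<delta> n) \<longlonglongrightarrow> T \<and>
     (\<forall>n\<ge>1. t n 0 = 0 \<and> strict_mono_on {0..n} (t n) \<and> t n n \<le> T \<and>
        (\<forall>k\<le>n. (\<psi> has_integral (real k * \<delta> n / T)) {0..t n k}))"

definition design_assumption :: "real \<Rightarrow> (real \<Rightarrow> real) \<Rightarrow> bool" where
  "design_assumption T \<psi> \<longleftrightarrow>
     0 < (INF t\<in>{0..T}. \<psi> t) \<and>
     (\<exists>L \<alpha>. 0 < L \<and> 0 < \<alpha> \<and> \<alpha> \<le> 1 \<and>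
        (\<forall>s\<in>{0..T}. \<forall>t\<in>{0..T}. \<bar>\<psi> s - \<psi> t\<bar> \<le> L * \<bar>s - t\<bar> powr \<alpha>))"


section \<open>The estimator\<close>

text \<open>In this section \<open>\<tau> k\<close> is the \<open>k\<close>-th observation time and \<open>x\<close> the observed path.\<close>

definition dd_coeff :: "(nat \<Rightarrow> real) \<Rightarrow> nat \<Rightarrow> nat \<Rightarrow> nat \<Rightarrow> nat \<Rightarrow> real" where
  "dd_coeff \<tau> u i k r = (\<Prod>m\<in>{0..r} - {i}. inverse (\<tau> (k + i * u) - \<tau> (k + m * u)))"

definition div_diff :: "(nat \<Rightarrow> real) \<Rightarrow> nat \<Rightarrow> nat \<Rightarrow> nat \<Rightarrow> (real \<Rightarrow> real) \<Rightarrow> real" where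
  "div_diff \<tau> u r k x = (\<Sum>i=0..r. dd_coeff \<tau> u i k r * x (\<tau> (k + i * u)))"

text \<open>To be used for \<open>u * r \<le> n\<close> only, since the subtraction is truncated.\<close>

definition mean_sq_div_diff :: "(nat \<Rightarrow> real) \<Rightarrow> nat \<Rightarrow> nat \<Rightarrow> nat \<Rightarrow> (real \<Rightarrow> real) \<Rightarrow> real" where
  "mean_sq_div_diff \<tau> n u r x =
     (\<Sum>k=0..n - u * r. (div_diff \<tau> u r k x)\<^sup>2) / real (n - u * r + 1)"

definition r0_hat ::
  "(nat \<Rightarrow> nat \<Rightarrow> real) \<Rightarrow> (nat \<Rightarrow> int) \<Rightarrow> (nat \<Rightarrow> real) \<Rightarrow> real \<Rightarrow> nat \<Rightarrow> (real \<Rightarrow> real) \<Rightarrow> real" where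
  "r0_hat t m b l0 n x =
     (let S = {r::nat. 2 \<le> r \<and> int r \<le> m n \<and> (real n)\<^sup>2 * b n \<le> mean_sq_div_diff (t n) n 1 r x}
      in if S = {} then l0 else real (Min S) - 2)"

text \<open>The two admissible choices of \<open>m\<close>. The constraint \<open>m n \<le> n\<close> can only hold for
  large \<open>n\<close> in the second one.\<close>

definition max_order_seq :: "nat \<Rightarrow> (nat \<Rightarrow> int) \<Rightarrow> bool" where
  "max_order_seq r0 m \<longleftrightarrow>
     (\<forall>\<^sub>F n in sequentially. m n \<le> int n) \<and>
     (filterlim m at_top sequentially \<or>
      (\<exists>B. r0 \<le> B \<and> (\<forall>\<^sub>F n in sequentially. m n = int B + 2)))"

definition threshold_seq :: "(nat \<Rightarrow> real) \<Rightarrow> bool" where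
  "threshold_seq b \<longleftrightarrow> (\<forall>n\<ge>1. 0 < b n) \<and>
     (\<forall>\<beta>. 0 < \<beta> \<and> \<beta> < 1 \<longrightarrow>
        (\<lambda>n. real n powr (- 2 * (1 - \<beta>)) * b n) \<longlonglongrightarrow> 0 \<and>
        filterlim (\<lambda>n. real n powr (2 * \<beta>) * b n) at_top sequentially)"


section \<open>The rate\<close>

text \<open>\<open>C\<close> is the constant \<open>C\<^sub>1(r0)\<close>; only \<open>p = 1\<close> and \<open>p = 2\<close> are meaningful.\<close>

definition rate :: "real \<Rightarrow> real \<Rightarrow> nat \<Rightarrow> nat \<Rightarrow> real" where
  "rate C \<beta>0 p n =
     (if p = 1 then
        C * (real n * indicator {0<..<1/2} \<beta>0 + real n / ln (real n) * indicator {1/2} \<beta>0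
             + real n powr (2 - 2 * \<beta>0) * indicator {1/2<..<1} \<beta>0)
      else C * real n)"

end

theory Submission
  imports Defs "HOL-Computational_Algebra.Polynomial" "HOL-Real_Asymp.Real_Asymp"
begin

text \<open>The estimator can only err if the mean square of the divided differences of order \<open>r0 + 2\<close>
  lies below the threshold \<open>n\<^sup>2 b\<^sub>n\<close>, or if that of some order \<open>r \<in> {2..r0 + 1}\<close> reaches it. The
  expectations of these mean squares are of order \<open>n\<^sup>4\<^sup>-\<^sup>2\<^sup>\<beta>\<close> and at most \<open>n\<^sup>2\<^sup>-\<^sup>2\<^sup>\<beta>\<close> respectively, hence
  on the correct side of the threshold, and it remains to control the deviations of Gaussian
  quadratic forms. Their Laplace transforms are computed with an auxiliary standard normal
  vector; this only requires bounds on the covariance matrix as a quadratic form, namely on its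
  row sums for the upper tail and diagonal dominance for the lower tail. For the latter, indices
  are thinned out to distance \<open>q\<close>, and the largest number of indices that can be kept is
  \<open>n / (\<Sum>j\<le>n. j powr (2 \<beta> - 2 p))\<close> up to a constant: this is the rate. The moments
  and covariances are bounded by mean value theorems for divided differences.\<close>

section \<open>Divided differences\<close>

text \<open>The hypotheses control the increments of the derivative of order \<open>r0\<close> and,
  off the diagonal, the covariances of order \<open>r0 + p\<close>, whereas the estimator separates
  the orders \<open>r0 + 1\<close> and \<open>r0 + 2\<close>; one of these is always reached
  indirectly. For \<open>p = 1\<close>, order \<open>r0 + 2\<close> comes from differencing order
  \<open>r0 + 1\<close>: this yields the right power of \<open>n\<close> but no further decay in
  \<open>\<bar>k - l\<bar>\<close>, so that row sums diverge once \<beta> reaches 1/2 and the rate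
  drops below \<open>n\<close>. For \<open>p = 2\<close>, order \<open>r0 + 1\<close> is recovered
  from second differences inside blocks, with the decay exponent \<open>2 - 2 * \<beta>\<close>
  halved. The loss is affordable: the threshold dominates \<open>real n powr (2 - \<beta>)\<close>
  by a diverging factor, so upper deviations have probability of order \<open>exp (- n)\<close> in
  all cases and the lower deviation at order \<open>r0 + 2\<close> alone decides the rate. There the
  difficulty is nondegeneracy, since the lower bound in the hypotheses concerns increments and not
  second differences; one second difference of full size is secured in every window of fixed length,
  and that suffices.\<close>

lemma div_diff_recursion:
  assumes "inj_on \<tau> {k..k + Suc r}"
  shows "(\<tau> (k + Suc r) - \<tau> k) * div_diff \<tau> 1 (Suc r) k x =
           div_diff \<tau> 1 r (Suc k) x - div_diff \<tau> 1 r k x"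
proof -
  define z where "z i = \<tau> (k + i)" for i
  define q where "q A i = (\<Prod>m\<in>A - {i}. inverse (z i - z m))" for A i
  have z_neq: "z i \<noteq> z j" if "i \<le> Suc r" "j \<le> Suc r" "i \<noteq> j" for i j
    using inj_onD[OF assms, of "k + i" "k + j"] that by (auto simp: z_def)
  have split0: "q {0..Suc r} i = inverse (z i - z 0) * q {1..Suc r} i" if "i \<noteq> 0" for i
  proof -
    have "{0..Suc r} - {i} = insert 0 ({1..Suc r} - {i})" using that by auto
    thus ?thesis by (simp add: q_def)
  qed
  have splitr: "q {0..Suc r} i = inverse (z i - z (Suc r)) * q {0..r} i" if "i \<noteq> Suc r" for i
  proof -
    have "{0..Suc r} - {i} = insert (Suc r) ({0..r} - {i})" using that by auto
    thus ?thesis by (simp add: q_def)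
  qed
  \<comment> \<open>The identity is checked on the coefficient of each \<open>x (z i)\<close>:
    restoring the missing factors leaves \<open>(z i - z 0) - (z i - z (Suc r))\<close>. Each end
    node is absent from one of the two shorter divided differences, where \<open>q\<close> would be
    a meaningless product; hence the conditionals.\<close>
  have key: "q {0..Suc r} i * (z (Suc r) - z 0) =
      (if i = 0 then 0 else q {1..Suc r} i) - (if i = Suc r then 0 else q {0..r} i)"
    if "i \<le> Suc r" for i
  proof -
    consider "i = 0" | "i = Suc r" | "i \<noteq> 0" "i \<noteq> Suc r" by blast
    thus ?thesis
    proof cases
      case 1
      thus ?thesis using z_neq[of "Suc r" 0] splitr[of 0] by (simp add: field_simps)
    next
      case 2
      thus ?thesis using z_neq[of "Suc r" 0] split0[of "Suc r"] by (simp add: field_simps)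
    next
      case 3
      have "z i - z 0 \<noteq> 0" "z i - z (Suc r) \<noteq> 0"
        using z_neq[of i 0] z_neq[of i "Suc r"] 3 that by auto
      moreover have "q {1..Suc r} i = (z i - z 0) * q {0..Suc r} i"
        using split0[OF 3(1)] \<open>z i - z 0 \<noteq> 0\<close> by (simp add: field_simps)
      moreover have "q {0..r} i = (z i - z (Suc r)) * q {0..Suc r} i"
        using splitr[OF 3(2)] \<open>z i - z (Suc r) \<noteq> 0\<close> by (simp add: field_simps)
      ultimately show ?thesis using 3 by (simp add: algebra_simps)
    qed
  qed
  have c: "dd_coeff \<tau> 1 i k n = q {0..n} i" for i n
    by (simp add: dd_coeff_def q_def z_def)
  have c': "dd_coeff \<tau> 1 i (Suc k) r = q {1..Suc r} (Suc i)" for i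
  proof -
    have "{1..Suc r} - {Suc i} = Suc ` ({0..r} - {i})"
      by (auto simp: image_iff Bex_def) presburger
    thus ?thesis by (simp add: dd_coeff_def q_def z_def prod.reindex)
  qed
  have "(\<tau> (k + Suc r) - \<tau> k) * div_diff \<tau> 1 (Suc r) k x =
      (\<Sum>i=0..Suc r. q {0..Suc r} i * (z (Suc r) - z 0) * x (z i))"
    unfolding div_diff_def c sum_distrib_left by (simp add: z_def mult_ac)
  also have "\<dots> = (\<Sum>i=0..Suc r. (if i = 0 then 0 else q {1..Suc r} i) * x (z i)) -
      (\<Sum>i=0..Suc r. (if i = Suc r then 0 else q {0..r} i) * x (z i))"
    by (simp add: key left_diff_distrib flip: sum_subtractf)
  also have "(\<Sum>i=0..Suc r. (if i = 0 then 0 else q {1..Suc r} i) * x (z i)) =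
      (\<Sum>i=0..r. q {1..Suc r} (Suc i) * x (z (Suc i)))"
    by (subst sum.atLeast0_atMost_Suc_shift) simp
  also have "(\<Sum>i=0..Suc r. (if i = Suc r then 0 else q {0..r} i) * x (z i)) =
      (\<Sum>i=0..r. q {0..r} i * x (z i))"
    by simp
  also have "(\<Sum>i=0..r. q {1..Suc r} (Suc i) * x (z (Suc i))) = div_diff \<tau> 1 r (Suc k) x"
    unfolding div_diff_def c' by (simp add: z_def)
  also have "(\<Sum>i=0..r. q {0..r} i * x (z i)) = div_diff \<tau> 1 r k x"
    unfolding div_diff_def c by (simp add: z_def)
  finally show ?thesis .
qed

section \<open>Iterated derivatives and the mean value theorem for divided differences\<close>

lemma has_nth_deriv_on_subset:
  "has_nth_deriv_on k f g S \<Longrightarrow> S' \<subseteq> S \<Longrightarrow> has_nth_deriv_on k f g S'"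
proof (induction k arbitrary: g)
  case (Suc k)
  then obtain h where h: "has_nth_deriv_on k f h S"
    "\<forall>x\<in>S. (h has_real_derivative g x) (at x within S)" by auto
  show ?case
    using Suc.IH[OF h(1) Suc.prems(2)] h(2) Suc.prems(2)
    by (auto intro!: exI[of _ h] intro: has_field_derivative_subset)
qed auto

lemma has_nth_deriv_on_lincomb:
  assumes "has_nth_deriv_on k f1 g1 S" "has_nth_deriv_on k f2 g2 S"
  shows "has_nth_deriv_on k (\<lambda>x. a * f1 x + b * f2 x) (\<lambda>x. a * g1 x + b * g2 x) S"
  using assms
proof (induction k arbitrary: g1 g2)
  case (Suc k)
  then obtain h1 h2 where h: "has_nth_deriv_on k f1 h1 S"
    "\<forall>x\<in>S. (h1 has_real_derivative g1 x) (at x within S)"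
    "has_nth_deriv_on k f2 h2 S"
    "\<forall>x\<in>S. (h2 has_real_derivative g2 x) (at x within S)" by auto
  show ?case
    using Suc.IH[OF h(1,3)] h(2,4)
    by (auto intro!: exI[of _ "\<lambda>x. a * h1 x + b * h2 x"] derivative_eq_intros)
qed auto

lemma has_nth_deriv_on_zero: "has_nth_deriv_on k (\<lambda>_. 0) (\<lambda>_. 0) S"
proof (induction k)
  case (Suc k)
  thus ?case by (simp, intro exI[of _ "\<lambda>_. 0"]) simp
qed simp

lemma has_nth_deriv_on_sum:
  assumes "\<And>i. i \<in> A \<Longrightarrow> has_nth_deriv_on k (f i) (g i) S"
  shows "has_nth_deriv_on k (\<lambda>x. \<Sum>i\<in>A. c i * f i x) (\<lambda>x. \<Sum>i\<in>A. c i * g i x) S"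
  using assms
proof (induction A rule: infinite_finite_induct)
  case (insert i A)
  thus ?case
    using has_nth_deriv_on_lincomb[of k "f i" "g i" S "\<lambda>x. \<Sum>i\<in>A. c i * f i x"
        "\<lambda>x. \<Sum>i\<in>A. c i * g i x" "c i" 1] by simp
qed (auto simp: has_nth_deriv_on_zero)

lemma has_nth_deriv_on_poly:
  "has_nth_deriv_on k (poly p) (poly ((pderiv ^^ k) p)) S"
proof (induction k)
  case (Suc k)
  thus ?case
    by (simp, intro exI[of _ "poly ((pderiv ^^ k) p)"])
       (auto intro: poly_DERIV has_field_derivative_at_within)
qed simp

text \<open>Iterated Rolle: every differentiation costs one zero. The surplus \<open>j\<close> is
  kept general because the induction passes to one more zero of the derivative of lower order before
  Rolle is applied between neighbouring zeros.\<close>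

lemma has_nth_deriv_on_zeros:
  assumes "has_nth_deriv_on k f h {a..b}"
    and "strict_mono_on {0..k + j} z" "\<forall>i\<le>k + j. z i \<in> {a..b} \<and> f (z i) = 0"
  shows "\<exists>z'. strict_mono_on {0..j} z' \<and> (\<forall>i\<le>j. z' i \<in> {a..b} \<and> h (z' i) = (0::real))"
  using assms
proof (induction k arbitrary: h j)
  case 0
  thus ?case by (auto intro!: exI[of _ z])
next
  case (Suc k)
  then obtain g where g: "has_nth_deriv_on k f g {a..b}"
    "\<forall>x\<in>{a..b}. (g has_real_derivative h x) (at x within {a..b})" by auto
  obtain y where y: "strict_mono_on {0..Suc j} y" "\<forall>i\<le>Suc j. y i \<in> {a..b} \<and> g (y i) = 0"
    using Suc.IH[OF g(1), of "Suc j"] Suc.prems by auto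
  have step: "\<exists>w. y i < w \<and> w < y (Suc i) \<and> h w = 0" if "i \<le> j" for i
  proof -
    have lt: "y i < y (Suc i)" using y(1) that by (auto simp: strict_mono_on_def)
    have sub: "{y i..y (Suc i)} \<subseteq> {a..b}" using y(2) that by auto
    have "continuous_on {a..b} g"
      using g(2) unfolding continuous_on_eq_continuous_within by (blast intro: DERIV_continuous)
    hence cont: "continuous_on {y i..y (Suc i)} g" using sub by (rule continuous_on_subset)
    have "\<exists>w. y i < w \<and> w < y (Suc i) \<and> (\<lambda>v. v * h w) = (\<lambda>v. 0)"
    proof (rule Rolle_deriv[OF lt _ cont])
      fix w assume w: "y i < w" "w < y (Suc i)"
      hence wab: "w \<in> {a<..<b}" using sub lt by force
      hence "(g has_real_derivative h w) (at w)"
        using g(2) at_within_Icc_at[of a w b] w by (metis atLeastAtMost_iff greaterThanLessThan_iff less_imp_le)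
      thus "(g has_derivative (\<lambda>v. v * h w)) (at w)"
        by (simp add: has_field_derivative_def mult.commute[of _ "h w"])
    qed (use y(2) that in auto)
    thus ?thesis by (metis mult_1)
  qed
  then obtain w where w: "\<And>i. i \<le> j \<Longrightarrow> y i < w i \<and> w i < y (Suc i) \<and> h (w i) = 0" by metis
  have "w i < w i'" if "i < i'" "i' \<le> j" for i i'
  proof -
    have "y (Suc i) \<le> y i'" using strict_mono_on_leD[OF y(1), of "Suc i" i'] that by auto
    thus ?thesis using w[of i] w[of i'] that by force
  qed
  moreover have "w i \<in> {a..b}" if "i \<le> j" for i
  proof -
    have "y i \<in> {a..b}" "y (Suc i) \<in> {a..b}" using y(2) that by auto
    thus ?thesis using w[OF that] by auto
  qed
  ultimately show ?case using w by (auto intro!: exI[of _ w] simp: strict_mono_on_def)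
qed

lemma pderiv_funpow_degree_le:
  fixes p :: "real poly"
  assumes "degree p \<le> r"
  shows "(pderiv ^^ r) p = [:fact r * coeff p r:]"
proof -
  have "coeff ((pderiv ^^ r) p) n = pochhammer (of_nat (Suc n)) r * coeff p (n + r)" for n
    using coeff_higher_pderiv[of r p n] by simp
  hence "coeff ((pderiv ^^ r) p) n = coeff [:fact r * coeff p r:] n" for n
    using assms by (cases n) (auto simp: pochhammer_fact coeff_eq_0)
  thus ?thesis by (simp add: poly_eq_iff)
qed

text \<open>The Lagrange polynomial \<open>P\<close> of \<open>f\<close> at the \<open>r + 1\<close>
  nodes has the divided difference as its coefficient of degree \<open>r\<close>. The error
  \<open>f - P\<close> vanishes at all nodes, so its derivative of order \<open>r\<close>, which is
  \<open>g\<close> minus \<open>fact r\<close> times that coefficient, has a zero.\<close>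

theorem div_diff_mean_value:
  assumes mono: "strict_mono_on {k..k + r} \<tau>"
    and deriv: "has_nth_deriv_on r f g {\<tau> k..\<tau> (k + r)}"
  shows "\<exists>\<xi>\<in>{\<tau> k..\<tau> (k + r)}. div_diff \<tau> 1 r k f = g \<xi> / fact r"
proof -
  define z where "z i = \<tau> (k + i)" for i
  have zmono: "strict_mono_on {0..r} z"
    using mono by (auto simp: z_def strict_mono_on_def)
  hence zneq: "z i \<noteq> z j" if "i \<le> r" "j \<le> r" "i \<noteq> j" for i j
    using that strict_mono_on_imp_inj_on[OF zmono] by (auto simp: inj_on_def)
  define L where "L i = (\<Prod>m\<in>{0..r} - {i}. smult (inverse (z i - z m)) [:- z m, 1:])" for i
  define P where "P = (\<Sum>i=0..r. smult (f (z i)) (L i))"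
  have L_eval: "poly (L i) (z j) = (if i = j then 1 else 0)" if "i \<le> r" "j \<le> r" for i j
  proof (cases "i = j")
    case True
    have "poly (L i) (z j) = (\<Prod>m\<in>{0..r} - {i}. 1)"
      unfolding L_def poly_prod
    proof (intro prod.cong refl)
      fix m assume "m \<in> {0..r} - {i}"
      hence "z i - z m \<noteq> 0" using zneq[of i m] that by auto
      thus "poly (smult (inverse (z i - z m)) [:- z m, 1:]) (z j) = 1"
        using left_inverse[of "z i - z m"] True by (simp add: algebra_simps)
    qed
    thus ?thesis using True by simp
  next
    case False
    thus ?thesis unfolding L_def poly_prod using that by (auto intro!: prod_zero)
  qed
  have degc: "degree (L i) \<le> r \<and> coeff (L i) r = dd_coeff \<tau> 1 i k r" if "i \<le> r" for i
  proof -
    have "degree (\<Prod>m\<in>{0..r} - {i}. [:- z m, 1:]) = r"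
      using that by (subst degree_prod_eq_sum_degree) auto
    moreover have "lead_coeff (\<Prod>m\<in>{0..r} - {i}. [:- z m, 1:]) = 1"
      by (subst lead_coeff_prod) simp
    moreover have "L i = smult (\<Prod>m\<in>{0..r} - {i}. inverse (z i - z m))
        (\<Prod>m\<in>{0..r} - {i}. [:- z m, 1:])"
      unfolding L_def by (rule prod_smult)
    ultimately show ?thesis by (auto simp: dd_coeff_def z_def degree_smult_le)
  qed
  have P_eval: "poly P (z j) = f (z j)" if "j \<le> r" for j
    unfolding P_def poly_sum using that by (simp add: L_eval if_distrib cong: if_cong)
  have P_deg: "degree P \<le> r"
    unfolding P_def by (intro degree_sum_le) (auto simp: degc intro: order.trans[OF degree_smult_le])
  have P_coeff: "coeff P r = div_diff \<tau> 1 r k f"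
    unfolding P_def coeff_sum div_diff_def by (simp add: degc z_def mult.commute)
  have "has_nth_deriv_on r (\<lambda>x. 1 * f x + (- 1) * poly P x)
      (\<lambda>x. 1 * g x + (- 1) * poly ((pderiv ^^ r) P) x) {\<tau> k..\<tau> (k + r)}"
    by (intro has_nth_deriv_on_lincomb deriv has_nth_deriv_on_poly)
  moreover have "z i \<in> {\<tau> k..\<tau> (k + r)}" if "i \<le> r" for i
    using strict_mono_on_leD[OF mono, of k "k + i"] strict_mono_on_leD[OF mono, of "k + i" "k + r"]
      that by (auto simp: z_def)
  ultimately obtain z' where "z' (0::nat) \<in> {\<tau> k..\<tau> (k + r)}"
    "1 * g (z' 0) + (- 1) * poly ((pderiv ^^ r) P) (z' 0) = 0"
    using has_nth_deriv_on_zeros[of r "\<lambda>x. 1 * f x + (- 1) * poly P x"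
        "\<lambda>x. 1 * g x + (- 1) * poly ((pderiv ^^ r) P) x" "\<tau> k" "\<tau> (k + r)" 0 z] zmono P_eval
    by auto
  thus ?thesis
    using pderiv_funpow_degree_le[OF P_deg] P_coeff by (intro bexI[of _ "z' 0"]) auto
qed

section \<open>Exponential moments of Gaussian quadratic forms\<close>

abbreviation gauss01 :: "real measure" where
  "gauss01 \<equiv> density lborel (\<lambda>x. ennreal (std_normal_density x))"

lemma nn_integral_normal_density:
  "0 < \<sigma> \<Longrightarrow> (\<integral>\<^sup>+x. ennreal (normal_density \<mu> \<sigma> x) \<partial>lborel) = 1"
  by (subst nn_integral_eq_integral) auto

lemma nn_integral_exp_gauss01: "(\<integral>\<^sup>+x. ennreal (exp (a * x)) \<partial>gauss01) = ennreal (exp (a\<^sup>2 / 2))"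
proof -
  have "(\<integral>\<^sup>+x. ennreal (exp (a * x)) \<partial>gauss01) =
      (\<integral>\<^sup>+x. ennreal (std_normal_density x) * ennreal (exp (a * x)) \<partial>lborel)"
    by (subst nn_integral_density) auto
  also have "\<dots> = (\<integral>\<^sup>+x. ennreal (exp (a\<^sup>2 / 2)) * ennreal (normal_density a 1 x) \<partial>lborel)"
  proof (intro nn_integral_cong)
    fix x :: real
    \<comment> \<open>Completing the square: the exponential weight moves the mean to
      \<open>a\<close>.\<close>
    have "std_normal_density x * exp (a * x) = exp (a\<^sup>2 / 2) * normal_density a 1 x"
      by (simp add: normal_density_def field_simps power2_eq_square flip: exp_add)
    thus "ennreal (std_normal_density x) * ennreal (exp (a * x)) =
        ennreal (exp (a\<^sup>2 / 2)) * ennreal (normal_density a 1 x)"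
      by (simp flip: ennreal_mult'')
  qed
  finally show ?thesis by (simp add: nn_integral_cmult nn_integral_normal_density)
qed

lemma nn_integral_exp_square_gauss01:
  assumes "2 * u < 1"
  shows "(\<integral>\<^sup>+x. ennreal (exp (u * x\<^sup>2)) \<partial>gauss01) = ennreal (1 / sqrt (1 - 2 * u))"
proof -
  \<comment> \<open>The weight \<open>exp (u * x\<^sup>2)\<close> turns the standard normal density
    into a multiple of the centred one with variance \<open>1 / (1 - 2 * u)\<close>.\<close>
  define \<sigma> where "\<sigma> = 1 / sqrt (1 - 2 * u)"
  have \<sigma>: "0 < \<sigma>" "\<sigma>\<^sup>2 = 1 / (1 - 2 * u)" using assms by (auto simp: \<sigma>_def power_divide)
  have "(\<integral>\<^sup>+x. ennreal (exp (u * x\<^sup>2)) \<partial>gauss01) =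
      (\<integral>\<^sup>+x. ennreal (std_normal_density x) * ennreal (exp (u * x\<^sup>2)) \<partial>lborel)"
    by (subst nn_integral_density) auto
  also have "\<dots> = (\<integral>\<^sup>+x. ennreal \<sigma> * ennreal (normal_density 0 \<sigma> x) \<partial>lborel)"
  proof (intro nn_integral_cong)
    fix x :: real
    have "u * x\<^sup>2 - x\<^sup>2 / 2 = - (x\<^sup>2 / (2 * \<sigma>\<^sup>2))"
      using assms unfolding \<sigma>(2) by (simp add: field_simps)
    hence "std_normal_density x * exp (u * x\<^sup>2) = \<sigma> * normal_density 0 \<sigma> x"
      using \<sigma>(1) by (simp add: normal_density_def real_sqrt_mult flip: exp_add)
    thus "ennreal (std_normal_density x) * ennreal (exp (u * x\<^sup>2)) =
        ennreal \<sigma> * ennreal (normal_density 0 \<sigma> x)"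
      using \<sigma>(1) by (simp flip: ennreal_mult'')
  qed
  finally show ?thesis using \<sigma>(1) by (simp add: nn_integral_cmult nn_integral_normal_density \<sigma>_def)
qed

lemma prob_space_gauss01: "prob_space gauss01"
  by (rule prob_space_normal_density) simp

lemma char_gauss01: "(CLINT x|gauss01. iexp (a * x)) = complex_of_real (exp (- a\<^sup>2 / 2))"
  using char_std_normal_distribution by (auto simp: char_def fun_eq_iff)

context prob_space
begin

text \<open>In the nondegenerate case \<open>U\<close> is literally a multiple of a standard normal
  variable, so that integrals of functions of \<open>U\<close> transfer to \<open>gauss01\<close>;
  the constant case is kept apart.\<close>

lemma gaussian_rv_centered_cases:
  assumes "gaussian_rv M U" "expectation U = 0"
  obtains "AE \<omega> in M. U \<omega> = 0" "expectation (\<lambda>\<omega>. (U \<omega>)\<^sup>2) = 0" 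
  | \<sigma> Z where "0 < \<sigma>" "expectation (\<lambda>\<omega>. (U \<omega>)\<^sup>2) = \<sigma>\<^sup>2" "Z \<in> borel_measurable M"
     "distr M borel Z = gauss01" "U = (\<lambda>\<omega>. \<sigma> * Z \<omega>)"
proof -
  have U[measurable]: "U \<in> borel_measurable M" using assms by (simp add: gaussian_rv_def)
  consider c \<sigma> where "0 < \<sigma>" "distributed M lborel U (\<lambda>x. ennreal (normal_density c \<sigma> x))"
    | c where "AE \<omega> in M. U \<omega> = c"
    using assms(1) unfolding gaussian_rv_def by blast
  thus thesis
  proof cases
    case (1 c \<sigma>)
    have c: "c = 0" using normal_distributed_expectation[OF 1] assms(2) by simp
    have "distributed M lborel (\<lambda>\<omega>. (U \<omega> - c) / \<sigma>) (\<lambda>x. ennreal (std_normal_density x))"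
      using normal_standard_normal_convert[OF 1(1), of U c] 1(2) by simp
    hence D: "distr M lborel (\<lambda>\<omega>. U \<omega> / \<sigma>) = gauss01"
      by (simp add: c distributed_def)
    have "distr M borel (\<lambda>\<omega>. U \<omega> / \<sigma>) = distr M lborel (\<lambda>\<omega>. U \<omega> / \<sigma>)"
      by (rule distr_cong) auto
    moreover have "expectation (\<lambda>\<omega>. (U \<omega>)\<^sup>2) = \<sigma>\<^sup>2"
      using normal_distributed_variance[OF 1] assms(2) by simp
    ultimately show thesis using that(2)[of \<sigma> "\<lambda>\<omega>. U \<omega> / \<sigma>"] D 1(1) by auto
  next
    case (2 c)
    have "expectation U = expectation (\<lambda>_. c)"
      using 2 by (intro integral_cong_AE) auto
    hence "c = 0" using assms(2) prob_space by simp
    hence ae: "AE \<omega> in M. U \<omega> = 0" using 2 by simp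
    hence "expectation (\<lambda>\<omega>. (U \<omega>)\<^sup>2) = expectation (\<lambda>_. 0)"
      by (intro integral_cong_AE) auto
    thus thesis using that(1) ae by simp
  qed
qed

lemma gaussian_rv_exp:
  assumes "gaussian_rv M U" "expectation U = 0"
  shows "(\<integral>\<^sup>+\<omega>. ennreal (exp (a * U \<omega>)) \<partial>M) = ennreal (exp (a\<^sup>2 * expectation (\<lambda>\<omega>. (U \<omega>)\<^sup>2) / 2))"
  using assms
proof (cases rule: gaussian_rv_centered_cases)
  case 1
  have "(\<integral>\<^sup>+\<omega>. ennreal (exp (a * U \<omega>)) \<partial>M) = (\<integral>\<^sup>+\<omega>. 1 \<partial>M)"
    using 1(1) by (intro nn_integral_cong_AE) auto
  thus ?thesis using 1(2) by (simp add: emeasure_space_1)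
next
  case (2 \<sigma> Z)
  note [measurable] = 2(3)
  have "(\<integral>\<^sup>+\<omega>. ennreal (exp (a * U \<omega>)) \<partial>M) = (\<integral>\<^sup>+x. ennreal (exp ((a * \<sigma>) * x)) \<partial>distr M borel Z)"
    by (subst nn_integral_distr) (auto simp: 2(5) mult_ac)
  thus ?thesis unfolding 2(4) by (simp add: nn_integral_exp_gauss01 2(2) power_mult_distrib)
qed

lemma gaussian_rv_char:
  assumes "gaussian_rv M U" "expectation U = 0"
  shows "(CLINT \<omega>|M. iexp (a * U \<omega>)) =
           complex_of_real (exp (- (a\<^sup>2 * expectation (\<lambda>\<omega>. (U \<omega>)\<^sup>2) / 2)))"
  using assms
proof (cases rule: gaussian_rv_centered_cases)
  case 1
  have [measurable]: "U \<in> borel_measurable M" using assms by (simp add: gaussian_rv_def)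
  have "(CLINT \<omega>|M. iexp (a * U \<omega>)) = (CLINT \<omega>|M. 1)"
    using 1(1) by (intro integral_cong_AE) auto
  thus ?thesis using 1(2) prob_space by simp
next
  case (2 \<sigma> Z)
  note [measurable] = 2(3)
  have "(CLINT \<omega>|M. iexp (a * U \<omega>)) = (CLINT x|distr M borel Z. iexp ((a * \<sigma>) * x))"
    by (subst integral_distr) (auto simp: 2(5) mult_ac)
  thus ?thesis unfolding 2(4) 
    by (simp only: char_gauss01) (simp add: 2(2) power_mult_distrib)
qed

text \<open>Both bounds linearise the square by an independent standard normal vector \<open>g\<close>:
  \<open>exp (s \<bar>W\<bar>\<^sup>2) = E\<^sub>g exp (sqrt (2 s) g \<cdot> W)\<close>, and dually with the characteristic function;
  the variable \<open>g \<cdot> W\<close> is Gaussian by assumption, so that no joint density is needed.\<close>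

lemma gaussian_quadratic_exp_upper:
  fixes W :: "'i \<Rightarrow> 'a \<Rightarrow> real"
  assumes fin: "finite A"
    and gauss: "\<And>c. gaussian_rv M (\<lambda>\<omega>. \<Sum>i\<in>A. c i * W i \<omega>)"
    and mean: "\<And>c. expectation (\<lambda>\<omega>. \<Sum>i\<in>A. c i * W i \<omega>) = 0"
    and meas: "\<And>i. i \<in> A \<Longrightarrow> W i \<in> borel_measurable M"
    and quad: "\<And>c. expectation (\<lambda>\<omega>. (\<Sum>i\<in>A. c i * W i \<omega>)\<^sup>2) \<le> \<Lambda> * (\<Sum>i\<in>A. (c i)\<^sup>2)"
    and s: "0 \<le> s" "2 * (s * \<Lambda>) < 1"
  shows "(\<integral>\<^sup>+\<omega>. ennreal (exp (s * (\<Sum>i\<in>A. (W i \<omega>)\<^sup>2))) \<partial>M) \<le>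
           ennreal ((1 / sqrt (1 - 2 * (s * \<Lambda>))) ^ card A)"
proof -
  interpret g: prob_space gauss01 by (rule prob_space_gauss01)
  interpret P: product_prob_space "\<lambda>_::'i. gauss01" A by unfold_locales
  define G where "G = Pi\<^sub>M A (\<lambda>_. gauss01)"
  interpret G: prob_space G unfolding G_def by (rule P.prob_space_axioms)
  interpret pair_sigma_finite G M ..
  define a where "a = sqrt (2 * s)"
  have a: "a\<^sup>2 = 2 * s" using s by (simp add: a_def)
  have [measurable]: "(\<lambda>x. x i) \<in> borel_measurable G" if "i \<in> A" for i
    unfolding G_def using that by (simp add: measurable_component_singleton)
  note [measurable] = meas
  have "(\<integral>\<^sup>+\<omega>. ennreal (exp (s * (\<Sum>i\<in>A. (W i \<omega>)\<^sup>2))) \<partial>M) =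
      (\<integral>\<^sup>+\<omega>. (\<integral>\<^sup>+x. ennreal (exp (a * (\<Sum>i\<in>A. x i * W i \<omega>))) \<partial>G) \<partial>M)"
  proof (intro nn_integral_cong)
    fix \<omega>
    have "(\<integral>\<^sup>+x. ennreal (exp (a * (\<Sum>i\<in>A. x i * W i \<omega>))) \<partial>G) =
        (\<integral>\<^sup>+x. (\<Prod>i\<in>A. ennreal (exp ((a * W i \<omega>) * x i))) \<partial>G)"
      by (intro nn_integral_cong) (simp add: prod_ennreal exp_sum fin sum_distrib_left mult_ac)
    also have "\<dots> = (\<Prod>i\<in>A. \<integral>\<^sup>+y. ennreal (exp ((a * W i \<omega>) * y)) \<partial>gauss01)"
      unfolding G_def by (rule P.product_nn_integral_prod) (auto simp: fin)
    also have "\<dots> = ennreal (exp (s * (\<Sum>i\<in>A. (W i \<omega>)\<^sup>2)))"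
      by (simp add: nn_integral_exp_gauss01 prod_ennreal power_mult_distrib a sum_distrib_left exp_sum fin)
    finally show "ennreal (exp (s * (\<Sum>i\<in>A. (W i \<omega>)\<^sup>2))) =
        (\<integral>\<^sup>+x. ennreal (exp (a * (\<Sum>i\<in>A. x i * W i \<omega>))) \<partial>G)" ..
  qed
  \<comment> \<open>After the exchange the inner integral, for fixed \<open>x\<close>, depends on
    the variance of a single Gaussian variable only. There the bound on the quadratic form enters,
    and it leaves an integrand that factorises over the coordinates.\<close>
  also have "\<dots> = (\<integral>\<^sup>+x. (\<integral>\<^sup>+\<omega>. ennreal (exp (a * (\<Sum>i\<in>A. x i * W i \<omega>))) \<partial>M) \<partial>G)"
    by (rule Fubini') measurable
  also have "\<dots> = (\<integral>\<^sup>+x. ennreal (exp (s * expectation (\<lambda>\<omega>. (\<Sum>i\<in>A. x i * W i \<omega>)\<^sup>2))) \<partial>G)"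
    by (subst gaussian_rv_exp[OF gauss mean]) (simp add: a)
  also have "\<dots> \<le> (\<integral>\<^sup>+x. ennreal (exp (s * (\<Lambda> * (\<Sum>i\<in>A. (x i)\<^sup>2)))) \<partial>G)"
    using quad s(1) by (intro nn_integral_mono ennreal_leI) (auto intro: mult_left_mono)
  also have "\<dots> = (\<integral>\<^sup>+x. (\<Prod>i\<in>A. ennreal (exp ((s * \<Lambda>) * (x i)\<^sup>2))) \<partial>G)"
    by (intro nn_integral_cong) (simp add: prod_ennreal exp_sum fin sum_distrib_left mult_ac)
  also have "\<dots> = (\<Prod>i\<in>A. \<integral>\<^sup>+y. ennreal (exp ((s * \<Lambda>) * y\<^sup>2)) \<partial>gauss01)"
    unfolding G_def by (rule P.product_nn_integral_prod) (auto simp: fin)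
  also have "\<dots> = ennreal ((1 / sqrt (1 - 2 * (s * \<Lambda>))) ^ card A)"
    using s by (simp add: nn_integral_exp_square_gauss01 ennreal_power)
  finally show ?thesis .
qed

lemma gaussian_quadratic_exp_lower:
  fixes W :: "'i \<Rightarrow> 'a \<Rightarrow> real"
  assumes fin: "finite A"
    and gauss: "\<And>c. gaussian_rv M (\<lambda>\<omega>. \<Sum>i\<in>A. c i * W i \<omega>)"
    and mean: "\<And>c. expectation (\<lambda>\<omega>. \<Sum>i\<in>A. c i * W i \<omega>) = 0"
    and meas: "\<And>i. i \<in> A \<Longrightarrow> W i \<in> borel_measurable M"
    and quad: "\<And>c. expectation (\<lambda>\<omega>. (\<Sum>i\<in>A. c i * W i \<omega>)\<^sup>2) \<ge> l * (\<Sum>i\<in>A. (c i)\<^sup>2)"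
    and s: "0 \<le> s" "0 \<le> l"
  shows "expectation (\<lambda>\<omega>. exp (- s * (\<Sum>i\<in>A. (W i \<omega>)\<^sup>2))) \<le>
           (1 / sqrt (1 + 2 * (s * l))) ^ card A"
proof -
  interpret g: prob_space gauss01 by (rule prob_space_gauss01)
  interpret P: product_prob_space "\<lambda>_::'i. gauss01" A by unfold_locales
  define G where "G = Pi\<^sub>M A (\<lambda>_. gauss01)"
  interpret G: prob_space G unfolding G_def by (rule P.prob_space_axioms)
  interpret pair_sigma_finite M G ..
  interpret MG: pair_prob_space M G ..
  define a where "a = sqrt (2 * s)"
  have a: "a\<^sup>2 = 2 * s" using s by (simp add: a_def)
  have [measurable]: "(\<lambda>x. x i) \<in> borel_measurable G" if "i \<in> A" for i
    unfolding G_def using that by (simp add: measurable_component_singleton)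
  note [measurable] = meas
  define E where "E x = expectation (\<lambda>\<omega>. (\<Sum>i\<in>A. x i * W i \<omega>)\<^sup>2)" for x
  have "complex_of_real (expectation (\<lambda>\<omega>. exp (- s * (\<Sum>i\<in>A. (W i \<omega>)\<^sup>2)))) =
      (CLINT \<omega>|M. complex_of_real (exp (- s * (\<Sum>i\<in>A. (W i \<omega>)\<^sup>2))))"
    by (rule integral_complex_of_real[symmetric])
  also have "\<dots> = (CLINT \<omega>|M. (CLINT x|G. iexp (a * (\<Sum>i\<in>A. x i * W i \<omega>))))"
  proof (intro Bochner_Integration.integral_cong refl)
    fix \<omega>
    have "(CLINT x|G. iexp (a * (\<Sum>i\<in>A. x i * W i \<omega>))) =
        (CLINT x|G. (\<Prod>i\<in>A. iexp ((a * W i \<omega>) * x i)))"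
      by (intro Bochner_Integration.integral_cong refl)
         (simp add: exp_sum fin sum_distrib_left mult_ac flip: exp_sum)
    also have "\<dots> = (\<Prod>i\<in>A. CLINT y|gauss01. iexp ((a * W i \<omega>) * y))"
      unfolding G_def by (rule P.product_integral_prod) (auto simp: fin intro!: g.integrable_iexp)
    also have "\<dots> = (\<Prod>i\<in>A. complex_of_real (exp (- s * (W i \<omega>)\<^sup>2)))"
      by (intro prod.cong refl, subst char_gauss01)
         (simp add: power_mult_distrib a)
    also have "\<dots> = complex_of_real (exp (- s * (\<Sum>i\<in>A. (W i \<omega>)\<^sup>2)))"
      by (simp add: exp_sum fin sum_distrib_left flip: of_real_prod sum_negf)
    finally show "complex_of_real (exp (- s * (\<Sum>i\<in>A. (W i \<omega>)\<^sup>2))) =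
        (CLINT x|G. iexp (a * (\<Sum>i\<in>A. x i * W i \<omega>)))" ..
  qed
  \<comment> \<open>The integrand has modulus one on a product of probability spaces, which
    justifies Fubini for the complex integrals.\<close>
  also have "\<dots> = (CLINT x|G. (CLINT \<omega>|M. iexp (a * (\<Sum>i\<in>A. x i * W i \<omega>))))"
    by (rule Fubini_integral[symmetric], rule MG.integrable_const_bound[of _ 1]) auto
  also have "\<dots> = (CLINT x|G. complex_of_real (exp (- (s * E x))))"
    by (subst gaussian_rv_char[OF gauss mean]) (simp add: a E_def)
  also have "\<dots> = complex_of_real (LINT x|G. exp (- (s * E x)))"
    by (rule integral_complex_of_real)
  finally have "expectation (\<lambda>\<omega>. exp (- s * (\<Sum>i\<in>A. (W i \<omega>)\<^sup>2))) = (LINT x|G. exp (- (s * E x)))"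
    by (simp only: of_real_eq_iff)
  also have "\<dots> \<le> (LINT x|G. exp (- s * (l * (\<Sum>i\<in>A. (x i)\<^sup>2))))"
  proof (rule integral_mono)
    have [measurable]: "E \<in> borel_measurable G"
      unfolding E_def by measurable
    have "0 \<le> E x" for x unfolding E_def by (rule Bochner_Integration.integral_nonneg) simp
    thus "integrable G (\<lambda>x. exp (- (s * E x)))"
      using s by (intro G.integrable_const_bound[of _ 1]) (auto)
    show "integrable G (\<lambda>x. exp (- s * (l * (\<Sum>i\<in>A. (x i)\<^sup>2))))"
      using s by (intro G.integrable_const_bound[of _ 1]) (auto intro!: mult_nonneg_nonneg sum_nonneg)
    show "exp (- (s * E x)) \<le> exp (- s * (l * (\<Sum>i\<in>A. (x i)\<^sup>2)))" for x
      using quad[of x] s(1) by (simp add: E_def mult_left_mono)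
  qed
  also have "\<dots> = (LINT x|G. (\<Prod>i\<in>A. exp ((- (s * l)) * (x i)\<^sup>2)))"
    by (intro Bochner_Integration.integral_cong refl)
       (simp add: exp_sum fin sum_distrib_left mult_ac flip: sum_negf)
  also have "\<dots> = (\<Prod>i\<in>A. LINT y|gauss01. exp ((- (s * l)) * y\<^sup>2))"
    unfolding G_def using s
    by (intro P.product_integral_prod) (auto simp: fin intro!: g.integrable_const_bound[of _ 1])
  also have "(LINT y|gauss01. exp ((- (s * l)) * y\<^sup>2)) = 1 / sqrt (1 + 2 * (s * l))"
  proof -
    have "2 * (- (s * l)) < 1" using mult_nonneg_nonneg[OF s] by simp
    from nn_integral_exp_square_gauss01[OF this] show ?thesis
      using s by (subst integral_eq_nn_integral) (auto simp: add_nonneg_nonneg)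
  qed
  finally show ?thesis by simp
qed

end

section \<open>Covariances and tail bounds in mean square\<close>

definition sq_integrable :: "'a measure \<Rightarrow> ('a \<Rightarrow> real) \<Rightarrow> bool" where
  "sq_integrable M U \<longleftrightarrow> U \<in> borel_measurable M \<and> integrable M (\<lambda>\<omega>. (U \<omega>)\<^sup>2)"

text \<open>Not centred, because the regularity assumption concerns uncentred increments; means are
  subtracted only when variances are needed, through \<open>cov_self\<close>.\<close>

definition msq :: "'a measure \<Rightarrow> ('a \<Rightarrow> real) \<Rightarrow> real" where
  "msq M U = (\<integral>\<omega>. (U \<omega>)\<^sup>2 \<partial>M)"

text \<open>The uncentred form makes bilinearity immediate; \<open>cov_centered\<close> is the link
  to \<open>cov_fun\<close>.\<close>

definition cov :: "'a measure \<Rightarrow> ('a \<Rightarrow> real) \<Rightarrow> ('a \<Rightarrow> real) \<Rightarrow> real" where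
  "cov M U V = (\<integral>\<omega>. U \<omega> * V \<omega> \<partial>M) - (\<integral>\<omega>. U \<omega> \<partial>M) * (\<integral>\<omega>. V \<omega> \<partial>M)"

lemma sq_integrableD [measurable_dest]: "sq_integrable M U \<Longrightarrow> U \<in> borel_measurable M"
  by (simp add: sq_integrable_def)

lemma sq_integrable_mult:
  assumes "sq_integrable M U" "sq_integrable M V"
  shows "integrable M (\<lambda>\<omega>. U \<omega> * V \<omega>)"
proof (rule Bochner_Integration.integrable_bound)
  show "integrable M (\<lambda>\<omega>. (U \<omega>)\<^sup>2 + (V \<omega>)\<^sup>2)"
    using assms by (auto simp: sq_integrable_def)
  show "(\<lambda>\<omega>. U \<omega> * V \<omega>) \<in> borel_measurable M"
    using assms by (auto dest: sq_integrableD)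
  have "\<bar>u * v\<bar> \<le> u\<^sup>2 + v\<^sup>2" for u v :: real
  proof -
    have "2 * (\<bar>u\<bar> * \<bar>v\<bar>) \<le> u\<^sup>2 + v\<^sup>2"
      using sum_squares_bound[of "\<bar>u\<bar>" "\<bar>v\<bar>"] by (simp add: mult.assoc)
    moreover have "0 \<le> \<bar>u\<bar> * \<bar>v\<bar>" by simp
    ultimately show ?thesis unfolding abs_mult by linarith
  qed
  thus "AE \<omega> in M. norm (U \<omega> * V \<omega>) \<le> norm ((U \<omega>)\<^sup>2 + (V \<omega>)\<^sup>2)" by auto
qed

lemma sq_integrable_cmult: "sq_integrable M U \<Longrightarrow> sq_integrable M (\<lambda>\<omega>. c * U \<omega>)"
  by (auto simp: sq_integrable_def power_mult_distrib)

lemma sq_integrable_add: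
  assumes "sq_integrable M U" "sq_integrable M V"
  shows "sq_integrable M (\<lambda>\<omega>. U \<omega> + V \<omega>)"
  using assms sq_integrable_mult[OF assms]
  by (auto simp: sq_integrable_def power2_sum mult.assoc)

lemma sq_integrable_diff:
  assumes "sq_integrable M U" "sq_integrable M V"
  shows "sq_integrable M (\<lambda>\<omega>. U \<omega> - V \<omega>)"
  using sq_integrable_add[OF assms(1) sq_integrable_cmult[OF assms(2), of "-1"]] by simp

lemma sq_integrable_sum:
  assumes "\<And>i. i \<in> A \<Longrightarrow> sq_integrable M (U i)"
  shows "sq_integrable M (\<lambda>\<omega>. \<Sum>i\<in>A. c i * U i \<omega>)"
  using assms
  by (induction A rule: infinite_finite_induct)
     (auto intro!: sq_integrable_add sq_integrable_cmult, auto simp: sq_integrable_def)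

lemma msq_nonneg: "0 \<le> msq M U"
  by (simp add: msq_def)

lemma msq_cmult: "msq M (\<lambda>\<omega>. c * U \<omega>) = c\<^sup>2 * msq M U"
  by (simp add: msq_def power_mult_distrib)

lemma msq_add_le:
  assumes "sq_integrable M U" "sq_integrable M V"
  shows "msq M (\<lambda>\<omega>. U \<omega> + V \<omega>) \<le> 2 * msq M U + 2 * msq M V"
proof -
  have "msq M (\<lambda>\<omega>. U \<omega> + V \<omega>) \<le> (\<integral>\<omega>. 2 * (U \<omega>)\<^sup>2 + 2 * (V \<omega>)\<^sup>2 \<partial>M)"
    unfolding msq_def
  proof (rule integral_mono)
    show "(U \<omega> + V \<omega>)\<^sup>2 \<le> 2 * (U \<omega>)\<^sup>2 + 2 * (V \<omega>)\<^sup>2" for \<omega>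
      using sum_squares_bound[of "U \<omega>" "V \<omega>"] by (simp add: power2_sum)
  qed (use sq_integrable_add[OF assms] assms in \<open>auto simp: sq_integrable_def\<close>)
  also have "\<dots> = 2 * msq M U + 2 * msq M V"
    using assms by (simp add: msq_def sq_integrable_def)
  finally show ?thesis .
qed

lemma msq_diff_le:
  assumes "sq_integrable M U" "sq_integrable M V"
  shows "msq M (\<lambda>\<omega>. U \<omega> - V \<omega>) \<le> 2 * msq M U + 2 * msq M V"
  using msq_add_le[OF assms(1) sq_integrable_cmult[OF assms(2), of "-1"]] msq_cmult[of M "-1" V]
  by simp

lemma Cauchy_Schwarz_msq:
  assumes "sq_integrable M U" "sq_integrable M V"
  shows "(\<integral>\<omega>. U \<omega> * V \<omega> \<partial>M)\<^sup>2 \<le> msq M U * msq M V"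
proof -
  define B where "B = (\<integral>\<omega>. U \<omega> * V \<omega> \<partial>M)"
  have pos: "0 \<le> msq M U * x\<^sup>2 + 2 * B * x * y + msq M V * y\<^sup>2" for x y
  proof -
    have "msq M U * x\<^sup>2 + 2 * B * x * y + msq M V * y\<^sup>2 =
        (\<integral>\<omega>. x\<^sup>2 * (U \<omega>)\<^sup>2 + (2 * x * y) * (U \<omega> * V \<omega>) + y\<^sup>2 * (V \<omega>)\<^sup>2 \<partial>M)"
      using assms sq_integrable_mult[OF assms]
      by (simp add: msq_def B_def sq_integrable_def)
    also have "\<dots> = (\<integral>\<omega>. (x * U \<omega> + y * V \<omega>)\<^sup>2 \<partial>M)"
      by (intro Bochner_Integration.integral_cong) (auto simp: power2_eq_square algebra_simps)
    also have "\<dots> \<ge> 0" by simp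
    finally show ?thesis .
  qed
  define p q where "p = msq M U" and "q = msq M V"
  have pq: "0 \<le> p" "0 \<le> q" by (simp_all add: p_def q_def msq_nonneg)
  have "B\<^sup>2 \<le> p * q"
  proof (cases "p = 0")
    case True
    have "0 \<le> 2 * B * x + q" for x
      using pos[of x 1] True by (simp add: p_def q_def)
    \<comment> \<open>For \<open>B \<noteq> 0\<close> the nonnegative expression
      \<open>2 * B * x + q\<close> would equal -1 at this point.\<close>
    from this[of "- (q + 1) / (2 * B)"] have "B = 0" by (cases "B = 0") auto
    thus ?thesis using True by simp
  next
    case False
    hence p: "0 < p" using pq by simp
    have "0 \<le> p * (- B)\<^sup>2 + 2 * B * (- B) * p + q * p\<^sup>2"
      using pos[of "- B" p] by (simp add: p_def q_def)
    hence "0 \<le> p * (p * q - B\<^sup>2)" by (simp add: power2_eq_square algebra_simps)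
    thus ?thesis using p by (simp add: zero_le_mult_iff)
  qed
  thus ?thesis by (simp add: B_def p_def q_def)
qed

text \<open>The triangle inequality of the \<open>L2\<close> norm in squared form: Cauchy-Schwarz
  bounds every entry of the Gram matrix by \<open>B\<close>.\<close>

lemma msq_sum_le:
  assumes U: "\<And>i. i \<in> A \<Longrightarrow> sq_integrable M (U i)"
    and B: "\<And>i. i \<in> A \<Longrightarrow> msq M (U i) \<le> B"
  shows "msq M (\<lambda>\<omega>. \<Sum>i\<in>A. c i * U i \<omega>) \<le> (\<Sum>i\<in>A. \<bar>c i\<bar>)\<^sup>2 * B"
proof -
  have ent: "\<bar>\<integral>\<omega>. U i \<omega> * U j \<omega> \<partial>M\<bar> \<le> B" if "i \<in> A" "j \<in> A" for i j
  proof -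
    have "0 \<le> B" using B[OF that(1)] msq_nonneg[of M "U i"] by linarith
    moreover have "(\<integral>\<omega>. U i \<omega> * U j \<omega> \<partial>M)\<^sup>2 \<le> B * B"
      using Cauchy_Schwarz_msq[OF U U, OF that] B that \<open>0 \<le> B\<close>
      by (meson mult_mono msq_nonneg order.trans)
    ultimately show ?thesis using abs_le_square_iff[of "\<integral>\<omega>. U i \<omega> * U j \<omega> \<partial>M" B]
      by (simp add: power2_eq_square)
  qed
  have "msq M (\<lambda>\<omega>. \<Sum>i\<in>A. c i * U i \<omega>) =
      (\<integral>\<omega>. (\<Sum>i\<in>A. \<Sum>j\<in>A. (c i * c j) * (U i \<omega> * U j \<omega>)) \<partial>M)"
    unfolding msq_def
    by (intro Bochner_Integration.integral_cong)
       (auto simp: power2_eq_square sum_product mult_ac)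
  also have "\<dots> = (\<Sum>i\<in>A. \<Sum>j\<in>A. (c i * c j) * (\<integral>\<omega>. U i \<omega> * U j \<omega> \<partial>M))"
    by (simp add: Bochner_Integration.integral_sum sq_integrable_mult U)
  also have "\<dots> \<le> (\<Sum>i\<in>A. \<Sum>j\<in>A. (\<bar>c i\<bar> * \<bar>c j\<bar>) * B)"
  proof (intro sum_mono)
    fix i j assume "i \<in> A" "j \<in> A"
    have "(c i * c j) * (\<integral>\<omega>. U i \<omega> * U j \<omega> \<partial>M) \<le> \<bar>c i * c j\<bar> * \<bar>\<integral>\<omega>. U i \<omega> * U j \<omega> \<partial>M\<bar>"
      by (metis abs_ge_self abs_mult)
    also have "\<dots> \<le> \<bar>c i * c j\<bar> * B"
      using ent \<open>i \<in> A\<close> \<open>j \<in> A\<close> by (intro mult_left_mono) auto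
    finally show "(c i * c j) * (\<integral>\<omega>. U i \<omega> * U j \<omega> \<partial>M) \<le> (\<bar>c i\<bar> * \<bar>c j\<bar>) * B"
      by (simp add: abs_mult)
  qed
  also have "\<dots> = (\<Sum>i\<in>A. \<bar>c i\<bar>)\<^sup>2 * B"
    unfolding power2_eq_square sum_product by (simp only: sum_distrib_right)
  finally show ?thesis .
qed

lemma cov_commute: "cov M U V = cov M V U"
  by (simp add: cov_def mult.commute)

context prob_space
begin

lemma sq_integrable_const: "sq_integrable M (\<lambda>_. c)"
  by (simp add: sq_integrable_def)

lemma sq_integrable_imp_integrable: "sq_integrable M U \<Longrightarrow> integrable M U"
  using sq_integrable_mult[OF _ sq_integrable_const[of 1]] by simp

lemma cov_sum_left:
  assumes "\<And>i. i \<in> A \<Longrightarrow> sq_integrable M (U i)" "sq_integrable M V"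
  shows "cov M (\<lambda>\<omega>. \<Sum>i\<in>A. c i * U i \<omega>) V = (\<Sum>i\<in>A. c i * cov M (U i) V)"
proof -
  have "integrable M (\<lambda>\<omega>. U i \<omega> * V \<omega>)" "integrable M (U i)" if "i \<in> A" for i
    using assms that by (auto intro: sq_integrable_mult sq_integrable_imp_integrable)
  thus ?thesis
    by (simp add: cov_def sum_distrib_right right_diff_distrib mult.assoc
        sum_subtractf Bochner_Integration.integral_sum)
qed

lemma cov_sum_right:
  assumes "\<And>i. i \<in> A \<Longrightarrow> sq_integrable M (U i)" "sq_integrable M V"
  shows "cov M V (\<lambda>\<omega>. \<Sum>i\<in>A. c i * U i \<omega>) = (\<Sum>i\<in>A. c i * cov M V (U i))"
  using cov_sum_left[OF assms] by (simp add: cov_commute[of M V])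

lemma cov_diff_left:
  assumes "sq_integrable M U" "sq_integrable M U'" "sq_integrable M V"
  shows "cov M (\<lambda>\<omega>. U \<omega> - U' \<omega>) V = cov M U V - cov M U' V"
proof -
  have "integrable M (\<lambda>\<omega>. U \<omega> * V \<omega>)" "integrable M U" "integrable M (\<lambda>\<omega>. U' \<omega> * V \<omega>)" "integrable M U'"
    using assms by (auto intro: sq_integrable_mult sq_integrable_imp_integrable)
  thus ?thesis by (simp add: cov_def left_diff_distrib)
qed

lemma cov_cmult_left: "cov M (\<lambda>\<omega>. c * U \<omega>) V = c * cov M U V"
  by (simp add: cov_def mult.assoc right_diff_distrib)

lemma cov_centered:
  assumes "sq_integrable M U" "sq_integrable M V"
  shows "(\<integral>\<omega>. (U \<omega> - expectation U) * (V \<omega> - expectation V) \<partial>M) = cov M U V"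
proof -
  have i: "integrable M (\<lambda>\<omega>. U \<omega> * V \<omega>)" "integrable M U" "integrable M V"
    using assms by (auto intro: sq_integrable_mult sq_integrable_imp_integrable)
  have "(\<integral>\<omega>. (U \<omega> - expectation U) * (V \<omega> - expectation V) \<partial>M) =
      (\<integral>\<omega>. U \<omega> * V \<omega> - expectation V * U \<omega> - expectation U * V \<omega> + expectation U * expectation V \<partial>M)"
    by (intro Bochner_Integration.integral_cong) (auto simp: algebra_simps)
  also have "\<dots> = cov M U V"
    using i by (simp add: cov_def prob_space)
  finally show ?thesis .
qed

lemma cov_self: "cov M U U = msq M U - (expectation U)\<^sup>2"
  by (simp add: cov_def msq_def power2_eq_square)



lemma cov_square_le:
  assumes "sq_integrable M U" "sq_integrable M V"
  shows "(cov M U V)\<^sup>2 \<le> msq M U * msq M V"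
proof -
  have c: "sq_integrable M (\<lambda>\<omega>. W \<omega> - expectation W)" if "sq_integrable M W" for W
    using that by (intro sq_integrable_diff sq_integrable_const)
  have le: "msq M (\<lambda>\<omega>. W \<omega> - expectation W) \<le> msq M W" if "sq_integrable M W" for W
    using cov_centered[OF that that] cov_self[of W] by (simp add: msq_def power2_eq_square)
  have "(cov M U V)\<^sup>2 \<le> msq M (\<lambda>\<omega>. U \<omega> - expectation U) * msq M (\<lambda>\<omega>. V \<omega> - expectation V)"
    using Cauchy_Schwarz_msq[OF c c, OF assms] cov_centered[OF assms] by simp
  also have "\<dots> \<le> msq M U * msq M V"
    using le[OF assms(1)] le[OF assms(2)] by (intro mult_mono msq_nonneg)
  finally show ?thesis .
qed

section \<open>Gaussian families and the deviations of their sums of squares\<close>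

lemma gaussian_rv_diff_const:
  assumes "gaussian_rv M U"
  shows "gaussian_rv M (\<lambda>\<omega>. U \<omega> - a)"
proof -
  have "(\<exists>c \<sigma>. 0 < \<sigma> \<and> distributed M lborel (\<lambda>\<omega>. U \<omega> - a) (\<lambda>x. ennreal (normal_density c \<sigma> x)))"
    if "0 < \<sigma>" "distributed M lborel U (\<lambda>x. ennreal (normal_density c \<sigma> x))" for c \<sigma>
    using normal_density_affine[OF that(2,1), of 1 "- a"] that(1)
    by (intro exI[of _ "- a + c"] exI[of _ \<sigma>]) simp
  moreover have "\<exists>c'. AE \<omega> in M. U \<omega> - a = c'" if "AE \<omega> in M. U \<omega> = c" for c
    using that by (intro exI[of _ "c - a"]) auto
  ultimately show ?thesis
    using assms unfolding gaussian_rv_def by (auto intro: borel_measurable_diff)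
qed

lemma gaussian_rv_sq_integrable:
  assumes "gaussian_rv M U"
  shows "sq_integrable M U"
proof -
  have U[measurable]: "U \<in> borel_measurable M" using assms by (simp add: gaussian_rv_def)
  consider c \<sigma> where "0 < \<sigma>" "distributed M lborel U (\<lambda>x. ennreal (normal_density c \<sigma> x))"
    | c where "AE \<omega> in M. U \<omega> = c"
    using assms(1) unfolding gaussian_rv_def by blast
  thus ?thesis
  proof cases
    case (1 c \<sigma>)
    have "integrable M (\<lambda>\<omega>. (U \<omega> - c)\<^sup>2)"
      using integrable_normal_moment[OF 1(1), of c 2]
        distributed_integrable[OF 1(2), of "\<lambda>x. (x - c)\<^sup>2"] by simp
    hence "sq_integrable M (\<lambda>\<omega>. U \<omega> - c)" by (simp add: sq_integrable_def)
    from sq_integrable_add[OF this sq_integrable_const[of c]] show ?thesis by simp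
  next
    case (2 c)
    have "integrable M (\<lambda>\<omega>. (U \<omega>)\<^sup>2) \<longleftrightarrow> integrable M (\<lambda>_. c\<^sup>2)"
      using 2 by (intro integrable_cong_AE) auto
    thus ?thesis by (simp add: sq_integrable_def U)
  qed
qed

context
  fixes A :: "'i set" and U :: "'i \<Rightarrow> 'a \<Rightarrow> real"
  assumes fin: "finite A"
    and gauss: "\<And>c. gaussian_rv M (\<lambda>\<omega>. \<Sum>i\<in>A. c i * U i \<omega>)"
begin

lemma gaussian_family_sq_integrable:
  assumes "i \<in> A"
  shows "sq_integrable M (U i)"
proof -
  have "(\<lambda>\<omega>. \<Sum>j\<in>A. (if j = i then 1 else 0) * U j \<omega>) = U i"
    using fin assms by (simp add: fun_eq_iff if_distrib[of "\<lambda>x. x * _"] cong: if_cong)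
  thus ?thesis using gaussian_rv_sq_integrable[OF gauss[of "\<lambda>j. if j = i then 1 else 0"]] by simp
qed

lemma gaussian_family_centered:
  defines "W \<equiv> \<lambda>i \<omega>. U i \<omega> - expectation (U i)"
  shows "gaussian_rv M (\<lambda>\<omega>. \<Sum>i\<in>A. c i * W i \<omega>)"
    and "expectation (\<lambda>\<omega>. \<Sum>i\<in>A. c i * W i \<omega>) = 0"
    and "expectation (\<lambda>\<omega>. (\<Sum>i\<in>A. c i * W i \<omega>)\<^sup>2) = (\<Sum>i\<in>A. \<Sum>j\<in>A. c i * c j * cov M (U i) (U j))"
proof -
  note sq = gaussian_family_sq_integrable
  have eq: "(\<lambda>\<omega>. \<Sum>i\<in>A. c i * W i \<omega>) =
      (\<lambda>\<omega>. (\<Sum>i\<in>A. c i * U i \<omega>) - (\<Sum>i\<in>A. c i * expectation (U i)))"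
    by (simp add: W_def right_diff_distrib sum_subtractf)
  show "gaussian_rv M (\<lambda>\<omega>. \<Sum>i\<in>A. c i * W i \<omega>)"
    unfolding eq by (rule gaussian_rv_diff_const[OF gauss])
  have E: "expectation (\<lambda>\<omega>. \<Sum>i\<in>A. c i * U i \<omega>) = (\<Sum>i\<in>A. c i * expectation (U i))"
    by (simp add: Bochner_Integration.integral_sum sq sq_integrable_imp_integrable)
  have sqs: "sq_integrable M (\<lambda>\<omega>. \<Sum>i\<in>A. c i * U i \<omega>)" by (intro sq_integrable_sum sq)
  show "expectation (\<lambda>\<omega>. \<Sum>i\<in>A. c i * W i \<omega>) = 0"
    unfolding eq using sq_integrable_imp_integrable[OF sqs] E by (simp add: prob_space)
  have "expectation (\<lambda>\<omega>. (\<Sum>i\<in>A. c i * W i \<omega>)\<^sup>2) =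
      cov M (\<lambda>\<omega>. \<Sum>i\<in>A. c i * U i \<omega>) (\<lambda>\<omega>. \<Sum>i\<in>A. c i * U i \<omega>)"
    using cov_centered[OF sqs sqs] by (simp only: fun_cong[OF eq] E power2_eq_square)
  also have "\<dots> = (\<Sum>i\<in>A. \<Sum>j\<in>A. c i * c j * cov M (U i) (U j))"
    by (simp add: cov_sum_left cov_sum_right sq sqs sum_distrib_left mult.assoc)
  finally show "expectation (\<lambda>\<omega>. (\<Sum>i\<in>A. c i * W i \<omega>)\<^sup>2) =
      (\<Sum>i\<in>A. \<Sum>j\<in>A. c i * c j * cov M (U i) (U j))" .
qed

end

text \<open>Schur test: \<open>2 * \<bar>c i * c j\<bar> \<le> (c i)\<^sup>2 + (c
  j)\<^sup>2\<close>, and by symmetry the two halves contribute the same sum over rows.\<close>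

lemma sum_abs_form_le:
  fixes K :: "'i \<Rightarrow> 'i \<Rightarrow> real"
  assumes sym: "\<And>i j. K i j = K j i" and rows: "\<And>i. i \<in> A \<Longrightarrow> (\<Sum>j\<in>A. \<bar>K i j\<bar>) \<le> \<Lambda>"
  shows "\<bar>\<Sum>i\<in>A. \<Sum>j\<in>A. c i * c j * K i j\<bar> \<le> \<Lambda> * (\<Sum>i\<in>A. (c i)\<^sup>2)"
proof -
  have "\<bar>\<Sum>i\<in>A. \<Sum>j\<in>A. c i * c j * K i j\<bar> \<le> (\<Sum>i\<in>A. \<Sum>j\<in>A. \<bar>c i * c j * K i j\<bar>)"
    by (intro order.trans[OF sum_abs] sum_mono sum_abs)
  also have "\<dots> \<le> (\<Sum>i\<in>A. \<Sum>j\<in>A. ((c i)\<^sup>2 * \<bar>K i j\<bar> + (c j)\<^sup>2 * \<bar>K i j\<bar>) / 2)"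
  proof (intro sum_mono)
    fix i j
    have "\<bar>c i * c j\<bar> \<le> ((c i)\<^sup>2 + (c j)\<^sup>2) / 2"
      using sum_squares_bound[of "\<bar>c i\<bar>" "\<bar>c j\<bar>"] by (simp add: abs_mult)
    from mult_right_mono[OF this, of "\<bar>K i j\<bar>"]
    show "\<bar>c i * c j * K i j\<bar> \<le> ((c i)\<^sup>2 * \<bar>K i j\<bar> + (c j)\<^sup>2 * \<bar>K i j\<bar>) / 2"
      by (simp add: abs_mult algebra_simps)
  qed
  also have "\<dots> = ((\<Sum>i\<in>A. \<Sum>j\<in>A. (c i)\<^sup>2 * \<bar>K i j\<bar>) + (\<Sum>i\<in>A. \<Sum>j\<in>A. (c j)\<^sup>2 * \<bar>K i j\<bar>)) / 2"
    by (simp add: sum.distrib flip: sum_divide_distrib)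
  also have "(\<Sum>i\<in>A. \<Sum>j\<in>A. (c j)\<^sup>2 * \<bar>K i j\<bar>) = (\<Sum>i\<in>A. \<Sum>j\<in>A. (c i)\<^sup>2 * \<bar>K i j\<bar>)"
    by (subst sum.swap) (simp add: sym)
  also have "((\<Sum>i\<in>A. \<Sum>j\<in>A. (c i)\<^sup>2 * \<bar>K i j\<bar>) + (\<Sum>i\<in>A. \<Sum>j\<in>A. (c i)\<^sup>2 * \<bar>K i j\<bar>)) / 2 =
      (\<Sum>i\<in>A. (c i)\<^sup>2 * (\<Sum>j\<in>A. \<bar>K i j\<bar>))"
    unfolding sum_distrib_left by simp
  also have "\<dots> \<le> (\<Sum>i\<in>A. (c i)\<^sup>2 * \<Lambda>)"
    by (intro sum_mono mult_left_mono rows) auto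
  finally show ?thesis by (simp add: sum_distrib_left mult.commute)
qed

text \<open>The exponential Markov inequality for the centred variables \<open>W i\<close>. Since
  \<open>(U i)\<^sup>2 \<le> 2 * (W i)\<^sup>2 + 2 * a\<close>, the level \<open>y\<close> becomes
  \<open>y / 2 - card A * a\<close>.\<close>

lemma gaussian_sum_squares_upper_tail:
  fixes U :: "'i \<Rightarrow> 'a \<Rightarrow> real"
  assumes fin: "finite A"
    and gauss: "\<And>c. gaussian_rv M (\<lambda>\<omega>. \<Sum>i\<in>A. c i * U i \<omega>)"
    and rows: "\<And>i. i \<in> A \<Longrightarrow> (\<Sum>j\<in>A. \<bar>cov M (U i) (U j)\<bar>) \<le> \<Lambda>" and \<Lambda>: "0 < \<Lambda>"
    and mean: "\<And>i. i \<in> A \<Longrightarrow> (expectation (U i))\<^sup>2 \<le> a"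
  shows "prob {\<omega> \<in> space M. y \<le> (\<Sum>i\<in>A. (U i \<omega>)\<^sup>2)} \<le>
           exp (real (card A) / 2 - (y / 2 - real (card A) * a) / (4 * \<Lambda>))"
proof -
  define W where "W i \<omega> = U i \<omega> - expectation (U i)" for i \<omega>
  \<comment> \<open>Half of the range in which the Laplace transform is finite: each coordinate then
    costs a factor \<open>sqrt 2\<close>, which is at most \<open>exp (1 / 2)\<close>.\<close>
  define s where "s = 1 / (4 * \<Lambda>)"
  have s: "0 < s" "2 * (s * \<Lambda>) = 1 / 2" using \<Lambda> by (auto simp: s_def)
  have meas[measurable]: "U i \<in> borel_measurable M" if "i \<in> A" for i
    using gaussian_family_sq_integrable[OF fin gauss that] by (simp add: sq_integrable_def)
  have measW[measurable]: "W i \<in> borel_measurable M" if "i \<in> A" for i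
    unfolding W_def using that by measurable
  note cent = gaussian_family_centered[OF fin gauss, folded W_def]
  define z where "z = y / 2 - real (card A) * a"
  have "(\<integral>\<^sup>+\<omega>. ennreal (exp (s * (\<Sum>i\<in>A. (W i \<omega>)\<^sup>2))) \<partial>M) \<le>
      ennreal ((1 / sqrt (1 - 2 * (s * \<Lambda>))) ^ card A)"
  proof (rule gaussian_quadratic_exp_upper[OF fin cent(1,2) measW])
    show "expectation (\<lambda>\<omega>. (\<Sum>i\<in>A. c i * W i \<omega>)\<^sup>2) \<le> \<Lambda> * (\<Sum>i\<in>A. (c i)\<^sup>2)" for c
      unfolding cent(3) using sum_abs_form_le[of "\<lambda>i j. cov M (U i) (U j)" A \<Lambda> c, OF cov_commute rows]
      by linarith
  qed (use s in auto)
  also have "\<dots> \<le> ennreal (exp (real (card A) / 2))"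
  proof (rule ennreal_leI)
    have "sqrt 2 \<le> exp (1 / 2 :: real)"
    proof (rule power2_le_imp_le)
      show "(sqrt 2)\<^sup>2 \<le> (exp (1 / 2 :: real))\<^sup>2"
        using exp_ge_add_one_self[of 1] by (simp flip: exp_double)
    qed simp
    hence "sqrt 2 ^ card A \<le> exp (1 / 2 :: real) ^ card A" by (intro power_mono) auto
    thus "(1 / sqrt (1 - 2 * (s * \<Lambda>))) ^ card A \<le> exp (real (card A) / 2)"
      by (simp add: s real_sqrt_divide flip: exp_of_nat_mult)
  qed
  finally have lap: "(\<integral>\<^sup>+\<omega>. ennreal (exp (s * (\<Sum>i\<in>A. (W i \<omega>)\<^sup>2))) \<partial>M) \<le> ennreal (exp (real (card A) / 2))" .
  have incl: "z \<le> (\<Sum>i\<in>A. (W i \<omega>)\<^sup>2)" if "y \<le> (\<Sum>i\<in>A. (U i \<omega>)\<^sup>2)" for \<omega>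
  proof -
    have "(U i \<omega>)\<^sup>2 \<le> 2 * (W i \<omega>)\<^sup>2 + 2 * a" if "i \<in> A" for i
    proof -
      have "(U i \<omega>)\<^sup>2 \<le> 2 * (W i \<omega>)\<^sup>2 + 2 * (expectation (U i))\<^sup>2"
        using sum_squares_bound[of "W i \<omega>" "expectation (U i)"] unfolding W_def
        by (simp add: power2_eq_square algebra_simps)
      thus ?thesis using mean[OF that] by linarith
    qed
    hence "(\<Sum>i\<in>A. (U i \<omega>)\<^sup>2) \<le> (\<Sum>i\<in>A. 2 * (W i \<omega>)\<^sup>2 + 2 * a)" by (rule sum_mono)
    also have "\<dots> = 2 * (\<Sum>i\<in>A. (W i \<omega>)\<^sup>2) + 2 * (real (card A) * a)"
      by (simp add: sum.distrib sum_distrib_left)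
    finally show ?thesis using that by (simp add: z_def)
  qed
  have "emeasure M {\<omega> \<in> space M. y \<le> (\<Sum>i\<in>A. (U i \<omega>)\<^sup>2)} \<le>
      emeasure M {\<omega> \<in> space M. 1 \<le> ennreal (exp (- s * z)) * ennreal (exp (s * (\<Sum>i\<in>A. (W i \<omega>)\<^sup>2)))}"
  proof (intro emeasure_mono subsetI)
    fix \<omega> assume "\<omega> \<in> {\<omega> \<in> space M. y \<le> (\<Sum>i\<in>A. (U i \<omega>)\<^sup>2)}"
    hence "\<omega> \<in> space M" "z \<le> (\<Sum>i\<in>A. (W i \<omega>)\<^sup>2)" using incl by auto
    hence "1 \<le> exp (- s * z) * exp (s * (\<Sum>i\<in>A. (W i \<omega>)\<^sup>2))"
      using s(1) by (simp flip: exp_add)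
    thus "\<omega> \<in> {\<omega> \<in> space M. 1 \<le> ennreal (exp (- s * z)) * ennreal (exp (s * (\<Sum>i\<in>A. (W i \<omega>)\<^sup>2)))}"
      using \<open>\<omega> \<in> space M\<close> by (simp flip: ennreal_mult'' ennreal_1)
  qed measurable
  also have "\<dots> \<le> ennreal (exp (- s * z)) * (\<integral>\<^sup>+\<omega>. ennreal (exp (s * (\<Sum>i\<in>A. (W i \<omega>)\<^sup>2))) \<partial>M)"
    using nn_integral_Markov_inequality[of "\<lambda>\<omega>. ennreal (exp (s * (\<Sum>i\<in>A. (W i \<omega>)\<^sup>2)))" "space M" M
        "ennreal (exp (- s * z))"]
    by (simp cong: nn_integral_cong)
  also have "\<dots> \<le> ennreal (exp (- s * z)) * ennreal (exp (real (card A) / 2))"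
    by (intro mult_left_mono lap) auto
  also have "\<dots> = ennreal (exp (- s * z) * exp (real (card A) / 2))"
    by (simp add: ennreal_mult'')
  also have "exp (- s * z) * exp (real (card A) / 2) = exp (real (card A) / 2 - z / (4 * \<Lambda>))"
    by (simp add: s_def flip: exp_add)
  finally show ?thesis
    by (simp add: emeasure_eq_measure z_def)
qed

text \<open>Off-diagonal row sums of at most \<open>d / 2\<close> against a diagonal of at least
  \<open>d\<close> make the covariance form at least \<open>d / 2\<close> times the identity. The
  Laplace transform at a negative argument then decays exponentially in the number of
  coordinates.\<close>

lemma gaussian_sum_squares_lower_tail:
  fixes U :: "'i \<Rightarrow> 'a \<Rightarrow> real"
  assumes fin: "finite A"
    and gauss: "\<And>c. gaussian_rv M (\<lambda>\<omega>. \<Sum>i\<in>A. c i * U i \<omega>)"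
    and diag: "\<And>i. i \<in> A \<Longrightarrow> d \<le> cov M (U i) (U i)" and d: "0 < d"
    and rows: "\<And>i. i \<in> A \<Longrightarrow> (\<Sum>j\<in>A - {i}. \<bar>cov M (U i) (U j)\<bar>) \<le> d / 2"
    and mean: "\<And>i. i \<in> A \<Longrightarrow> (expectation (U i))\<^sup>2 \<le> a"
  shows "prob {\<omega> \<in> space M. (\<Sum>i\<in>A. (U i \<omega>)\<^sup>2) \<le> y} \<le>
           exp (4 * (y + real (card A) * a) / d - real (card A) / 2)"
proof -
  define W where "W i \<omega> = U i \<omega> - expectation (U i)" for i \<omega>
  \<comment> \<open>Chosen so that \<open>1 + 2 * (s * (d / 2)) = 3\<close>; each coordinate
    contributes \<open>1 / sqrt 3\<close>, which is at most \<open>exp (- 1 / 2)\<close> because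
    \<open>exp 1 \<le> 3\<close>.\<close>
  define s where "s = 2 / d"
  have s: "0 < s" "2 * (s * (d / 2)) = 2" using d by (auto simp: s_def)
  have meas[measurable]: "U i \<in> borel_measurable M" if "i \<in> A" for i
    using gaussian_family_sq_integrable[OF fin gauss that] by (simp add: sq_integrable_def)
  have measW[measurable]: "W i \<in> borel_measurable M" if "i \<in> A" for i
    unfolding W_def using that by measurable
  note cent = gaussian_family_centered[OF fin gauss, folded W_def]
  define z where "z = 2 * y + 2 * (real (card A) * a)"
  define F where "F \<omega> = exp (- s * (\<Sum>i\<in>A. (W i \<omega>)\<^sup>2))" for \<omega>
  have "expectation F \<le> (1 / sqrt (1 + 2 * (s * (d / 2)))) ^ card A"
    unfolding F_def
  proof (rule gaussian_quadratic_exp_lower[OF fin cent(1,2) measW])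
    fix c :: "'i \<Rightarrow> real"
    define K where "K i j = (if i = j then 0 else cov M (U i) (U j))" for i j
    have "(\<Sum>j\<in>A. \<bar>K i j\<bar>) = (\<Sum>j\<in>A - {i}. \<bar>cov M (U i) (U j)\<bar>)" if "i \<in> A" for i
    proof -
      have "(\<Sum>j\<in>A. \<bar>K i j\<bar>) = \<bar>K i i\<bar> + (\<Sum>j\<in>A - {i}. \<bar>K i j\<bar>)"
        using that fin by (rule sum.remove[rotated])
      also have "\<dots> = (\<Sum>j\<in>A - {i}. \<bar>cov M (U i) (U j)\<bar>)"
        by (simp add: K_def, intro sum.cong) auto
      finally show ?thesis .
    qed
    hence "\<bar>\<Sum>i\<in>A. \<Sum>j\<in>A. c i * c j * K i j\<bar> \<le> d / 2 * (\<Sum>i\<in>A. (c i)\<^sup>2)"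
      using rows by (intro sum_abs_form_le) (auto simp: K_def cov_commute)
    moreover have "(\<Sum>i\<in>A. \<Sum>j\<in>A. c i * c j * cov M (U i) (U j)) =
        (\<Sum>i\<in>A. (c i)\<^sup>2 * cov M (U i) (U i)) + (\<Sum>i\<in>A. \<Sum>j\<in>A. c i * c j * K i j)"
    proof -
      have "(\<Sum>j\<in>A. c i * c j * cov M (U i) (U j)) =
          (c i)\<^sup>2 * cov M (U i) (U i) + (\<Sum>j\<in>A. c i * c j * K i j)" if "i \<in> A" for i
      proof -
        have "(\<Sum>j\<in>A. c i * c j * cov M (U i) (U j)) =
            (\<Sum>j\<in>A. (if j = i then (c i)\<^sup>2 * cov M (U i) (U i) else 0) + c i * c j * K i j)"
          by (intro sum.cong) (auto simp: K_def power2_eq_square)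
        thus ?thesis using that fin by (simp add: sum.distrib)
      qed
      thus ?thesis by (simp add: sum.distrib)
    qed
    moreover have "(\<Sum>i\<in>A. (c i)\<^sup>2 * d) \<le> (\<Sum>i\<in>A. (c i)\<^sup>2 * cov M (U i) (U i))"
      by (intro sum_mono mult_left_mono diag) auto
    ultimately show "d / 2 * (\<Sum>i\<in>A. (c i)\<^sup>2) \<le> expectation (\<lambda>\<omega>. (\<Sum>i\<in>A. c i * W i \<omega>)\<^sup>2)"
      unfolding cent(3) by (simp add: mult.commute flip: sum_distrib_left)
  qed (use s d in auto)
  also have "\<dots> \<le> exp (- (real (card A) / 2))"
  proof -
    have "exp (1 / 2) \<le> sqrt (3 :: real)"
    proof (rule power2_le_imp_le)
      show "(exp (1 / 2 :: real))\<^sup>2 \<le> (sqrt 3)\<^sup>2"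
        using exp_le by (simp flip: exp_double)
    qed simp
    hence "1 / sqrt 3 \<le> exp (- (1 / 2) :: real)"
      by (simp add: exp_minus field_simps)
    hence "(1 / sqrt 3) ^ card A \<le> exp (- (1 / 2) :: real) ^ card A" by (intro power_mono) auto
    thus ?thesis
      unfolding s(2) by (simp flip: exp_of_nat_mult)
  qed
  finally have lap: "expectation F \<le> exp (- (real (card A) / 2))" .
  have incl: "(\<Sum>i\<in>A. (W i \<omega>)\<^sup>2) \<le> z" if "(\<Sum>i\<in>A. (U i \<omega>)\<^sup>2) \<le> y" for \<omega>
  proof -
    have "(W i \<omega>)\<^sup>2 \<le> 2 * (U i \<omega>)\<^sup>2 + 2 * a" if "i \<in> A" for i
    proof -
      have "(W i \<omega>)\<^sup>2 \<le> 2 * (U i \<omega>)\<^sup>2 + 2 * (expectation (U i))\<^sup>2"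
        using sum_squares_bound[of "U i \<omega>" "- expectation (U i)"] unfolding W_def
        by (simp add: power2_eq_square algebra_simps)
      thus ?thesis using mean[OF that] by linarith
    qed
    hence "(\<Sum>i\<in>A. (W i \<omega>)\<^sup>2) \<le> (\<Sum>i\<in>A. 2 * (U i \<omega>)\<^sup>2 + 2 * a)" by (rule sum_mono)
    also have "\<dots> = 2 * (\<Sum>i\<in>A. (U i \<omega>)\<^sup>2) + 2 * (real (card A) * a)"
      by (simp add: sum.distrib sum_distrib_left)
    finally show ?thesis using that by (simp add: z_def)
  qed
  have intF: "integrable M F"
    unfolding F_def using s(1)
    by (intro integrable_const_bound[of _ 1]) (auto intro!: mult_nonneg_nonneg sum_nonneg)
  have "prob {\<omega> \<in> space M. (\<Sum>i\<in>A. (U i \<omega>)\<^sup>2) \<le> y} \<le> prob {\<omega> \<in> space M. exp (- s * z) \<le> F \<omega>}"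
  proof (intro finite_measure_mono subsetI)
    fix \<omega> assume "\<omega> \<in> {\<omega> \<in> space M. (\<Sum>i\<in>A. (U i \<omega>)\<^sup>2) \<le> y}"
    thus "\<omega> \<in> {\<omega> \<in> space M. exp (- s * z) \<le> F \<omega>}"
      using incl[of \<omega>] s(1) by (simp add: F_def mult_left_mono)
  qed (unfold F_def, measurable)
  also have "\<dots> \<le> expectation F / exp (- s * z)"
    using integral_Markov_inequality_measure[OF intF, of "{}" "exp (- s * z)"]
    by (simp add: less_imp_le[OF exp_gt_zero, of "- s * (\<Sum>i\<in>A. (W i _)\<^sup>2)", folded F_def])
  also have "\<dots> \<le> exp (- (real (card A) / 2)) / exp (- s * z)"
    by (intro divide_right_mono lap) auto
  also have "\<dots> = exp (s * z - real (card A) / 2)"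
    by (simp flip: exp_diff)
  also have "s * z = 4 * (y + real (card A) * a) / d"
    by (simp add: s_def z_def field_simps)
  finally show ?thesis .
qed

end

section \<open>Derivatives in quadratic mean\<close>

definition div_diff_rv :: "(nat \<Rightarrow> real) \<Rightarrow> (real \<Rightarrow> 'a \<Rightarrow> real) \<Rightarrow> nat \<Rightarrow> nat \<Rightarrow> 'a \<Rightarrow> real" where
  "div_diff_rv \<tau> X r k = (\<lambda>\<omega>. div_diff \<tau> 1 r k (\<lambda>s. X s \<omega>))"

lemma div_diff_rv_eq_sum:
  "div_diff_rv \<tau> X r k = (\<lambda>\<omega>. \<Sum>i=0..r. dd_coeff \<tau> 1 i k r * X (\<tau> (k + i)) \<omega>)"
  by (simp add: div_diff_rv_def div_diff_def)

lemma sq_integrable_div_diff_rv: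
  assumes "\<And>i. i \<le> r \<Longrightarrow> sq_integrable M (X (\<tau> (k + i)))"
  shows "sq_integrable M (div_diff_rv \<tau> X r k)"
  unfolding div_diff_rv_eq_sum by (intro sq_integrable_sum assms) auto

lemma div_diff_rv_recursion:
  assumes "inj_on \<tau> {k..k + Suc r}"
  shows "(\<tau> (k + Suc r) - \<tau> k) * div_diff_rv \<tau> X (Suc r) k \<omega> =
           div_diff_rv \<tau> X r (Suc k) \<omega> - div_diff_rv \<tau> X r k \<omega>"
  unfolding div_diff_rv_def by (rule div_diff_recursion[OF assms])

lemma second_order_iff: "second_order M I X \<longleftrightarrow> (\<forall>t\<in>I. sq_integrable M (X t))"
  by (simp add: second_order_def sq_integrable_def)

text \<open>Pairing with a fixed \<open>Z\<close> is a bounded linear functional, by Cauchy-Schwarz,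
  and therefore commutes with the limit of difference quotients. The result is a real function to
  which mean value theorems apply.\<close>

lemma has_qm_deriv_weak:
  assumes "has_qm_deriv M I X Y" "sq_integrable M Z" "t \<in> I"
  shows "((\<lambda>s. \<integral>\<omega>. X s \<omega> * Z \<omega> \<partial>M) has_real_derivative (\<integral>\<omega>. Y t \<omega> * Z \<omega> \<partial>M)) (at t within I)"
proof -
  have X: "sq_integrable M (X s)" and Y: "sq_integrable M (Y s)" if "s \<in> I" for s
    using assms(1) that by (auto simp: has_qm_deriv_def second_order_iff)
  have lim: "((\<lambda>s. \<integral>\<omega>. ((X s \<omega> - X t \<omega>) / (s - t) - Y t \<omega>)\<^sup>2 \<partial>M) \<longlongrightarrow> 0) (at t within I)"
    using assms by (simp add: has_qm_deriv_def)
  define E where "E s = (\<integral>\<omega>. X s \<omega> * Z \<omega> \<partial>M)" for s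
  define q where "q s = (E s - E t) / (s - t) - (\<integral>\<omega>. Y t \<omega> * Z \<omega> \<partial>M)" for s
  have le: "(q s)\<^sup>2 \<le> (\<integral>\<omega>. ((X s \<omega> - X t \<omega>) / (s - t) - Y t \<omega>)\<^sup>2 \<partial>M) * msq M Z"
    if "s \<in> I" "s \<noteq> t" for s
  proof -
    define V where "V \<omega> = (X s \<omega> - X t \<omega>) / (s - t) - Y t \<omega>" for \<omega>
    have V: "sq_integrable M V"
      using sq_integrable_diff[OF sq_integrable_cmult[OF sq_integrable_diff[OF X[OF that(1)] X[OF assms(3)]],
            of "inverse (s - t)"] Y[OF assms(3)]]
      unfolding V_def by (simp add: divide_inverse mult.commute)
    have int: "integrable M (\<lambda>\<omega>. X s \<omega> * Z \<omega>)" "integrable M (\<lambda>\<omega>. X t \<omega> * Z \<omega>)"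
      "integrable M (\<lambda>\<omega>. Y t \<omega> * Z \<omega>)"
      using X Y that assms by (auto intro: sq_integrable_mult)
    have "(\<integral>\<omega>. V \<omega> * Z \<omega> \<partial>M) =
        (\<integral>\<omega>. (X s \<omega> * Z \<omega> - X t \<omega> * Z \<omega>) / (s - t) - Y t \<omega> * Z \<omega> \<partial>M)"
      by (intro Bochner_Integration.integral_cong)
         (auto simp: V_def left_diff_distrib diff_divide_distrib)
    also have "\<dots> = q s"
      using int by (simp add: q_def E_def)
    finally have "(q s)\<^sup>2 \<le> msq M V * msq M Z"
      using Cauchy_Schwarz_msq[OF V assms(2)] by simp
    thus ?thesis by (simp add: msq_def V_def)
  qed
  have "((\<lambda>s. (q s)\<^sup>2) \<longlongrightarrow> 0) (at t within I)"
  proof (rule tendsto_sandwich[where f = "\<lambda>_. 0"])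
    show "((\<lambda>s. (\<integral>\<omega>. ((X s \<omega> - X t \<omega>) / (s - t) - Y t \<omega>)\<^sup>2 \<partial>M) * msq M Z) \<longlongrightarrow> 0) (at t within I)"
      using tendsto_mult_right[OF lim, of "msq M Z"] by simp
  qed (use le in \<open>auto simp: eventually_at_filter\<close>)
  hence "((\<lambda>s. sqrt ((q s)\<^sup>2)) \<longlongrightarrow> sqrt 0) (at t within I)" by (rule tendsto_real_sqrt)
  hence "(q \<longlongrightarrow> 0) (at t within I)" by (simp add: tendsto_rabs_zero_iff)
  thus ?thesis
    unfolding has_field_derivative_iff using LIM_zero_iff unfolding q_def E_def by blast
qed

lemma has_nth_qm_deriv_weak:
  assumes "has_nth_qm_deriv M I r X Y" "\<And>t. t \<in> I \<Longrightarrow> sq_integrable M (X t)" "sq_integrable M Z"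
  shows "has_nth_deriv_on r (\<lambda>s. \<integral>\<omega>. X s \<omega> * Z \<omega> \<partial>M) (\<lambda>s. \<integral>\<omega>. Y s \<omega> * Z \<omega> \<partial>M) I"
  using assms(1)
proof (induction r arbitrary: Y)
  case (Suc r)
  then obtain W where W: "has_nth_qm_deriv M I r X W" "has_qm_deriv M I W Y" by auto
  show ?case using Suc.IH[OF W(1)] has_qm_deriv_weak[OF W(2) assms(3)] by auto
qed auto

lemma has_nth_qm_deriv_sq_integrable:
  assumes "has_nth_qm_deriv M I r X Y" "\<And>t. t \<in> I \<Longrightarrow> sq_integrable M (X t)" "t \<in> I"
  shows "sq_integrable M (Y t)"
  using assms by (cases r) (auto simp: has_qm_deriv_def second_order_iff)

text \<open>Cauchy-Schwarz and division by the norm of \<open>U\<close>. This closes every argument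
  in which an error \<open>U\<close> is tested against itself.\<close>

lemma msq_le_of_inner_bound:
  assumes U: "sq_integrable M U" and V: "sq_integrable M V"
    and eq: "msq M U = c * (\<integral>\<omega>. V \<omega> * U \<omega> \<partial>M)"
  shows "msq M U \<le> c\<^sup>2 * msq M V"
proof (cases "msq M U = 0")
  case True
  thus ?thesis using msq_nonneg[of M V] by simp
next
  case False
  hence pos: "0 < msq M U" using msq_nonneg[of M U] by linarith
  have "msq M U * msq M U = c\<^sup>2 * (\<integral>\<omega>. V \<omega> * U \<omega> \<partial>M)\<^sup>2"
    by (subst (1 2) eq) (simp add: power2_eq_square)
  also have "\<dots> \<le> c\<^sup>2 * (msq M V * msq M U)"
    using Cauchy_Schwarz_msq[OF V U] by (intro mult_left_mono) auto
  finally show ?thesis using pos by (simp add: mult.assoc[symmetric])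
qed

text \<open>A mean value inequality in quadratic mean: the increment \<open>U = X t - X 0\<close> is
  paired with itself, so that the classical theorem yields a single intermediate point, at which the
  bound on \<open>Y\<close> is used.\<close>

lemma has_qm_deriv_bounded:
  assumes d: "has_qm_deriv M {0..T} X Y" and T: "0 \<le> T"
    and B: "\<And>t. t \<in> {0..T} \<Longrightarrow> msq M (Y t) \<le> B"
  shows "\<exists>B'. \<forall>t\<in>{0..T}. msq M (X t) \<le> B'"
proof (intro exI ballI)
  fix t assume t: "t \<in> {0..T}"
  have X: "sq_integrable M (X s)" and Y: "sq_integrable M (Y s)" if "s \<in> {0..T}" for s
    using d that by (auto simp: has_qm_deriv_def second_order_iff)
  define U where "U \<omega> = X t \<omega> - X 0 \<omega>" for \<omega>
  have U: "sq_integrable M U" unfolding U_def using X t T by (intro sq_integrable_diff) auto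
  have B0: "0 \<le> B" using B[of 0] msq_nonneg[of M "Y 0"] T by auto
  have "msq M U \<le> T\<^sup>2 * B"
  proof (cases "t = 0")
    case True
    thus ?thesis using B0 by (simp add: U_def msq_def)
  next
    case False
    define g where "g s = (\<integral>\<omega>. X s \<omega> * U \<omega> \<partial>M)" for s
    have "\<exists>\<xi>\<in>{0<..<t}. g t - g 0 = (\<lambda>v. (\<integral>\<omega>. Y \<xi> \<omega> * U \<omega> \<partial>M) * v) (t - 0)"
    proof (rule mvt_simple)
      show "0 < t" using False t by simp
      fix x assume "0 \<le> x" "x \<le> t"
      hence x: "x \<in> {0..T}" "{0..t} \<subseteq> {0..T}" using t by auto
      have "(g has_real_derivative (\<integral>\<omega>. Y x \<omega> * U \<omega> \<partial>M)) (at x within {0..t})"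
        unfolding g_def using has_qm_deriv_weak[OF d U x(1)] x(2) by (rule has_field_derivative_subset)
      thus "(g has_derivative (*) (\<integral>\<omega>. Y x \<omega> * U \<omega> \<partial>M)) (at x within {0..t})"
        by (simp add: has_field_derivative_def)
    qed
    then obtain \<xi> where \<xi>: "\<xi> \<in> {0<..<t}" "g t - g 0 = t * (\<integral>\<omega>. Y \<xi> \<omega> * U \<omega> \<partial>M)"
      by (auto simp: mult.commute)
    have "g t - g 0 = (\<integral>\<omega>. X t \<omega> * U \<omega> - X 0 \<omega> * U \<omega> \<partial>M)"
      unfolding g_def using X t T U
      by (subst Bochner_Integration.integral_diff) (auto intro: sq_integrable_mult)
    also have "\<dots> = msq M U"
      unfolding msq_def by (intro Bochner_Integration.integral_cong)
        (auto simp: U_def power2_eq_square algebra_simps)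
    finally have "msq M U \<le> t\<^sup>2 * msq M (Y \<xi>)"
      using \<xi> t by (intro msq_le_of_inner_bound U Y) auto
    also have "\<dots> \<le> T\<^sup>2 * B"
      using \<xi> t B[of \<xi>] by (intro mult_mono power_mono msq_nonneg) auto
    finally show ?thesis .
  qed
  moreover have "msq M (X t) \<le> 2 * msq M U + 2 * msq M (X 0)"
    using msq_add_le[OF U X, of 0] T by (simp add: U_def)
  ultimately show "msq M (X t) \<le> 2 * (T\<^sup>2 * B) + 2 * msq M (X 0)" by linarith
qed

text \<open>Only the derivative of top order comes with a quantitative bound; boundedness of the
  lower orders descends from it one order at a time.\<close>

lemma has_nth_qm_deriv_intermediate:
  assumes "has_nth_qm_deriv M {0..T} r0 X Y" "0 \<le> T"
    and "\<exists>B. \<forall>t\<in>{0..T}. msq M (Y t) \<le> B" and "r \<le> r0"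
  shows "\<exists>Z B. has_nth_qm_deriv M {0..T} r X Z \<and> (\<forall>t\<in>{0..T}. msq M (Z t) \<le> B)"
  using assms
proof (induction r0 arbitrary: Y)
  case (Suc r0)
  show ?case
  proof (cases "r = Suc r0")
    case True
    thus ?thesis using Suc.prems by blast
  next
    case False
    obtain W where W: "has_nth_qm_deriv M {0..T} r0 X W" "has_qm_deriv M {0..T} W Y"
      using Suc.prems(1) by auto
    have "\<exists>B. \<forall>t\<in>{0..T}. msq M (W t) \<le> B"
      using has_qm_deriv_bounded[OF W(2) Suc.prems(2)] Suc.prems(3) by blast
    thus ?thesis using Suc.IH[OF W(1)] Suc.prems False by auto
  qed
qed auto

text \<open>Testing the divided difference against the error itself turns the mean value theorem
  for real functions into a bound in quadratic mean.\<close>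

lemma div_diff_rv_approx:
  assumes d: "has_nth_qm_deriv M {0..T} r X Y" and X: "\<And>t. t \<in> {0..T} \<Longrightarrow> sq_integrable M (X t)"
    and \<tau>: "strict_mono_on {k..k + r} \<tau>" "0 \<le> \<tau> k" "\<tau> (k + r) \<le> T"
    and V: "sq_integrable M V"
    and B: "\<And>\<xi>. \<xi> \<in> {\<tau> k..\<tau> (k + r)} \<Longrightarrow> msq M (\<lambda>\<omega>. Y \<xi> \<omega> - V \<omega>) \<le> B"
  shows "msq M (\<lambda>\<omega>. fact r * div_diff_rv \<tau> X r k \<omega> - V \<omega>) \<le> B"
proof -
  have \<tau>_mem: "\<tau> (k + i) \<in> {0..T}" if "i \<le> r" for i
    using strict_mono_on_leD[OF \<tau>(1), of k "k + i"] strict_mono_on_leD[OF \<tau>(1), of "k + i" "k + r"]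
      that \<tau> by auto
  \<comment> \<open>The target \<open>V\<close> is left free: with \<open>V = 0\<close> the lemma
    bounds the divided difference itself, with \<open>V = Y (t n k)\<close> its distance from the
    derivative.\<close>
  define Z where "Z \<omega> = fact r * div_diff_rv \<tau> X r k \<omega> - V \<omega>" for \<omega>
  have sqD: "sq_integrable M (div_diff_rv \<tau> X r k)"
    using \<tau>_mem by (intro sq_integrable_div_diff_rv X) auto
  have Z: "sq_integrable M Z"
    unfolding Z_def by (intro sq_integrable_diff sq_integrable_cmult sqD V)
  define g where "g s = (\<integral>\<omega>. X s \<omega> * Z \<omega> \<partial>M)" for s
  have "has_nth_deriv_on r g (\<lambda>s. \<integral>\<omega>. Y s \<omega> * Z \<omega> \<partial>M) {\<tau> k..\<tau> (k + r)}"
    unfolding g_def using \<tau>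
    by (intro has_nth_deriv_on_subset[OF has_nth_qm_deriv_weak[OF d X Z]]) auto
  then obtain \<xi> where \<xi>: "\<xi> \<in> {\<tau> k..\<tau> (k + r)}"
    "div_diff \<tau> 1 r k g = (\<integral>\<omega>. Y \<xi> \<omega> * Z \<omega> \<partial>M) / fact r"
    using div_diff_mean_value[OF \<tau>(1)] by blast
  have sqY: "sq_integrable M (Y \<xi>)"
    using has_nth_qm_deriv_sq_integrable[OF d X] \<xi> \<tau> by auto
  have "div_diff \<tau> 1 r k g = (\<Sum>i=0..r. \<integral>\<omega>. dd_coeff \<tau> 1 i k r * (X (\<tau> (k + i)) \<omega> * Z \<omega>) \<partial>M)"
    by (simp add: div_diff_def g_def)
  also have "\<dots> = (\<integral>\<omega>. (\<Sum>i=0..r. dd_coeff \<tau> 1 i k r * (X (\<tau> (k + i)) \<omega> * Z \<omega>)) \<partial>M)"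
    using \<tau>_mem X Z by (subst Bochner_Integration.integral_sum) (auto intro: sq_integrable_mult)
  also have "\<dots> = (\<integral>\<omega>. div_diff_rv \<tau> X r k \<omega> * Z \<omega> \<partial>M)"
    by (simp add: div_diff_rv_eq_sum sum_distrib_right mult.assoc)
  finally have eq: "fact r * (\<integral>\<omega>. div_diff_rv \<tau> X r k \<omega> * Z \<omega> \<partial>M) = (\<integral>\<omega>. Y \<xi> \<omega> * Z \<omega> \<partial>M)"
    using \<xi>(2) by (simp add: field_simps)
  have i1: "integrable M (\<lambda>\<omega>. div_diff_rv \<tau> X r k \<omega> * Z \<omega>)" "integrable M (\<lambda>\<omega>. V \<omega> * Z \<omega>)"
    "integrable M (\<lambda>\<omega>. Y \<xi> \<omega> * Z \<omega>)"
    using sqD V sqY Z by (auto intro: sq_integrable_mult)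
  have "msq M Z = (\<integral>\<omega>. fact r * (div_diff_rv \<tau> X r k \<omega> * Z \<omega>) - V \<omega> * Z \<omega> \<partial>M)"
    unfolding msq_def by (intro Bochner_Integration.integral_cong)
      (auto simp: Z_def power2_eq_square algebra_simps)
  also have "\<dots> = (\<integral>\<omega>. Y \<xi> \<omega> * Z \<omega> \<partial>M) - (\<integral>\<omega>. V \<omega> * Z \<omega> \<partial>M)"
    using i1 eq by simp
  also have "\<dots> = 1 * (\<integral>\<omega>. (Y \<xi> \<omega> - V \<omega>) * Z \<omega> \<partial>M)"
    using i1 by (simp add: left_diff_distrib)
  finally have "msq M Z \<le> 1\<^sup>2 * msq M (\<lambda>\<omega>. Y \<xi> \<omega> - V \<omega>)"
    by (intro msq_le_of_inner_bound Z sq_integrable_diff sqY V)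
  also have "\<dots> \<le> B" using B[OF \<xi>(1)] by simp
  finally show ?thesis by (simp add: Z_def[abs_def])
qed

section \<open>Regularity of the design and of the process\<close>

lemma regular_design_mem:
  assumes "regular_design T \<psi> \<delta> t" "1 \<le> n" "k \<le> n"
  shows "0 \<le> t n k" "t n k \<le> T"
proof -
  have t: "strict_mono_on {0..n} (t n)" "t n 0 = 0" "t n n \<le> T"
    using assms by (auto simp: regular_design_def)
  show "0 \<le> t n k" using strict_mono_on_leD[OF t(1), of 0 k] assms t by auto
  show "t n k \<le> T" using strict_mono_on_leD[OF t(1), of k n] assms t by auto
qed

text \<open>The integral of \<psi> over each gap is \<open>\<delta> n / T\<close>, and the extrema
  of \<psi> on the compact interval convert it into a length. The upper bound uses
  \<open>n * \<delta> n \<le> T\<close>, the lower one \<open>n * \<delta> n > T / 2\<close>, which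
  holds for large \<open>n\<close> only.\<close>

lemma regular_design_gaps:
  assumes rd: "regular_design T \<psi> \<delta> t" and T: "0 < T"
  shows "\<exists>gl gu. 0 < gl \<and> 0 < gu \<and>
    (\<forall>\<^sub>F n in sequentially. \<forall>k<n. gl / real n \<le> t n (Suc k) - t n k \<and> t n (Suc k) - t n k \<le> gu / real n)"
proof -
  have cont: "continuous_on {0..T} \<psi>" and pos: "\<forall>s\<in>{0..T}. 0 < \<psi> s"
    using rd by (auto simp: regular_design_def design_density_def)
  obtain xl where xl: "xl \<in> {0..T}" "\<forall>y\<in>{0..T}. \<psi> xl \<le> \<psi> y"
    using continuous_attains_inf[OF compact_Icc _ cont] T by auto
  obtain xu where xu: "xu \<in> {0..T}" "\<forall>y\<in>{0..T}. \<psi> y \<le> \<psi> xu"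
    using continuous_attains_sup[OF compact_Icc _ cont] T by auto
  define p0 p1 where "p0 = \<psi> xl" and "p1 = \<psi> xu"
  have p: "0 < p0" "0 < p1" using pos xl xu by (auto simp: p0_def p1_def)
  have "(\<lambda>n. real n * \<delta> n) \<longlonglongrightarrow> T" using rd by (simp add: regular_design_def)
  hence "\<forall>\<^sub>F n in sequentially. T / 2 < real n * \<delta> n" using T by (intro order_tendstoD(1)) auto
  hence "\<forall>\<^sub>F n in sequentially. \<forall>k<n. 1 / (2 * p1) / real n \<le> t n (Suc k) - t n k \<and>
      t n (Suc k) - t n k \<le> 1 / p0 / real n"
    using eventually_ge_at_top[of 1]
  proof eventually_elim
    case (elim n)
    hence n: "0 < real n" by auto
    have \<delta>: "0 < \<delta> n" "real n * \<delta> n \<le> T" using rd elim by (auto simp: regular_design_def)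
    show ?case
    proof (intro allI impI)
      fix k assume k: "k < n"
      have int: "(\<psi> has_integral (real j * \<delta> n / T)) {0..t n j}" if "j \<le> n" for j
        using rd elim that by (auto simp: regular_design_def)
      have mono: "strict_mono_on {0..n} (t n)" using rd elim by (auto simp: regular_design_def)
      have lt: "t n k < t n (Suc k)" using mono k by (auto simp: strict_mono_on_def)
      have t0: "0 \<le> t n k" and t1: "t n (Suc k) \<le> T"
        using regular_design_mem[OF rd, of n] elim k by auto
      define g where "g = t n (Suc k) - t n k"
      have "integral {0..t n k} \<psi> + integral {t n k..t n (Suc k)} \<psi> = integral {0..t n (Suc k)} \<psi>"
        using lt t0 int[of "Suc k"] k by (intro Henstock_Kurzweil_Integration.integral_combine) auto
      hence I: "integral {t n k..t n (Suc k)} \<psi> = \<delta> n / T"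
        using integral_unique[OF int[of k]] integral_unique[OF int[of "Suc k"]] k
        by (simp add: distrib_right add_divide_distrib)
      have ci: "\<psi> integrable_on {t n k..t n (Suc k)}"
        using cont by (intro integrable_continuous_real) (rule continuous_on_subset, use t0 t1 in auto)
      have "integral {t n k..t n (Suc k)} (\<lambda>_. p0) \<le> integral {t n k..t n (Suc k)} \<psi>"
        using xl t0 t1 by (intro integral_le ci) (auto simp: p0_def)
      hence l: "p0 * g \<le> \<delta> n / T" using I lt by (simp add: g_def mult.commute)
      have "integral {t n k..t n (Suc k)} \<psi> \<le> integral {t n k..t n (Suc k)} (\<lambda>_. p1)"
        using xu t0 t1 by (intro integral_le ci) (auto simp: p1_def)
      hence u: "\<delta> n / T \<le> p1 * g" using I lt by (simp add: g_def mult.commute)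
      have "1 / 2 < real n * (\<delta> n / T)" using elim(1) T by (simp add: field_simps)
      also have "\<dots> \<le> real n * (p1 * g)" using u n by (intro mult_left_mono) auto
      finally have 1: "1 / (2 * p1) / real n \<le> g" using p n by (simp add: field_simps)
      have "real n * (p0 * g) \<le> real n * (\<delta> n / T)" using l n by (intro mult_left_mono) auto
      also have "\<dots> \<le> 1" using \<delta> T by (simp add: field_simps)
      finally have 2: "g \<le> 1 / p0 / real n" using p n by (simp add: field_simps)
      show "1 / (2 * p1) / real n \<le> t n (Suc k) - t n k \<and> t n (Suc k) - t n k \<le> 1 / p0 / real n"
        using 1 2 by (simp add: g_def)
    qed
  qed
  thus ?thesis using p by (intro exI[of _ "1 / (2 * p1)"] exI[of _ "1 / p0"]) auto
qed

section \<open>Hoelder bounds in quadratic mean\<close>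

lemma holder_two_sided:
  fixes Y :: "real \<Rightarrow> 'a \<Rightarrow> real"
  assumes T: "0 < T" and d0: "continuous_on {0..T} d0" "\<forall>t\<in>{0..T}. 0 < d0 t"
    and lim: "((\<lambda>h. SUP (s, t) \<in> {(s, t). s \<in> {0..T} \<and> t \<in> {0..T} \<and> \<bar>s - t\<bar> \<le> h \<and> s \<noteq> t}.
              ereal \<bar>(\<integral>\<omega>. (Y s \<omega> - Y t \<omega>)\<^sup>2 \<partial>M) / \<bar>s - t\<bar> powr (2 * \<beta>) - d0 t\<bar>)
            \<longlongrightarrow> 0) (at_right 0)"
  shows "\<exists>c1 c2 h0. 0 < c1 \<and> 0 < c2 \<and> 0 < h0 \<and> (\<forall>s\<in>{0..T}. \<forall>t\<in>{0..T}. \<bar>s - t\<bar> \<le> h0 \<longrightarrow>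
    c1 * \<bar>s - t\<bar> powr (2 * \<beta>) \<le> msq M (\<lambda>\<omega>. Y s \<omega> - Y t \<omega>) \<and>
    msq M (\<lambda>\<omega>. Y s \<omega> - Y t \<omega>) \<le> c2 * \<bar>s - t\<bar> powr (2 * \<beta>))"
proof -
  obtain xl where xl: "xl \<in> {0..T}" "\<forall>y\<in>{0..T}. d0 xl \<le> d0 y"
    using continuous_attains_inf[OF compact_Icc _ d0(1)] T by auto
  obtain xu where xu: "xu \<in> {0..T}" "\<forall>y\<in>{0..T}. d0 y \<le> d0 xu"
    using continuous_attains_sup[OF compact_Icc _ d0(1)] T by auto
  \<comment> \<open>Half the minimum of \<open>d0\<close>, so that \<open>d0 t - \<epsilon>\<close>
    is still at least \<epsilon>.\<close>
  define \<epsilon> where "\<epsilon> = d0 xl / 2"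
  have \<epsilon>: "0 < \<epsilon>" using xl d0 by (auto simp: \<epsilon>_def)
  define S where "S h = {(s, t). s \<in> {0..T} \<and> t \<in> {0..T} \<and> \<bar>s - t\<bar> \<le> h \<and> s \<noteq> t}" for h
  define F where "F = (\<lambda>(s, t). ereal \<bar>msq M (\<lambda>\<omega>. Y s \<omega> - Y t \<omega>) / \<bar>s - t\<bar> powr (2 * \<beta>) - d0 t\<bar>)"
  have "((\<lambda>h. SUP x\<in>S h. F x) \<longlongrightarrow> 0) (at_right 0)"
    using lim by (simp add: S_def F_def msq_def)
  hence "\<forall>\<^sub>F h in at_right 0. (SUP x\<in>S h. F x) < ereal \<epsilon>"
    using \<epsilon> by (intro order_tendstoD(2)) auto
  then obtain b where b: "0 < b" "\<And>h. 0 < h \<Longrightarrow> h < b \<Longrightarrow> (SUP x\<in>S h. F x) < ereal \<epsilon>"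
    unfolding eventually_at_right[OF zero_less_one] by auto
  have "\<epsilon> * \<bar>s - t\<bar> powr (2 * \<beta>) \<le> msq M (\<lambda>\<omega>. Y s \<omega> - Y t \<omega>) \<and>
      msq M (\<lambda>\<omega>. Y s \<omega> - Y t \<omega>) \<le> (d0 xu + \<epsilon>) * \<bar>s - t\<bar> powr (2 * \<beta>)"
    if st: "s \<in> {0..T}" "t \<in> {0..T}" "\<bar>s - t\<bar> \<le> b / 2" for s t
  proof (cases "s = t")
    case True
    thus ?thesis by (simp add: msq_def)
  next
    case False
    define m p where "m = msq M (\<lambda>\<omega>. Y s \<omega> - Y t \<omega>)" and "p = \<bar>s - t\<bar> powr (2 * \<beta>)"
    have p: "0 < p" using False by (simp add: p_def)
    have "F (s, t) \<le> (SUP x\<in>S (b / 2). F x)"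
      using st False by (intro SUP_upper) (auto simp: S_def)
    also have "\<dots> < ereal \<epsilon>" using b(1) by (intro b(2)) auto
    finally have "\<bar>m / p - d0 t\<bar> < \<epsilon>" by (simp add: F_def m_def p_def)
    moreover have "2 * \<epsilon> \<le> d0 t" "d0 t \<le> d0 xu" using xl xu st by (auto simp: \<epsilon>_def)
    ultimately have "\<epsilon> \<le> m / p" "m / p \<le> d0 xu + \<epsilon>" by linarith+
    hence "\<epsilon> * p \<le> m \<and> m \<le> (d0 xu + \<epsilon>) * p" using p by (simp add: field_simps)
    thus ?thesis by (simp only: m_def p_def)
  qed
  thus ?thesis using \<epsilon> b(1) d0(2) xu(1)
    by (intro exI[of _ \<epsilon>] exI[of _ "d0 xu + \<epsilon>"] exI[of _ "b / 2"]) (auto intro: add_pos_pos)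
qed

text \<open>A fixed number \<open>N\<close> of steps no longer than \<open>h0\<close> leads from 0
  to any point of the interval, and each step changes the variable by a bounded amount.\<close>

lemma holder_bounded:
  fixes Y :: "real \<Rightarrow> 'a \<Rightarrow> real"
  assumes T: "0 < T" and h0: "0 < h0" and \<beta>: "0 < \<beta>" and c2: "0 < c2"
    and Y: "\<And>t. t \<in> {0..T} \<Longrightarrow> sq_integrable M (Y t)"
    and holder: "\<And>s t. s \<in> {0..T} \<Longrightarrow> t \<in> {0..T} \<Longrightarrow> \<bar>s - t\<bar> \<le> h0 \<Longrightarrow>
      msq M (\<lambda>\<omega>. Y s \<omega> - Y t \<omega>) \<le> c2 * \<bar>s - t\<bar> powr (2 * \<beta>)"
  shows "\<exists>B. 0 < B \<and> (\<forall>t\<in>{0..T}. msq M (Y t) \<le> B)"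
proof -
  obtain N where N: "T / h0 < real N" using reals_Archimedean2 by blast
  have Npos: "0 < real N" using N T h0 by (smt (verit) divide_pos_pos)
  have step: "T / real N \<le> h0" using N Npos h0 by (simp add: field_simps)
  define B where "B = 2 * ((real N)\<^sup>2 * (c2 * h0 powr (2 * \<beta>))) + 2 * msq M (Y 0)"
  have "msq M (Y t) \<le> B" if t: "t \<in> {0..T}" for t
  proof -
    define u where "u j = real j * (t / real N)" for j :: nat
    have u_mem: "u j \<in> {0..T}" if "j \<le> N" for j
    proof -
      have "u j \<le> real N * (t / real N)"
        unfolding u_def using that t Npos by (intro mult_right_mono) auto
      thus ?thesis using t Npos by (auto simp: u_def)
    qed
    define U where "U j = (\<lambda>\<omega>. Y (u (Suc j)) \<omega> - Y (u j) \<omega>)" for j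
    have "msq M (U j) \<le> c2 * h0 powr (2 * \<beta>)" if "j < N" for j
    proof -
      have "u (Suc j) - u j = t / real N" by (simp add: u_def distrib_right add_divide_distrib)
      hence d: "\<bar>u (Suc j) - u j\<bar> = t / real N" using t Npos by simp
      have le: "t / real N \<le> h0"
        using t step Npos by (meson atLeastAtMost_iff divide_right_mono less_imp_le order_trans)
      have "msq M (U j) \<le> c2 * (t / real N) powr (2 * \<beta>)"
        unfolding U_def d[symmetric] using that d le by (intro holder u_mem) auto
      also have "\<dots> \<le> c2 * h0 powr (2 * \<beta>)"
        using le t Npos c2 \<beta> by (intro mult_left_mono powr_mono2) auto
      finally show ?thesis .
    qed
    moreover have sqU: "sq_integrable M (U j)" if "j < N" for j
      unfolding U_def using that by (intro sq_integrable_diff Y u_mem) auto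
    ultimately have "msq M (\<lambda>\<omega>. \<Sum>j\<in>{..<N}. 1 * U j \<omega>) \<le> (\<Sum>j\<in>{..<N}. \<bar>1\<bar>)\<^sup>2 * (c2 * h0 powr (2 * \<beta>))"
      by (intro msq_sum_le) auto
    moreover have "(\<lambda>\<omega>. \<Sum>j\<in>{..<N}. 1 * U j \<omega>) = (\<lambda>\<omega>. Y t \<omega> - Y 0 \<omega>)"
    proof
      fix \<omega>
      have "u N = t" "u 0 = 0" using Npos by (auto simp: u_def)
      thus "(\<Sum>j\<in>{..<N}. 1 * U j \<omega>) = Y t \<omega> - Y 0 \<omega>"
        using sum_lessThan_telescope[of "\<lambda>j. Y (u j) \<omega>" N] by (simp add: U_def)
    qed
    ultimately have "msq M (\<lambda>\<omega>. Y t \<omega> - Y 0 \<omega>) \<le> (real N)\<^sup>2 * (c2 * h0 powr (2 * \<beta>))" by simp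
    moreover have "msq M (Y t) \<le> 2 * msq M (\<lambda>\<omega>. Y t \<omega> - Y 0 \<omega>) + 2 * msq M (Y 0)"
      using msq_add_le[OF sq_integrable_diff[OF Y Y, OF t, of 0] Y, of 0] T by simp
    ultimately show ?thesis unfolding B_def by linarith
  qed
  moreover have "0 < B"
    using Npos c2 h0 msq_nonneg[of M "Y 0"] by (auto simp: B_def intro!: add_pos_nonneg mult_pos_pos)
  ultimately show ?thesis by blast
qed

text \<open>Beyond distance \<open>h0\<close> boundedness is enough, because
  \<open>\<bar>s - t\<bar> powr (2 * \<beta>)\<close> is then bounded below. Only the upper bound
  extends globally in this way; the lower one stays local.\<close>

lemma holder_global:
  fixes Y :: "real \<Rightarrow> 'a \<Rightarrow> real"
  assumes T: "0 < T" and h0: "0 < h0" and \<beta>: "0 < \<beta>" and c2: "0 < c2"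
    and Y: "\<And>t. t \<in> {0..T} \<Longrightarrow> sq_integrable M (Y t)"
    and holder: "\<And>s t. s \<in> {0..T} \<Longrightarrow> t \<in> {0..T} \<Longrightarrow> \<bar>s - t\<bar> \<le> h0 \<Longrightarrow>
      msq M (\<lambda>\<omega>. Y s \<omega> - Y t \<omega>) \<le> c2 * \<bar>s - t\<bar> powr (2 * \<beta>)"
  shows "\<exists>c. 0 < c \<and> (\<forall>s\<in>{0..T}. \<forall>t\<in>{0..T}.
      msq M (\<lambda>\<omega>. Y s \<omega> - Y t \<omega>) \<le> c * \<bar>s - t\<bar> powr (2 * \<beta>))"
proof -
  obtain B where B: "0 < B" "\<And>t. t \<in> {0..T} \<Longrightarrow> msq M (Y t) \<le> B"
    using holder_bounded[OF T h0 \<beta> c2 Y holder] by blast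
  define c where "c = c2 + 4 * B / h0 powr (2 * \<beta>)"
  have "msq M (\<lambda>\<omega>. Y s \<omega> - Y t \<omega>) \<le> c * \<bar>s - t\<bar> powr (2 * \<beta>)"
    if st: "s \<in> {0..T}" "t \<in> {0..T}" for s t
  proof (cases "\<bar>s - t\<bar> \<le> h0")
    case True
    have "c2 * \<bar>s - t\<bar> powr (2 * \<beta>) \<le> c * \<bar>s - t\<bar> powr (2 * \<beta>)"
      using B h0 by (intro mult_right_mono) (auto simp: c_def)
    thus ?thesis using holder[OF st True] by linarith
  next
    case False
    have "msq M (\<lambda>\<omega>. Y s \<omega> - Y t \<omega>) \<le> 2 * msq M (Y s) + 2 * msq M (Y t)"
      by (intro msq_diff_le Y st)
    also have "\<dots> \<le> 4 * B" using B(2)[OF st(1)] B(2)[OF st(2)] by linarith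
    also have "\<dots> = (4 * B / h0 powr (2 * \<beta>)) * h0 powr (2 * \<beta>)" using h0 by simp
    also have "\<dots> \<le> c * \<bar>s - t\<bar> powr (2 * \<beta>)"
      using False h0 B c2 \<beta> by (intro mult_mono powr_mono2) (auto simp: c_def)
    finally show ?thesis .
  qed
  thus ?thesis using c2 B h0 by (intro exI[of _ c]) (auto simp: c_def intro!: add_pos_pos)
qed

lemma Ck_on_lower_bounded:
  assumes "Ck_on n f {a..b}" "r \<le> n"
  shows "\<exists>g B. has_nth_deriv_on r f g {a..b} \<and> (\<forall>x\<in>{a..b}. \<bar>g x\<bar> \<le> B)"
proof -
  have "\<exists>h. has_nth_deriv_on r f h {a..b} \<and> continuous_on {a..b} h"
    if "has_nth_deriv_on n f g {a..b}" "continuous_on {a..b} g" "r \<le> n" for g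
    using that
  proof (induction n arbitrary: g)
    case (Suc n)
    show ?case
    proof (cases "r = Suc n")
      case False
      obtain h where h: "has_nth_deriv_on n f h {a..b}"
        "\<forall>x\<in>{a..b}. (h has_real_derivative g x) (at x within {a..b})" using Suc.prems by auto
      have "continuous_on {a..b} h"
        using h(2) unfolding continuous_on_eq_continuous_within by (blast intro: DERIV_continuous)
      thus ?thesis using Suc.IH[OF h(1)] Suc.prems False by auto
    qed (use Suc.prems in blast)
  qed auto
  then obtain h where h: "has_nth_deriv_on r f h {a..b}" "continuous_on {a..b} h"
    using assms by (auto simp: Ck_on_def)
  have "bounded (h ` {a..b})"
    using h(2) by (intro compact_imp_bounded compact_continuous_image) auto
  then obtain B where "\<forall>x\<in>{a..b}. \<bar>h x\<bar> \<le> B" by (auto simp: bounded_iff)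
  thus ?thesis using h by blast
qed

text \<open>The mean value theorem is applied in \<open>t\<close> first, to the divided difference of \<open>K\<close> in \<open>s\<close>,
  because only one intermediate point \<open>t\<close> may be used for all \<open>s\<close>.\<close>

lemma mixed_div_diff_mean_value:
  assumes mix: "has_mixed_deriv_off_diag I r r K G"
    and \<tau>: "strict_mono_on {k..l + r} \<tau>" and kl: "k + r < l" and I: "{\<tau> k..\<tau> (l + r)} \<subseteq> I"
  shows "\<exists>s\<in>{\<tau> k..\<tau> (k + r)}. \<exists>t\<in>{\<tau> l..\<tau> (l + r)}.
    (\<Sum>i=0..r. \<Sum>j=0..r. dd_coeff \<tau> 1 i k r * dd_coeff \<tau> 1 j l r * K (\<tau> (k + i)) (\<tau> (l + j))) =
      G s t / (fact r)\<^sup>2"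
proof -
  obtain H where H: "\<And>s. s \<in> I \<Longrightarrow> has_nth_deriv_on r (\<lambda>t. K s t) (\<lambda>t. H s t) (I - {s})"
    "\<And>t. t \<in> I \<Longrightarrow> has_nth_deriv_on r (\<lambda>s. H s t) (\<lambda>s. G s t) (I - {t})"
    using mix by (auto simp: has_mixed_deriv_off_diag_def)
  have le: "\<tau> i \<le> \<tau> j" if "k \<le> i" "i \<le> j" "j \<le> l + r" for i j
    using strict_mono_on_leD[OF \<tau>, of i j] that by auto
  have lt: "\<tau> (k + r) < \<tau> l" using \<tau> kl by (auto simp: strict_mono_on_def)
  \<comment> \<open>The two windows are disjoint, hence the intermediate points avoid the diagonal,
    where no derivative is available.\<close>
  define A B where "A = {\<tau> k..\<tau> (k + r)}" and "B = {\<tau> l..\<tau> (l + r)}"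
  have AI: "A \<subseteq> I" "B \<subseteq> I" "A \<inter> B = {}"
    using I le[of "k + r" "l + r"] le[of k l] kl lt by (auto simp: A_def B_def)
  have mA: "\<tau> (k + i) \<in> A" if "i \<le> r" for i
    using le[of k "k + i"] le[of "k + i" "k + r"] that kl by (auto simp: A_def)
  define \<Phi> where "\<Phi> t = (\<Sum>i=0..r. dd_coeff \<tau> 1 i k r * K (\<tau> (k + i)) t)" for t
  define \<Phi>' where "\<Phi>' t = (\<Sum>i=0..r. dd_coeff \<tau> 1 i k r * H (\<tau> (k + i)) t)" for t
  have "has_nth_deriv_on r \<Phi> \<Phi>' B"
    unfolding \<Phi>_def \<Phi>'_def
  proof (rule has_nth_deriv_on_sum)
    fix i assume "i \<in> {0..r}"
    hence "\<tau> (k + i) \<in> A" using mA by auto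
    thus "has_nth_deriv_on r (K (\<tau> (k + i))) (H (\<tau> (k + i))) B"
      using has_nth_deriv_on_subset[OF H(1), of "\<tau> (k + i)" B] AI by auto
  qed
  moreover have "strict_mono_on {l..l + r} \<tau>" "strict_mono_on {k..k + r} \<tau>"
    using \<tau> kl by (auto intro: monotone_on_subset)
  ultimately obtain t where t: "t \<in> B" "div_diff \<tau> 1 r l \<Phi> = \<Phi>' t / fact r"
    using div_diff_mean_value[of l r \<tau> \<Phi> \<Phi>'] unfolding B_def by blast
  have "has_nth_deriv_on r (\<lambda>s. H s t) (\<lambda>s. G s t) A"
    using has_nth_deriv_on_subset[OF H(2), of t A] t AI by auto
  then obtain s where s: "s \<in> A" "div_diff \<tau> 1 r k (\<lambda>s. H s t) = G s t / fact r"
    using div_diff_mean_value[of k r \<tau>] \<open>strict_mono_on {k..k + r} \<tau>\<close> unfolding A_def by blast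
  have "\<Phi>' t = G s t / fact r" using s(2) by (simp add: div_diff_def \<Phi>'_def)
  hence eq: "div_diff \<tau> 1 r l \<Phi> = G s t / (fact r)\<^sup>2" using t(2) by (simp add: power2_eq_square)
  have "div_diff \<tau> 1 r l \<Phi> =
      (\<Sum>j=0..r. \<Sum>i=0..r. dd_coeff \<tau> 1 i k r * dd_coeff \<tau> 1 j l r * K (\<tau> (k + i)) (\<tau> (l + j)))"
    by (simp add: div_diff_def \<Phi>_def sum_distrib_left mult_ac)
  also have "\<dots> = (\<Sum>i=0..r. \<Sum>j=0..r. dd_coeff \<tau> 1 i k r * dd_coeff \<tau> 1 j l r * K (\<tau> (k + i)) (\<tau> (l + j)))"
    by (rule sum.swap)
  finally have "(\<Sum>i=0..r. \<Sum>j=0..r. dd_coeff \<tau> 1 i k r * dd_coeff \<tau> 1 j l r * K (\<tau> (k + i)) (\<tau> (l + j))) =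
      G s t / (fact r)\<^sup>2"
    using eq by simp
  thus ?thesis using s(1) t(1) unfolding A_def B_def by blast
qed

section \<open>Moments of the divided differences\<close>

lemma gaussian_process_imp_gaussian_rv:
  assumes "gaussian_process M I X" "s \<in> I"
  shows "gaussian_rv M (X s)"
  using assms unfolding gaussian_process_def
  by (auto dest!: spec[of _ "{s}"] spec[of _ "\<lambda>_. 1"])

text \<open>Collects what the hypotheses provide, with constants independent of the size
  \<open>n\<close> and the index \<open>k\<close>: two-sided increments of the derivative
  \<open>Y\<close> of order \<open>r0\<close>, the off-diagonal bound on the mixed derivative, and
  gaps of order \<open>1 / n\<close> for all sizes from \<open>n0\<close> on.\<close>

locale sampled_process = prob_space M
  for M :: "'a measure" +
  fixes X Y :: "real \<Rightarrow> 'a \<Rightarrow> real" and T \<beta> c1 c2 h0 gl gu Dp :: real and r0 p n0 :: nat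
    and G :: "real \<Rightarrow> real \<Rightarrow> real" and t :: "nat \<Rightarrow> nat \<Rightarrow> real"
  assumes T: "0 < T" and gaussian: "gaussian_process M {0..T} X"
    and p: "p \<in> {1, 2}" and beta: "0 < \<beta>" "\<beta> < 1"
    and qm: "has_nth_qm_deriv M {0..T} r0 X Y"
    and holder_consts: "0 < c1" "0 < c2" "0 < h0"
    and holder_lower: "\<And>s u. s \<in> {0..T} \<Longrightarrow> u \<in> {0..T} \<Longrightarrow> \<bar>s - u\<bar> \<le> h0 \<Longrightarrow>
      c1 * \<bar>s - u\<bar> powr (2 * \<beta>) \<le> msq M (\<lambda>\<omega>. Y s \<omega> - Y u \<omega>)"
    and holder_upper: "\<And>s u. s \<in> {0..T} \<Longrightarrow> u \<in> {0..T} \<Longrightarrow>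
      msq M (\<lambda>\<omega>. Y s \<omega> - Y u \<omega>) \<le> c2 * \<bar>s - u\<bar> powr (2 * \<beta>)"
    and mixed: "has_mixed_deriv_off_diag {0..T} (r0 + p) (r0 + p) (cov_fun M X) G" "0 < Dp"
      "\<And>s u. s \<in> {0..T} \<Longrightarrow> u \<in> {0..T} \<Longrightarrow> s \<noteq> u \<Longrightarrow>
        \<bar>G s u\<bar> \<le> Dp * \<bar>s - u\<bar> powr (- (2 * real p - 2 * \<beta>))"
    and mean: "Ck_on (r0 + 1) (mean_fun M X) {0..T}"
    and n0: "1 \<le> n0"
    and design_mono: "\<And>n. n0 \<le> n \<Longrightarrow> strict_mono_on {0..n} (t n)"
    and design_mem: "\<And>n k. n0 \<le> n \<Longrightarrow> k \<le> n \<Longrightarrow> t n k \<in> {0..T}"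
    and gap_consts: "0 < gl" "0 < gu"
    and gaps: "\<And>n k. n0 \<le> n \<Longrightarrow> k < n \<Longrightarrow>
      gl / real n \<le> t n (Suc k) - t n k \<and> t n (Suc k) - t n k \<le> gu / real n"
begin

section \<open>Second moments along the design\<close>

abbreviation D :: "nat \<Rightarrow> nat \<Rightarrow> nat \<Rightarrow> 'a \<Rightarrow> real" where
  "D n r k \<equiv> div_diff_rv (t n) X r k"

lemma real_n_pos: "n0 \<le> n \<Longrightarrow> 0 < real n"
  using n0 by simp

lemma X_gaussian_rv: "s \<in> {0..T} \<Longrightarrow> gaussian_rv M (X s)"
  by (rule gaussian_process_imp_gaussian_rv[OF gaussian])

lemma sq_X: "s \<in> {0..T} \<Longrightarrow> sq_integrable M (X s)"
  by (intro gaussian_rv_sq_integrable X_gaussian_rv)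

lemma sq_Y: "s \<in> {0..T} \<Longrightarrow> sq_integrable M (Y s)"
  using has_nth_qm_deriv_sq_integrable[OF qm sq_X] .

lemma sq_D: "n0 \<le> n \<Longrightarrow> k + r \<le> n \<Longrightarrow> sq_integrable M (D n r k)"
  by (intro sq_integrable_div_diff_rv sq_X design_mem) auto

lemma mono_window: "n0 \<le> n \<Longrightarrow> k + r \<le> n \<Longrightarrow> strict_mono_on {k..k + r} (t n)"
  by (rule monotone_on_subset[OF design_mono]) auto

lemma gap_bounds:
  assumes "n0 \<le> n" "j \<le> k" "k \<le> n"
  shows "gl * (real k - real j) / real n \<le> t n k - t n j"
    and "t n k - t n j \<le> gu * (real k - real j) / real n"
proof -
  have "gl * (real k - real j) / real n \<le> t n k - t n j \<and> t n k - t n j \<le> gu * (real k - real j) / real n"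
    using assms(2,3)
  proof (induction k rule: dec_induct)
    case (step k)
    have "gl / real n \<le> t n (Suc k) - t n k" "t n (Suc k) - t n k \<le> gu / real n"
      using gaps[OF assms(1), of k] step by auto
    moreover have "gl * (real (Suc k) - real j) / real n = gl * (real k - real j) / real n + gl / real n"
      "gu * (real (Suc k) - real j) / real n = gu * (real k - real j) / real n + gu / real n"
      by (simp_all add: algebra_simps add_divide_distrib diff_divide_distrib)
    ultimately show ?case using step by auto
  qed simp
  thus "gl * (real k - real j) / real n \<le> t n k - t n j"
    "t n k - t n j \<le> gu * (real k - real j) / real n" by auto
qed

lemma D_recursion:
  assumes "n0 \<le> n" "k + Suc r \<le> n"
  shows "(t n (k + Suc r) - t n k) * D n (Suc r) k \<omega> = D n r (Suc k) \<omega> - D n r k \<omega>"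
  by (rule div_diff_rv_recursion)
     (rule strict_mono_on_imp_inj_on[OF mono_window[OF assms]])

lemma span_bounds:
  assumes "n0 \<le> n" "k + Suc r \<le> n"
  shows "gl / real n \<le> t n (k + Suc r) - t n k" "t n (k + Suc r) - t n k \<le> gu * real (Suc r) / real n"
    "0 < t n (k + Suc r) - t n k"
proof -
  have "gl * 1 / real n \<le> gl * (real (k + Suc r) - real k) / real n"
    using gap_consts by (intro divide_right_mono mult_left_mono) auto
  thus 1: "gl / real n \<le> t n (k + Suc r) - t n k"
    using gap_bounds(1)[OF assms(1), of k "k + Suc r"] assms by simp
  show "t n (k + Suc r) - t n k \<le> gu * real (Suc r) / real n"
    using gap_bounds(2)[OF assms(1), of k "k + Suc r"] assms by simp
  show "0 < t n (k + Suc r) - t n k"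
    using 1 gap_consts real_n_pos[OF assms(1)] by (smt (verit) divide_pos_pos)
qed

lemma D_diff_quotient:
  assumes "n0 \<le> n" "k + Suc r \<le> n"
  shows "D n (Suc r) k = (\<lambda>\<omega>. inverse (t n (k + Suc r) - t n k) * (D n r (Suc k) \<omega> - D n r k \<omega>))"
  using D_recursion[OF assms] span_bounds(3)[OF assms] by (auto simp: field_simps)

lemma inverse_span_le:
  assumes "n0 \<le> n" "k + Suc r \<le> n"
  shows "inverse (t n (k + Suc r) - t n k) \<le> real n / gl"
    and "0 < inverse (t n (k + Suc r) - t n k)"
proof -
  have "inverse (t n (k + Suc r) - t n k) \<le> inverse (gl / real n)"
    using span_bounds[OF assms] gap_consts real_n_pos[OF assms(1)] by (intro le_imp_inverse_le) auto
  thus "inverse (t n (k + Suc r) - t n k) \<le> real n / gl" by simp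
  show "0 < inverse (t n (k + Suc r) - t n k)" using span_bounds[OF assms] by simp
qed

lemma msq_D_Suc_le:
  assumes "n0 \<le> n" "k + Suc r \<le> n"
  shows "msq M (D n (Suc r) k) \<le> (real n / gl)\<^sup>2 * msq M (\<lambda>\<omega>. D n r (Suc k) \<omega> - D n r k \<omega>)"
  unfolding D_diff_quotient[OF assms] msq_cmult
  using inverse_span_le[OF assms] by (intro mult_right_mono power_mono msq_nonneg) auto

lemma msq_D_le_const:
  assumes "r \<le> r0"
  shows "\<exists>C>0. \<forall>n\<ge>n0. \<forall>k. k + r \<le> n \<longrightarrow> msq M (D n r k) \<le> C"
proof -
  have "\<exists>B. \<forall>s\<in>{0..T}. msq M (Y s) \<le> B"
    using holder_bounded[of T 1 \<beta> c2 M Y] T beta holder_consts sq_Y holder_upper by force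
  then obtain Z B where Z: "has_nth_qm_deriv M {0..T} r X Z" "\<forall>s\<in>{0..T}. msq M (Z s) \<le> B"
    using has_nth_qm_deriv_intermediate[OF qm _ _ assms] T by auto
  have "msq M (Z 0) \<le> B" using Z(2) T by auto
  hence B: "0 \<le> B" using msq_nonneg[of M "Z 0"] by linarith
  have "msq M (D n r k) \<le> B + 1" if n: "n0 \<le> n" "k + r \<le> n" for n k
  proof -
    \<comment> \<open>Approximation of the zero variable, which bounds the divided difference by the
      derivative of order \<open>r\<close>.\<close>
    have "msq M (\<lambda>\<omega>. fact r * D n r k \<omega> - 0) \<le> B"
    proof (rule div_diff_rv_approx[OF Z(1) sq_X])
      show "strict_mono_on {k..k + r} (t n)" using n by (rule mono_window)
      show "0 \<le> t n k" "t n (k + r) \<le> T" using design_mem[OF n(1)] n(2) by auto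
      fix \<xi> assume "\<xi> \<in> {t n k..t n (k + r)}"
      hence "\<xi> \<in> {0..T}" using \<open>0 \<le> t n k\<close> \<open>t n (k + r) \<le> T\<close> by auto
      thus "msq M (\<lambda>\<omega>. Z \<xi> \<omega> - 0) \<le> B" using Z(2) by auto
    qed (auto simp: sq_integrable_def)
    hence "(fact r)\<^sup>2 * msq M (D n r k) \<le> B" by (simp add: msq_cmult)
    moreover have "1 * msq M (D n r k) \<le> (fact r)\<^sup>2 * msq M (D n r k)"
      by (intro mult_right_mono msq_nonneg) (simp add: fact_ge_1 one_le_power)
    ultimately show ?thesis by linarith
  qed
  thus ?thesis using B by (intro exI[of _ "B + 1"]) auto
qed

text \<open>A window has length of order \<open>1 / n\<close>, and \<open>Y\<close> varies over it
  by at most \<open>real n powr (- (2 * \<beta>))\<close> in mean square, up to a constant.\<close>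

lemma msq_D_approx_Y:
  "\<exists>C>0. \<forall>n\<ge>n0. \<forall>k. k + r0 \<le> n \<longrightarrow>
     msq M (\<lambda>\<omega>. fact r0 * D n r0 k \<omega> - Y (t n k) \<omega>) \<le> C * real n powr (- (2 * \<beta>))"
proof -
  define C where "C = c2 * (gu * real r0) powr (2 * \<beta>)"
  have C: "0 \<le> C" using holder_consts by (simp add: C_def)
  have "msq M (\<lambda>\<omega>. fact r0 * D n r0 k \<omega> - Y (t n k) \<omega>) \<le> (C + 1) * real n powr (- (2 * \<beta>))"
    if n: "n0 \<le> n" "k + r0 \<le> n" for n k
  proof -
    have "msq M (\<lambda>\<omega>. fact r0 * D n r0 k \<omega> - Y (t n k) \<omega>) \<le> C * real n powr (- (2 * \<beta>))"
    proof (rule div_diff_rv_approx[OF qm sq_X])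
      show "strict_mono_on {k..k + r0} (t n)" using n by (rule mono_window)
      show 1: "0 \<le> t n k" "t n (k + r0) \<le> T" using design_mem[OF n(1)] n(2) by auto
      show "sq_integrable M (Y (t n k))" using n by (intro sq_Y design_mem) auto
      fix \<xi> assume \<xi>: "\<xi> \<in> {t n k..t n (k + r0)}"
      hence \<xi>T: "\<xi> \<in> {0..T}" using 1 by auto
      have "\<bar>\<xi> - t n k\<bar> \<le> gu * real r0 / real n"
        using \<xi> gap_bounds(2)[OF n(1), of k "k + r0"] n by auto
      hence "\<bar>\<xi> - t n k\<bar> powr (2 * \<beta>) \<le> (gu * real r0 / real n) powr (2 * \<beta>)"
        using beta by (intro powr_mono2) auto
      also have "\<dots> = (gu * real r0) powr (2 * \<beta>) * real n powr (- (2 * \<beta>))"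
        using gap_consts by (simp add: powr_divide powr_minus_divide)
      finally have "c2 * \<bar>\<xi> - t n k\<bar> powr (2 * \<beta>) \<le> C * real n powr (- (2 * \<beta>))"
        using holder_consts by (simp add: C_def mult.assoc)
      thus "msq M (\<lambda>\<omega>. Y \<xi> \<omega> - Y (t n k) \<omega>) \<le> C * real n powr (- (2 * \<beta>))"
        using holder_upper[OF \<xi>T design_mem, of n k] n by simp
    qed
    thus ?thesis by (simp add: distrib_right add_increasing2)
  qed
  thus ?thesis using C by (intro exI[of _ "C + 1"]) auto
qed

text \<open>Both divided differences are replaced by \<open>Y\<close> at their left nodes. The
  approximation errors have the size of an increment over one gap and are absorbed because
  \<open>1 \<le> h\<close>.\<close>

lemma msq_D_increment:
  "\<exists>C>0. \<forall>n\<ge>n0. \<forall>k h. 1 \<le> h \<longrightarrow> k + h + r0 \<le> n \<longrightarrow>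
     msq M (\<lambda>\<omega>. D n r0 (k + h) \<omega> - D n r0 k \<omega>) \<le> C * (real h / real n) powr (2 * \<beta>)"
proof -
  obtain C where C: "0 < C" "\<And>n k. n0 \<le> n \<Longrightarrow> k + r0 \<le> n \<Longrightarrow>
     msq M (\<lambda>\<omega>. fact r0 * D n r0 k \<omega> - Y (t n k) \<omega>) \<le> C * real n powr (- (2 * \<beta>))"
    using msq_D_approx_Y by blast
  define C' where "C' = 8 * C + 2 * c2 * gu powr (2 * \<beta>)"
  have "msq M (\<lambda>\<omega>. D n r0 (k + h) \<omega> - D n r0 k \<omega>) \<le> C' * (real h / real n) powr (2 * \<beta>)"
    if n: "n0 \<le> n" "1 \<le> h" "k + h + r0 \<le> n" for n k h
  proof -
    define E where "E j \<omega> = fact r0 * D n r0 j \<omega> - Y (t n j) \<omega>" for j \<omega>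
    have sE: "sq_integrable M (E j)" if "j + r0 \<le> n" for j
      unfolding E_def using that n
      by (intro sq_integrable_diff sq_integrable_cmult sq_D sq_Y design_mem) auto
    have mE: "msq M (E j) \<le> C * real n powr (- (2 * \<beta>))" if "j + r0 \<le> n" for j
      using C(2)[OF n(1) that] by (simp add: E_def[abs_def])
    define P where "P = (real h / real n) powr (2 * \<beta>)"
    have "real n powr (- (2 * \<beta>)) = (1 / real n) powr (2 * \<beta>)"
      by (simp add: powr_divide powr_minus_divide)
    also have "\<dots> \<le> P"
      unfolding P_def using n beta by (intro powr_mono2 divide_right_mono) auto
    finally have nP: "real n powr (- (2 * \<beta>)) \<le> P" .
    have mEP: "msq M (E j) \<le> C * P" if "j + r0 \<le> n" for j
      using mE[OF that] mult_left_mono[OF nP, of C] C(1) by linarith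
    have sY: "sq_integrable M (Y (t n j))" if "j \<le> n" for j
      using that n by (intro sq_Y design_mem)
    have "msq M (\<lambda>\<omega>. fact r0 * (D n r0 (k + h) \<omega> - D n r0 k \<omega>)) =
        msq M (\<lambda>\<omega>. (E (k + h) \<omega> - E k \<omega>) + (Y (t n (k + h)) \<omega> - Y (t n k) \<omega>))"
      by (simp add: E_def algebra_simps)
    also have "\<dots> \<le> 2 * msq M (\<lambda>\<omega>. E (k + h) \<omega> - E k \<omega>) + 2 * msq M (\<lambda>\<omega>. Y (t n (k + h)) \<omega> - Y (t n k) \<omega>)"
      using n by (intro msq_add_le sq_integrable_diff sE sY) auto
    also have "msq M (\<lambda>\<omega>. E (k + h) \<omega> - E k \<omega>) \<le> 2 * msq M (E (k + h)) + 2 * msq M (E k)"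
      using n by (intro msq_diff_le sE) auto
    also have "\<dots> \<le> 4 * (C * P)" using mEP[of k] mEP[of "k + h"] n by simp
    also have "msq M (\<lambda>\<omega>. Y (t n (k + h)) \<omega> - Y (t n k) \<omega>) \<le> c2 * (gu powr (2 * \<beta>) * P)"
    proof -
      have m: "t n k \<le> t n (k + h)"
        using strict_mono_on_leD[OF design_mono[OF n(1)], of k "k + h"] n by auto
      have "\<bar>t n (k + h) - t n k\<bar> \<le> gu * real h / real n"
        using gap_bounds(2)[OF n(1), of k "k + h"] n m by auto
      hence "\<bar>t n (k + h) - t n k\<bar> powr (2 * \<beta>) \<le> (gu * (real h / real n)) powr (2 * \<beta>)"
        using beta by (intro powr_mono2) auto
      also have "\<dots> = gu powr (2 * \<beta>) * P"
        unfolding P_def using gap_consts by (subst powr_mult[symmetric]) auto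
      finally have "c2 * \<bar>t n (k + h) - t n k\<bar> powr (2 * \<beta>) \<le> c2 * (gu powr (2 * \<beta>) * P)"
        using holder_consts by simp
      thus ?thesis using holder_upper[OF design_mem design_mem, of n "k + h" n k] n by simp
    qed
    finally have "(fact r0)\<^sup>2 * msq M (\<lambda>\<omega>. D n r0 (k + h) \<omega> - D n r0 k \<omega>) \<le>
        2 * (4 * (C * P)) + 2 * (c2 * (gu powr (2 * \<beta>) * P))"
      unfolding msq_cmult by simp
    also have "\<dots> = C' * P" by (simp add: C'_def algebra_simps)
    finally have "(fact r0)\<^sup>2 * msq M (\<lambda>\<omega>. D n r0 (k + h) \<omega> - D n r0 k \<omega>) \<le> C' * P" .
    moreover have "1 * msq M (\<lambda>\<omega>. D n r0 (k + h) \<omega> - D n r0 k \<omega>) \<le>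
        (fact r0)\<^sup>2 * msq M (\<lambda>\<omega>. D n r0 (k + h) \<omega> - D n r0 k \<omega>)"
      by (intro mult_right_mono msq_nonneg) (simp add: fact_ge_1 one_le_power)
    ultimately show ?thesis by (simp add: P_def)
  qed
  moreover have "0 < C'" using C holder_consts gap_consts by (auto simp: C'_def intro!: add_pos_nonneg)
  ultimately show ?thesis by blast
qed

lemma n_powr_simps:
  assumes "0 < real n"
  shows "(real n)\<^sup>2 * real n powr a = real n powr (2 + a)"
  using powr_add[of "real n" 2 a] assms by simp

lemma msq_D_Suc_r0:
  "\<exists>C>0. \<forall>n\<ge>n0. \<forall>k. k + Suc r0 \<le> n \<longrightarrow> msq M (D n (Suc r0) k) \<le> C * real n powr (2 - 2 * \<beta>)"
proof -
  obtain C where C: "0 < C" "\<And>n k h. n0 \<le> n \<Longrightarrow> 1 \<le> h \<Longrightarrow> k + h + r0 \<le> n \<Longrightarrow>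
     msq M (\<lambda>\<omega>. D n r0 (k + h) \<omega> - D n r0 k \<omega>) \<le> C * (real h / real n) powr (2 * \<beta>)"
    using msq_D_increment by blast
  have "msq M (D n (Suc r0) k) \<le> C / gl\<^sup>2 * real n powr (2 - 2 * \<beta>)"
    if n: "n0 \<le> n" "k + Suc r0 \<le> n" for n k
  proof -
    note pos = real_n_pos[OF n(1)]
    have "msq M (D n (Suc r0) k) \<le> (real n / gl)\<^sup>2 * msq M (\<lambda>\<omega>. D n r0 (Suc k) \<omega> - D n r0 k \<omega>)"
      using n by (rule msq_D_Suc_le)
    also have "\<dots> \<le> (real n / gl)\<^sup>2 * (C * (1 / real n) powr (2 * \<beta>))"
      using C(2)[OF n(1), of 1 k] n by (intro mult_left_mono) auto
    also have "(1 / real n) powr (2 * \<beta>) = real n powr (- (2 * \<beta>))"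
      by (simp add: powr_divide powr_minus_divide)
    also have "(real n / gl)\<^sup>2 * (C * real n powr (- (2 * \<beta>))) =
        C / gl\<^sup>2 * ((real n)\<^sup>2 * real n powr (- (2 * \<beta>)))"
      by (simp add: power_divide)
    also have "\<dots> = C / gl\<^sup>2 * real n powr (2 - 2 * \<beta>)"
      by (simp add: n_powr_simps[OF pos])
    finally show ?thesis .
  qed
  moreover have "0 < C / gl\<^sup>2" using C gap_consts by simp
  ultimately show ?thesis by blast
qed

lemma msq_D_Suc_Suc_r0:
  "\<exists>C>0. \<forall>n\<ge>n0. \<forall>k. k + Suc (Suc r0) \<le> n \<longrightarrow>
     msq M (D n (Suc (Suc r0)) k) \<le> C * real n powr (4 - 2 * \<beta>)"
proof -
  obtain C where C: "0 < C" "\<And>n k. n0 \<le> n \<Longrightarrow> k + Suc r0 \<le> n \<Longrightarrow>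
     msq M (D n (Suc r0) k) \<le> C * real n powr (2 - 2 * \<beta>)"
    using msq_D_Suc_r0 by blast
  have "msq M (D n (Suc (Suc r0)) k) \<le> 4 * C / gl\<^sup>2 * real n powr (4 - 2 * \<beta>)"
    if n: "n0 \<le> n" "k + Suc (Suc r0) \<le> n" for n k
  proof -
    note pos = real_n_pos[OF n(1)]
    have "msq M (D n (Suc (Suc r0)) k) \<le>
        (real n / gl)\<^sup>2 * msq M (\<lambda>\<omega>. D n (Suc r0) (Suc k) \<omega> - D n (Suc r0) k \<omega>)"
      using n by (rule msq_D_Suc_le)
    also have "msq M (\<lambda>\<omega>. D n (Suc r0) (Suc k) \<omega> - D n (Suc r0) k \<omega>) \<le>
        2 * msq M (D n (Suc r0) (Suc k)) + 2 * msq M (D n (Suc r0) k)"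
      using n by (intro msq_diff_le sq_D) auto
    also have "\<dots> \<le> 4 * (C * real n powr (2 - 2 * \<beta>))"
      using C(2)[OF n(1), of k] C(2)[OF n(1), of "Suc k"] n by simp
    also have "(real n / gl)\<^sup>2 * (4 * (C * real n powr (2 - 2 * \<beta>))) =
        4 * C / gl\<^sup>2 * ((real n)\<^sup>2 * real n powr (2 - 2 * \<beta>))"
      by (simp add: power_divide)
    also have "\<dots> = 4 * C / gl\<^sup>2 * real n powr (4 - 2 * \<beta>)"
      by (simp add: n_powr_simps[OF pos])
    finally show ?thesis by (simp add: mult_left_mono)
  qed
  moreover have "0 < 4 * C / gl\<^sup>2" using C gap_consts by simp
  ultimately show ?thesis by blast
qed

section \<open>Means of the divided differences\<close>

lemma expectation_D:
  assumes "n0 \<le> n" "k + r \<le> n"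
  shows "expectation (D n r k) = div_diff (t n) 1 r k (mean_fun M X)"
proof -
  have "expectation (D n r k) = (\<Sum>i=0..r. dd_coeff (t n) 1 i k r * expectation (X (t n (k + i))))"
    unfolding div_diff_rv_eq_sum using assms
    by (subst Bochner_Integration.integral_sum)
       (auto intro!: sq_integrable_imp_integrable sq_X design_mem[OF assms(1)] simp del: One_nat_def)
  thus ?thesis by (simp add: div_diff_def mean_fun_def)
qed

lemma expectation_D_bounded:
  assumes "r \<le> Suc r0"
  shows "\<exists>C>0. \<forall>n\<ge>n0. \<forall>k. k + r \<le> n \<longrightarrow> \<bar>expectation (D n r k)\<bar> \<le> C"
proof -
  obtain g B where g: "has_nth_deriv_on r (mean_fun M X) g {0..T}" "\<forall>x\<in>{0..T}. \<bar>g x\<bar> \<le> B"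
    using Ck_on_lower_bounded[OF mean, of r] assms by auto
  have "\<bar>expectation (D n r k)\<bar> \<le> \<bar>B\<bar> + 1" if n: "n0 \<le> n" "k + r \<le> n" for n k
  proof -
    have sub: "{t n k..t n (k + r)} \<subseteq> {0..T}"
      using design_mem[OF n(1), of k] design_mem[OF n(1), of "k + r"] n by auto
    obtain \<xi> where \<xi>: "\<xi> \<in> {t n k..t n (k + r)}"
      "div_diff (t n) 1 r k (mean_fun M X) = g \<xi> / fact r"
      using div_diff_mean_value[OF mono_window[OF n] has_nth_deriv_on_subset[OF g(1) sub]] by blast
    have "\<bar>g \<xi> / fact r\<bar> \<le> \<bar>g \<xi>\<bar> / 1"
      unfolding abs_divide by (intro divide_left_mono) (auto simp: fact_ge_1)
    moreover have "\<bar>g \<xi>\<bar> \<le> B" using g(2) \<xi>(1) sub by blast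
    ultimately show ?thesis unfolding expectation_D[OF n] \<xi>(2) by linarith
  qed
  thus ?thesis by (intro exI[of _ "\<bar>B\<bar> + 1"]) auto
qed

text \<open>The mean is controlled up to order \<open>r0 + 1\<close>, so the last difference
  quotient costs a factor \<open>n\<close>. Its square is still negligible against
  \<open>real n powr (4 - 2 * \<beta>)\<close>, as \<open>\<beta> < 1\<close>.\<close>

lemma expectation_D_Suc_Suc_r0:
  "\<exists>C>0. \<forall>n\<ge>n0. \<forall>k. k + Suc (Suc r0) \<le> n \<longrightarrow> \<bar>expectation (D n (Suc (Suc r0)) k)\<bar> \<le> C * real n"
proof -
  obtain C where C: "0 < C" "\<And>n k. n0 \<le> n \<Longrightarrow> k + Suc r0 \<le> n \<Longrightarrow> \<bar>expectation (D n (Suc r0) k)\<bar> \<le> C"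
    using expectation_D_bounded[of "Suc r0"] by blast
  have "\<bar>expectation (D n (Suc (Suc r0)) k)\<bar> \<le> 2 * C / gl * real n"
    if n: "n0 \<le> n" "k + Suc (Suc r0) \<le> n" for n k
  proof -
    have "expectation (D n (Suc (Suc r0)) k) = inverse (t n (k + Suc (Suc r0)) - t n k) *
        (expectation (D n (Suc r0) (Suc k)) - expectation (D n (Suc r0) k))"
      unfolding D_diff_quotient[OF n] using n
      by (subst integral_mult_right_zero, subst Bochner_Integration.integral_diff)
         (auto intro!: sq_integrable_imp_integrable sq_D)
    also have "\<bar>\<dots>\<bar> \<le> real n / gl * (2 * C)"
      unfolding abs_mult using inverse_span_le[OF n] C(2)[OF n(1), of k] C(2)[OF n(1), of "Suc k"] n C(1)
        gap_consts
      by (intro mult_mono) auto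
    finally show ?thesis by (simp add: mult.commute)
  qed
  moreover have "0 < 2 * C / gl" using C gap_consts by simp
  ultimately show ?thesis by blast
qed

end

section \<open>Covariances of the divided differences\<close>

text \<open>Brings bounds near the diagonal, where nothing decays, into the decaying form that holds
  away from it.\<close>

lemma one_le_powr_near:
  fixes x L :: real
  assumes "1 \<le> x" "x \<le> L" "0 \<le> \<kappa>"
  shows "1 \<le> L powr \<kappa> * x powr (- \<kappa>)"
proof -
  have "1 = x powr \<kappa> * x powr (- \<kappa>)" using assms by (simp flip: powr_add)
  also have "\<dots> \<le> L powr \<kappa> * x powr (- \<kappa>)"
    using assms by (intro mult_right_mono powr_mono2) auto
  finally show ?thesis .
qed

context prob_space
begin

lemma cov_abs_le:
  assumes "sq_integrable M U" "sq_integrable M V" "msq M U \<le> a" "msq M V \<le> b"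
  shows "\<bar>cov M U V\<bar> \<le> sqrt (a * b)"
proof -
  have "0 \<le> a" using msq_nonneg[of M U] assms(3) by linarith
  hence "(cov M U V)\<^sup>2 \<le> a * b"
    using cov_square_le[OF assms(1,2)] assms(3,4)
    by (meson mult_mono msq_nonneg order_trans)
  thus ?thesis by (rule real_le_rsqrt[of "\<bar>_\<bar>", simplified])
qed

lemma cov_cmult_right: "cov M V (\<lambda>\<omega>. c * U \<omega>) = c * cov M V U"
  using cov_cmult_left[of c U V] by (simp only: cov_commute[of M V])

lemma cov_diff_right:
  assumes "sq_integrable M U" "sq_integrable M U'" "sq_integrable M V"
  shows "cov M V (\<lambda>\<omega>. U \<omega> - U' \<omega>) = cov M V U - cov M V U'"
  using cov_diff_left[OF assms] by (simp only: cov_commute[of M V])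

lemma cov_lincomb_abs_le:
  assumes "\<And>i. i \<in> A \<Longrightarrow> sq_integrable M (U i)" "\<And>j. j \<in> B \<Longrightarrow> sq_integrable M (V j)"
    and "\<And>i j. i \<in> A \<Longrightarrow> j \<in> B \<Longrightarrow> \<bar>cov M (U i) (V j)\<bar> \<le> K"
    and "\<And>i. i \<in> A \<Longrightarrow> \<bar>a i\<bar> \<le> x" "\<And>j. j \<in> B \<Longrightarrow> \<bar>b j\<bar> \<le> y"
    and "0 \<le> K" "0 \<le> x" "0 \<le> y"
  shows "\<bar>cov M (\<lambda>\<omega>. \<Sum>i\<in>A. a i * U i \<omega>) (\<lambda>\<omega>. \<Sum>j\<in>B. b j * V j \<omega>)\<bar> \<le>
           real (card A) * real (card B) * (x * y * K)"
proof -
  have "cov M (\<lambda>\<omega>. \<Sum>i\<in>A. a i * U i \<omega>) (\<lambda>\<omega>. \<Sum>j\<in>B. b j * V j \<omega>) =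
      (\<Sum>i\<in>A. \<Sum>j\<in>B. a i * b j * cov M (U i) (V j))"
    using assms(1,2)
    by (simp add: cov_sum_left cov_sum_right sq_integrable_sum sum_distrib_left mult.assoc)
  also have "\<bar>\<dots>\<bar> \<le> (\<Sum>i\<in>A. \<Sum>j\<in>B. \<bar>a i * b j * cov M (U i) (V j)\<bar>)"
    by (intro order_trans[OF sum_abs] sum_mono sum_abs)
  also have "\<dots> \<le> (\<Sum>i\<in>A. \<Sum>j\<in>B. x * y * K)"
    unfolding abs_mult using assms by (intro sum_mono mult_mono) auto
  finally show ?thesis by simp
qed

end

context sampled_process
begin

text \<open>At order \<open>r0 + p\<close> this exponent governs both the growth of the variances
  with \<open>n\<close> and the decay of the covariances with the distance. Its position relative to
  1 decides whether the covariances are summable.\<close>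

definition \<kappa> :: real where "\<kappa> = 2 * real p - 2 * \<beta>"

lemma kappa_pos: "0 < \<kappa>"
  using p beta by (auto simp: \<kappa>_def)

lemma cov_fun_eq: "s \<in> {0..T} \<Longrightarrow> u \<in> {0..T} \<Longrightarrow> cov_fun M X s u = cov M (X s) (X u)"
  unfolding cov_fun_def mean_fun_def by (intro cov_centered sq_X)

lemma cov_D_eq:
  assumes "n0 \<le> n" "k + r \<le> n" "l + r \<le> n"
  shows "cov M (D n r k) (D n r l) = (\<Sum>i=0..r. \<Sum>j=0..r.
      dd_coeff (t n) 1 i k r * dd_coeff (t n) 1 j l r * cov_fun M X (t n (k + i)) (t n (l + j)))"
proof -
  have mem: "t n (k + i) \<in> {0..T}" "t n (l + i) \<in> {0..T}" if "i \<le> r" for i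
    using design_mem[OF assms(1)] assms that by auto
  have "cov M (D n r k) (D n r l) = (\<Sum>i=0..r. dd_coeff (t n) 1 i k r * cov M (X (t n (k + i))) (D n r l))"
    unfolding div_diff_rv_eq_sum[of "t n" X r k]
    using mem sq_D[OF assms(1,3)] by (intro cov_sum_left sq_X) auto
  also have "\<dots> = (\<Sum>i=0..r. dd_coeff (t n) 1 i k r *
      (\<Sum>j=0..r. dd_coeff (t n) 1 j l r * cov M (X (t n (k + i))) (X (t n (l + j)))))"
    unfolding div_diff_rv_eq_sum[of "t n" X r l]
    using mem by (intro sum.cong refl arg_cong2[where f = "(*)"] cov_sum_right sq_X) auto
  also have "\<dots> = (\<Sum>i=0..r. \<Sum>j=0..r.
      dd_coeff (t n) 1 i k r * dd_coeff (t n) 1 j l r * cov_fun M X (t n (k + i)) (t n (l + j)))"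
    using mem by (simp add: sum_distrib_left mult.assoc cov_fun_eq)
  finally show ?thesis .
qed

text \<open>The covariance is a double divided difference of the covariance function, hence a value
  of \<open>G\<close> at points of the two windows. These are at least \<open>l - (k + r)\<close>
  gaps apart, a number comparable with \<open>1 + \<bar>k - l\<bar>\<close>.\<close>

lemma cov_D_far:
  defines "r \<equiv> r0 + p"
  assumes n: "n0 \<le> n" "k + r < l" "l + r \<le> n"
  shows "\<bar>cov M (D n r k) (D n r l)\<bar> \<le>
    Dp * (gl / (real r + 2)) powr (- \<kappa>) * (real n powr \<kappa> * (1 + \<bar>real k - real l\<bar>) powr (- \<kappa>))"
proof -
  note pos = real_n_pos[OF n(1)]
  have mono: "strict_mono_on {k..l + r} (t n)"
    using n by (intro monotone_on_subset[OF design_mono[OF n(1)]]) auto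
  have sub: "{t n k..t n (l + r)} \<subseteq> {0..T}"
    using design_mem[OF n(1), of k] design_mem[OF n(1), of "l + r"] n by auto
  obtain s u where su: "s \<in> {t n k..t n (k + r)}" "u \<in> {t n l..t n (l + r)}"
    "cov M (D n r k) (D n r l) = G s u / (fact r)\<^sup>2"
  proof -
    have "k + r \<le> n" using n by simp
    thus thesis
      using mixed_div_diff_mean_value[OF mixed(1)[folded r_def] mono n(2) sub] that
      unfolding cov_D_eq[OF n(1) \<open>k + r \<le> n\<close> n(3), symmetric] by blast
  qed
  define d where "d = 1 + \<bar>real k - real l\<bar>"
  have d: "1 \<le> d" by (simp add: d_def)
  \<comment> \<open>With \<open>e = l - (k + r) \<ge> 1\<close> one has
    \<open>d = 1 + e + r\<close>, which is at most \<open>(r + 2) * e\<close>.\<close>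
  have "d \<le> (real r + 2) * (real l - real (k + r))"
  proof -
    define e where "e = real l - real (k + r)"
    have e: "1 \<le> e" using n by (simp add: e_def)
    have "0 \<le> (real r + 1) * (e - 1)" using e by simp
    moreover have "d = 1 + e + real r" using n by (simp add: d_def e_def)
    ultimately show ?thesis unfolding e_def[symmetric] by (simp add: algebra_simps)
  qed
  hence "d / (real r + 2) \<le> real l - real (k + r)" by (simp add: field_simps)
  hence "gl * (d / (real r + 2)) / real n \<le> gl * (real l - real (k + r)) / real n"
    using gap_consts pos by (intro divide_right_mono mult_left_mono) auto
  also have "\<dots> \<le> t n l - t n (k + r)" using n by (intro gap_bounds) auto
  finally have gap: "gl / (real r + 2) * d / real n \<le> u - s" using su by simp
  have x: "0 < gl / (real r + 2) * d / real n" using gap_consts d pos by simp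
  have ml: "t n (k + r) \<le> t n (l + r)" "t n k \<le> t n l"
    using strict_mono_on_leD[OF mono] n by auto
  hence mem: "s \<in> {0..T}" "u \<in> {0..T}" using su sub by auto
  have "\<bar>cov M (D n r k) (D n r l)\<bar> \<le> \<bar>G s u\<bar> / 1"
    unfolding su(3) abs_divide by (intro divide_left_mono) (auto simp: fact_ge_1 one_le_power)
  also have "\<dots> \<le> Dp * \<bar>s - u\<bar> powr (- \<kappa>)"
    using mixed(3)[OF mem] gap x by (simp add: \<kappa>_def)
  also have "\<dots> \<le> Dp * (gl / (real r + 2) * d / real n) powr (- \<kappa>)"
    using gap x kappa_pos mixed(2) by (intro mult_left_mono powr_mono2') auto
  also have "(gl / (real r + 2) * d / real n) powr (- \<kappa>) =
      (gl / (real r + 2)) powr (- \<kappa>) * (real n powr \<kappa> * d powr (- \<kappa>))"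
  proof -
    have "(gl / (real r + 2) * d / real n) powr (- \<kappa>) =
        ((gl / (real r + 2)) * d) powr (- \<kappa>) / real n powr (- \<kappa>)"
      by (rule powr_divide)
    also have "((gl / (real r + 2)) * d) powr (- \<kappa>) = (gl / (real r + 2)) powr (- \<kappa>) * d powr (- \<kappa>)"
      by (rule powr_mult)
    also have "real n powr (- \<kappa>) = inverse (real n powr \<kappa>)" by (rule powr_minus)
    finally show ?thesis by (simp add: divide_inverse mult_ac)
  qed
  finally show ?thesis by (simp add: d_def mult.assoc)
qed

lemma msq_D_base:
  "\<exists>C>0. \<forall>n\<ge>n0. \<forall>k. k + (r0 + p) \<le> n \<longrightarrow> msq M (D n (r0 + p) k) \<le> C * real n powr \<kappa>"
  using p msq_D_Suc_r0 msq_D_Suc_Suc_r0 by (auto simp: \<kappa>_def numeral_2_eq_2)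

text \<open>Within distance \<open>r\<close> of the diagonal the windows meet and the mixed
  derivative gives nothing; Cauchy-Schwarz replaces it, and \<open>1 + \<bar>k - l\<bar>\<close> is
  bounded there.\<close>

lemma cov_D_base:
  "\<exists>C>0. \<forall>n\<ge>n0. \<forall>k l. k + (r0 + p) \<le> n \<longrightarrow> l + (r0 + p) \<le> n \<longrightarrow>
     \<bar>cov M (D n (r0 + p) k) (D n (r0 + p) l)\<bar> \<le>
       C * (real n powr \<kappa> * (1 + \<bar>real k - real l\<bar>) powr (- \<kappa>))"
proof -
  define r where "r = r0 + p"
  obtain Cv where Cv: "0 < Cv" "\<And>n k. n0 \<le> n \<Longrightarrow> k + r \<le> n \<Longrightarrow> msq M (D n r k) \<le> Cv * real n powr \<kappa>"
    using msq_D_base unfolding r_def by blast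
  define C1 C2 where "C1 = Dp * (gl / (real r + 2)) powr (- \<kappa>)" and "C2 = Cv * (1 + real r) powr \<kappa>"
  have C12: "0 < C1" "0 < C2" using Cv mixed(2) gap_consts by (auto simp: C1_def C2_def)
  have "\<bar>cov M (D n r k) (D n r l)\<bar> \<le>
      (C1 + C2) * (real n powr \<kappa> * (1 + \<bar>real k - real l\<bar>) powr (- \<kappa>))"
    if n: "n0 \<le> n" "k + r \<le> n" "l + r \<le> n" and kl: "k \<le> l" for n k l
  proof (cases "k + r < l")
    case True
    have "\<bar>cov M (D n r k) (D n r l)\<bar> \<le> C1 * (real n powr \<kappa> * (1 + \<bar>real k - real l\<bar>) powr (- \<kappa>))"
      using cov_D_far[of n k l] True n unfolding C1_def r_def by auto
    also have "\<dots> \<le> (C1 + C2) * (real n powr \<kappa> * (1 + \<bar>real k - real l\<bar>) powr (- \<kappa>))"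
      using C12 by (intro mult_right_mono) auto
    finally show ?thesis .
  next
    case False
    have "\<bar>cov M (D n r k) (D n r l)\<bar> \<le> sqrt ((Cv * real n powr \<kappa>) * (Cv * real n powr \<kappa>))"
      using n by (intro cov_abs_le sq_D Cv) auto
    also have "\<dots> = Cv * real n powr \<kappa> * 1" using Cv(1) by simp
    also have "\<dots> \<le> Cv * real n powr \<kappa> * ((1 + real r) powr \<kappa> * (1 + \<bar>real k - real l\<bar>) powr (- \<kappa>))"
      using False kl Cv(1) kappa_pos by (intro mult_left_mono one_le_powr_near) auto
    also have "\<dots> = C2 * (real n powr \<kappa> * (1 + \<bar>real k - real l\<bar>) powr (- \<kappa>))"
      by (simp add: C2_def)
    also have "\<dots> \<le> (C1 + C2) * (real n powr \<kappa> * (1 + \<bar>real k - real l\<bar>) powr (- \<kappa>))"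
      using C12 by (intro mult_right_mono) auto
    finally show ?thesis .
  qed
  hence "\<bar>cov M (D n r k) (D n r l)\<bar> \<le>
      (C1 + C2) * (real n powr \<kappa> * (1 + \<bar>real k - real l\<bar>) powr (- \<kappa>))"
    if n: "n0 \<le> n" "k + r \<le> n" "l + r \<le> n" for n k l
    using that by (metis abs_minus_commute cov_commute nat_le_linear)
  thus ?thesis unfolding r_def using C12 by (intro exI[of _ "C1 + C2"]) auto
qed

text \<open>For \<open>p = 1\<close> one further differencing of order \<open>r0 + 1\<close> in each
  argument gains the factor \<open>n\<^sup>2\<close>, but leaves the decay exponent at
  \<open>2 - 2 * \<beta>\<close>. This is the origin of the slower rates for \<beta> from 1/2
  on.\<close>

lemma cov_D_Suc_Suc_r0:
  "\<exists>C>0. \<forall>n\<ge>n0. \<forall>k l. k + Suc (Suc r0) \<le> n \<longrightarrow> l + Suc (Suc r0) \<le> n \<longrightarrow>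
     \<bar>cov M (D n (Suc (Suc r0)) k) (D n (Suc (Suc r0)) l)\<bar> \<le>
       C * (real n powr (4 - 2 * \<beta>) * (1 + \<bar>real k - real l\<bar>) powr (- \<kappa>))"
proof (cases "p = 2")
  case True
  have "r0 + p = Suc (Suc r0)" "\<kappa> = 4 - 2 * \<beta>" unfolding \<kappa>_def using True by simp_all
  with cov_D_base show ?thesis by simp
next
  case False
  hence p1: "p = 1" using p by simp
  obtain C where C: "0 < C" "\<And>n k l. n0 \<le> n \<Longrightarrow> k + Suc r0 \<le> n \<Longrightarrow> l + Suc r0 \<le> n \<Longrightarrow>
     \<bar>cov M (D n (Suc r0) k) (D n (Suc r0) l)\<bar> \<le>
       C * (real n powr \<kappa> * (1 + \<bar>real k - real l\<bar>) powr (- \<kappa>))"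
    using cov_D_base unfolding p1 by auto
  define C' where "C' = 4 * C * 2 powr \<kappa> / gl\<^sup>2"
  have "\<bar>cov M (D n (Suc (Suc r0)) k) (D n (Suc (Suc r0)) l)\<bar> \<le>
       C' * (real n powr (4 - 2 * \<beta>) * (1 + \<bar>real k - real l\<bar>) powr (- \<kappa>))"
    if n: "n0 \<le> n" "k + Suc (Suc r0) \<le> n" "l + Suc (Suc r0) \<le> n" for n k l
  proof -
    define d where "d = 1 + \<bar>real k - real l\<bar>"
    define K where "K = C * 2 powr \<kappa> * (real n powr \<kappa> * d powr (- \<kappa>))"
    define c where "c i j = cov M (D n (Suc r0) i) (D n (Suc r0) j)" for i j
    have bound: "\<bar>c i j\<bar> \<le> K" if ij: "i \<in> {k, Suc k}" "j \<in> {l, Suc l}" for i j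
    proof -
      \<comment> \<open>Moving each index by at most one to the right changes the distance by at
        most one, so \<open>1 + \<bar>i - j\<bar>\<close> is at least \<open>d / 2\<close>.\<close>
      have "(1 + \<bar>real i - real j\<bar>) powr (- \<kappa>) \<le> (d / 2) powr (- \<kappa>)"
      proof (rule powr_mono2')
        have "\<bar>(real i - real j) - (real k - real l)\<bar> \<le> 1" using ij by auto
        moreover have "\<bar>real k - real l\<bar> - \<bar>real i - real j\<bar> \<le> \<bar>(real i - real j) - (real k - real l)\<bar>"
          by (rule abs_triangle_ineq2_sym)
        ultimately have "\<bar>real k - real l\<bar> \<le> 1 + \<bar>real i - real j\<bar>" by linarith
        moreover have "(1 + a) / 2 \<le> 1 + b" if "a \<le> 1 + b" "0 \<le> b" for a b :: real
          using that by simp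
        ultimately show "d / 2 \<le> 1 + \<bar>real i - real j\<bar>" unfolding d_def by (metis abs_ge_zero)
      qed (use kappa_pos in \<open>auto simp: d_def\<close>)
      also have "(d / 2) powr (- \<kappa>) = 2 powr \<kappa> * d powr (- \<kappa>)"
        by (simp add: d_def powr_divide powr_minus_divide)
      finally have pw: "(1 + \<bar>real i - real j\<bar>) powr (- \<kappa>) \<le> 2 powr \<kappa> * d powr (- \<kappa>)" .
      have "\<bar>c i j\<bar> \<le> C * (real n powr \<kappa> * (1 + \<bar>real i - real j\<bar>) powr (- \<kappa>))"
        unfolding c_def using ij n by (intro C(2)) auto
      also have "\<dots> \<le> C * (real n powr \<kappa> * (2 powr \<kappa> * d powr (- \<kappa>)))"
        using pw C(1) by (intro mult_left_mono) auto
      finally show ?thesis by (simp add: K_def mult_ac)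
    qed
    define x y where "x = inverse (t n (k + Suc (Suc r0)) - t n k)"
      and "y = inverse (t n (l + Suc (Suc r0)) - t n l)"
    have xy: "0 < x" "x \<le> real n / gl" "0 < y" "y \<le> real n / gl"
      unfolding x_def y_def by (rule inverse_span_le[OF n(1,2)] inverse_span_le[OF n(1,3)])+
    have s: "sq_integrable M (D n (Suc r0) k)" "sq_integrable M (D n (Suc r0) (Suc k))"
      "sq_integrable M (D n (Suc r0) l)" "sq_integrable M (D n (Suc r0) (Suc l))"
      using n by (auto intro!: sq_D)
    have "cov M (D n (Suc (Suc r0)) k) (D n (Suc (Suc r0)) l) =
        x * (y * ((c (Suc k) (Suc l) - c (Suc k) l) - (c k (Suc l) - c k l)))"
      unfolding D_diff_quotient[OF n(1,2)] D_diff_quotient[OF n(1,3)] x_def[symmetric] y_def[symmetric]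
        cov_cmult_left cov_cmult_right c_def
      by (simp only: cov_diff_left[OF s(2,1) sq_integrable_diff[OF s(4,3)]]
          cov_diff_right[OF s(4,3) s(1)] cov_diff_right[OF s(4,3) s(2)])
    also have "\<bar>\<dots>\<bar> \<le> real n / gl * (real n / gl * (4 * K))"
    proof -
      have "\<bar>(c (Suc k) (Suc l) - c (Suc k) l) - (c k (Suc l) - c k l)\<bar> \<le> 4 * K"
        using bound[of "Suc k" "Suc l"] bound[of "Suc k" l] bound[of k "Suc l"] bound[of k l] by simp
      thus ?thesis unfolding abs_mult using xy gap_consts by (intro mult_mono) auto
    qed
    also have "\<dots> = C' * ((real n)\<^sup>2 * real n powr \<kappa> * d powr (- \<kappa>))"
      by (simp add: C'_def K_def power2_eq_square)
    also have "(real n)\<^sup>2 * real n powr \<kappa> = real n powr (4 - 2 * \<beta>)"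
    proof -
      have "2 + \<kappa> = 4 - 2 * \<beta>" unfolding \<kappa>_def using p1 by simp
      thus ?thesis unfolding n_powr_simps[OF real_n_pos[OF n(1)]] by (simp only:)
    qed
    finally show ?thesis by (simp add: d_def)
  qed
  moreover have "0 < C'" using C gap_consts by (simp add: C'_def)
  ultimately show ?thesis by blast
qed

section \<open>Block averages of divided differences of order \<open>r0 + 1\<close>\<close>

definition block_span :: "nat \<Rightarrow> nat \<Rightarrow> nat \<Rightarrow> real" where
  "block_span n b h = (\<Sum>j<h. t n (b + j + Suc r0) - t n (b + j))"

text \<open>The mean of \<open>D n (Suc r0) (b + j)\<close> over \<open>j < h\<close>, weighted by
  the spans of the windows: by the recursion each weighted term is an increment of
  \<open>D n r0\<close>, and their sum telescopes. The windows overlap, hence the normalisation by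
  \<open>block_span\<close>, the sum of the weights, and not by the length of the block.\<close>

definition block_avg :: "nat \<Rightarrow> nat \<Rightarrow> nat \<Rightarrow> 'a \<Rightarrow> real" where
  "block_avg n b h = (\<lambda>\<omega>. inverse (block_span n b h) * (D n r0 (b + h) \<omega> - D n r0 b \<omega>))"

lemma block_span_bounds:
  assumes "n0 \<le> n" "b + h + r0 \<le> n"
  shows "real h * (gl / real n) \<le> block_span n b h"
    "block_span n b h \<le> real h * (gu * real (Suc r0) / real n)"
proof -
  have "(\<Sum>j<h. gl / real n) \<le> block_span n b h"
    unfolding block_span_def using assms by (intro sum_mono span_bounds) auto
  thus "real h * (gl / real n) \<le> block_span n b h" by simp
  have "block_span n b h \<le> (\<Sum>j<h. gu * real (Suc r0) / real n)"
    unfolding block_span_def using assms by (intro sum_mono span_bounds) auto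
  thus "block_span n b h \<le> real h * (gu * real (Suc r0) / real n)" by simp
qed

lemma block_span_pos:
  assumes "n0 \<le> n" "b + h + r0 \<le> n" "1 \<le> h"
  shows "0 < block_span n b h"
proof -
  have "0 < real h * (gl / real n)" using assms gap_consts real_n_pos[OF assms(1)] by simp
  thus ?thesis using block_span_bounds(1)[OF assms(1,2)] by linarith
qed

lemma sq_block_avg:
  assumes "n0 \<le> n" "b + h + r0 \<le> n"
  shows "sq_integrable M (block_avg n b h)"
  unfolding block_avg_def using assms by (intro sq_integrable_cmult sq_integrable_diff sq_D) auto

text \<open>Two members of a block differ by a telescoping sum of second differences multiplied by
  spans, and a weighted mean of such differences is again of this form. The position
  \<open>e\<close> is arbitrary so that blocks may be attached at either end.\<close>

lemma block_avg_deviation: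
  assumes n: "n0 \<le> n" "b + h + r0 \<le> n" and e: "e < h"
  shows "\<exists>\<alpha>. (\<forall>m. \<bar>\<alpha> m\<bar> \<le> gu * real (Suc (Suc r0)) / real n) \<and>
    (\<lambda>\<omega>. D n (Suc r0) (b + e) \<omega> - block_avg n b h \<omega>) =
    (\<lambda>\<omega>. \<Sum>m<h - 1. \<alpha> m * D n (Suc (Suc r0)) (b + m) \<omega>)"
proof -
  define S where "S = block_span n b h"
  have S: "0 < S" unfolding S_def using n e by (intro block_span_pos) auto
  define w where "w j = (t n (b + j + Suc r0) - t n (b + j)) / S" for j
  have w_nonneg: "0 \<le> w j" if "j < h" for j
    unfolding w_def using span_bounds(3)[OF n(1), of "b + j" r0] n that S by simp
  have w_sum: "(\<Sum>j<h. w j) = 1"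
    using S by (simp add: w_def S_def block_span_def flip: sum_divide_distrib)
  define v where "v m = t n (b + m + Suc (Suc r0)) - t n (b + m)" for m
  define D1 D2 where "D1 j = D n (Suc r0) (b + j)" and "D2 j = D n (Suc (Suc r0)) (b + j)" for j
  \<comment> \<open>The indicator lets every member of the block be summed over the same range,
    which permits the exchange of sums below.\<close>
  have D1: "D1 x \<omega> = D1 0 \<omega> + (\<Sum>m<h - 1. of_bool (m < x) * (v m * D2 m \<omega>))" if "x < h" for x \<omega>
  proof -
    have "{..<h - 1} \<inter> {m. m < x} = {..<x}" using that by auto
    hence "(\<Sum>m<h - 1. of_bool (m < x) * (v m * D2 m \<omega>)) = (\<Sum>m<x. v m * D2 m \<omega>)"
      by (simp add: of_bool_def if_distrib[of "\<lambda>z. z * _"] sum.If_cases cong: if_cong)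
    also have "\<dots> = (\<Sum>m<x. D1 (Suc m) \<omega> - D1 m \<omega>)"
    proof (intro sum.cong refl)
      fix m assume "m \<in> {..<x}"
      thus "v m * D2 m \<omega> = D1 (Suc m) \<omega> - D1 m \<omega>"
        unfolding v_def D1_def D2_def using that n D_recursion[OF n(1), of "b + m" "Suc r0" \<omega>] by simp
    qed
    also have "\<dots> = D1 x \<omega> - D1 0 \<omega>" by (rule sum_lessThan_telescope)
    finally show ?thesis by simp
  qed
  have avg: "block_avg n b h \<omega> = (\<Sum>j<h. w j * D1 j \<omega>)" for \<omega>
  proof -
    have "(\<Sum>j<h. (t n (b + j + Suc r0) - t n (b + j)) * D1 j \<omega>) =
        (\<Sum>j<h. D n r0 (b + Suc j) \<omega> - D n r0 (b + j) \<omega>)"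
      unfolding D1_def using n D_recursion[OF n(1), of _ r0 \<omega>] by (intro sum.cong) auto
    also have "\<dots> = D n r0 (b + h) \<omega> - D n r0 b \<omega>"
      using sum_lessThan_telescope[of "\<lambda>j. D n r0 (b + j) \<omega>" h] by simp
    finally have eq: "D n r0 (b + h) \<omega> - D n r0 b \<omega> =
        (\<Sum>j<h. (t n (b + j + Suc r0) - t n (b + j)) * D1 j \<omega>)" ..
    show ?thesis
      unfolding block_avg_def S_def[symmetric] eq sum_distrib_left
      by (simp add: w_def divide_inverse mult_ac)
  qed
  \<comment> \<open>The weights \<open>w j\<close> sum to 1 and the bracket lies in {-1, 0, 1}, so
    the coefficient is at most the span \<open>v m\<close>. The value 0 outside the block makes the
    bound valid for all \<open>m\<close>.\<close>
  define \<alpha> where "\<alpha> m = (if m < h - 1 then (\<Sum>j<h. w j * (of_bool (m < e) - of_bool (m < j))) * v m else 0)" for m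
  have "\<bar>\<alpha> m\<bar> \<le> gu * real (Suc (Suc r0)) / real n" for m
  proof (cases "m < h - 1")
    case True
    have "\<bar>\<Sum>j<h. w j * (of_bool (m < e) - of_bool (m < j))\<bar> \<le>
        (\<Sum>j<h. \<bar>w j * (of_bool (m < e) - of_bool (m < j))\<bar>)" by (rule sum_abs)
    also have "\<dots> \<le> (\<Sum>j<h. w j)"
      using w_nonneg by (intro sum_mono) (auto simp: abs_mult of_bool_def)
    finally have 1: "\<bar>\<Sum>j<h. w j * (of_bool (m < e) - of_bool (m < j))\<bar> \<le> 1" by (simp add: w_sum)
    have 2: "0 < v m" "v m \<le> gu * real (Suc (Suc r0)) / real n"
      unfolding v_def using True n span_bounds[OF n(1), of "b + m" "Suc r0"] by auto
    have "\<bar>\<alpha> m\<bar> = \<bar>\<Sum>j<h. w j * (of_bool (m < e) - of_bool (m < j))\<bar> * \<bar>v m\<bar>"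
      using True by (simp only: \<alpha>_def if_True abs_mult)
    also have "\<dots> \<le> 1 * \<bar>v m\<bar>" by (intro mult_right_mono 1) simp
    finally show ?thesis using 2 by simp
  qed (use gap_consts real_n_pos[OF n(1)] in \<open>simp add: \<alpha>_def\<close>)
  moreover have "D n (Suc r0) (b + e) \<omega> - block_avg n b h \<omega> =
      (\<Sum>m<h - 1. \<alpha> m * D n (Suc (Suc r0)) (b + m) \<omega>)" for \<omega>
  proof -
    have "D1 e \<omega> - block_avg n b h \<omega> = (\<Sum>j<h. w j) * D1 e \<omega> - (\<Sum>j<h. w j * D1 j \<omega>)"
      by (simp add: avg w_sum)
    also have "\<dots> = (\<Sum>j<h. w j * (D1 e \<omega> - D1 j \<omega>))"
      by (simp add: sum_distrib_right right_diff_distrib sum_subtractf)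
    also have "\<dots> = (\<Sum>j<h. w j * (\<Sum>m<h - 1. (of_bool (m < e) - of_bool (m < j)) * (v m * D2 m \<omega>)))"
    proof (intro sum.cong refl)
      fix j assume "j \<in> {..<h}"
      hence "D1 e \<omega> - D1 j \<omega> = (\<Sum>m<h - 1. (of_bool (m < e) - of_bool (m < j)) * (v m * D2 m \<omega>))"
        using D1[OF e, of \<omega>] D1[of j \<omega>] by (simp only: lessThan_iff left_diff_distrib sum_subtractf)
      thus "w j * (D1 e \<omega> - D1 j \<omega>) =
          w j * (\<Sum>m<h - 1. (of_bool (m < e) - of_bool (m < j)) * (v m * D2 m \<omega>))" by simp
    qed
    also have "\<dots> = (\<Sum>m<h - 1. \<Sum>j<h. w j * ((of_bool (m < e) - of_bool (m < j)) * (v m * D2 m \<omega>)))"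
      unfolding sum_distrib_left by (rule sum.swap)
    also have "\<dots> = (\<Sum>m<h - 1. \<alpha> m * D2 m \<omega>)"
      by (intro sum.cong refl) (simp add: \<alpha>_def sum_distrib_right mult.assoc)
    finally show ?thesis by (simp add: D1_def D2_def)
  qed
  ultimately show ?thesis by (intro exI[of _ \<alpha>]) auto
qed

text \<open>The increment over the block has second moment of order
  \<open>(h / n) powr (2 * \<beta>)\<close> and the normalising span is of order
  \<open>h / n\<close>. As \<open>\<beta> < 1\<close>, averages over long blocks are small.\<close>

lemma msq_block_avg_le:
  "\<exists>C>0. \<forall>n\<ge>n0. \<forall>b h. 1 \<le> h \<longrightarrow> b + h + r0 \<le> n \<longrightarrow>
     msq M (block_avg n b h) \<le> C * (real n powr (2 - 2 * \<beta>) * real h powr (- (2 - 2 * \<beta>)))"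
proof -
  obtain C where C: "0 < C" "\<And>n k h. n0 \<le> n \<Longrightarrow> 1 \<le> h \<Longrightarrow> k + h + r0 \<le> n \<Longrightarrow>
     msq M (\<lambda>\<omega>. D n r0 (k + h) \<omega> - D n r0 k \<omega>) \<le> C * (real h / real n) powr (2 * \<beta>)"
    using msq_D_increment by blast
  have "msq M (block_avg n b h) \<le> C / gl\<^sup>2 * (real n powr (2 - 2 * \<beta>) * real h powr (- (2 - 2 * \<beta>)))"
    if n: "n0 \<le> n" "1 \<le> h" "b + h + r0 \<le> n" for n b h
  proof -
    note pos = real_n_pos[OF n(1)]
    have x: "0 < real h / real n" using n pos by simp
    have le: "gl * (real h / real n) \<le> block_span n b h"
      using block_span_bounds(1)[OF n(1,3)] by (simp add: mult.commute)
    have "inverse (block_span n b h) \<le> inverse (gl * (real h / real n))"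
      using le x gap_consts by (intro le_imp_inverse_le mult_pos_pos)
    hence "(inverse (block_span n b h))\<^sup>2 \<le> (inverse (gl * (real h / real n)))\<^sup>2"
      using block_span_pos[OF n(1,3,2)] by (intro power_mono) auto
    hence "msq M (block_avg n b h) \<le> (inverse (gl * (real h / real n)))\<^sup>2 * (C * (real h / real n) powr (2 * \<beta>))"
      unfolding block_avg_def msq_cmult using C(2)[OF n] by (intro mult_mono msq_nonneg) auto
    also have "\<dots> = C / gl\<^sup>2 * ((real h / real n) powr (2 * \<beta>) / (real h / real n)\<^sup>2)"
      by (simp add: divide_inverse power_inverse power_mult_distrib)
    also have "(real h / real n) powr (2 * \<beta>) / (real h / real n)\<^sup>2 = (real h / real n) powr (2 * \<beta> - 2)"
      using x by (simp add: powr_diff)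
    also have "\<dots> = real n powr (2 - 2 * \<beta>) * real h powr (- (2 - 2 * \<beta>))"
    proof -
      define c where "c = 2 - 2 * \<beta>"
      have "(real h / real n) powr (- c) = real h powr (- c) / real n powr (- c)"
        by (rule powr_divide)
      also have "real n powr (- c) = inverse (real n powr c)" by (rule powr_minus)
      finally have "(real h / real n) powr (- c) = real n powr c * real h powr (- c)"
        by (simp add: divide_inverse)
      moreover have "2 * \<beta> - 2 = - c" by (simp add: c_def)
      ultimately show ?thesis by (simp only: c_def)
    qed
    finally show ?thesis .
  qed
  moreover have "0 < C / gl\<^sup>2" using C gap_consts by simp
  ultimately show ?thesis by blast
qed

end

lemma powr_divide_minus:
  fixes x y a :: real
  shows "(x / y) powr (- a) = y powr a * x powr (- a)"
proof -
  have "(x / y) powr (- a) = x powr (- a) / y powr (- a)" by (rule powr_divide)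
  also have "y powr (- a) = inverse (y powr a)" by (rule powr_minus)
  finally show ?thesis by (simp add: divide_inverse mult.commute)
qed

context sampled_process
begin

text \<open>\<open>A\<close> plays the part of the block average, small for long blocks, and
  \<open>R\<close> that of the deviation from it, which is available both through its second moment
  and as a combination of second differences.\<close>

definition block_split :: "real \<Rightarrow> real \<Rightarrow> nat \<Rightarrow> nat \<Rightarrow> nat \<Rightarrow> nat \<Rightarrow> bool" where
  "block_split C K n b h e \<longleftrightarrow> (\<exists>A R \<alpha>.
      sq_integrable M A \<and> sq_integrable M R \<and> D n (Suc r0) (b + e) = (\<lambda>\<omega>. A \<omega> + R \<omega>) \<and>
      msq M A \<le> C * (real n powr (2 - 2 * \<beta>) * real h powr (- (2 - 2 * \<beta>))) \<and>
      msq M R \<le> C * real n powr (2 - 2 * \<beta>) \<and>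
      (\<forall>m. \<bar>\<alpha> m\<bar> \<le> K / real n) \<and>
      R = (\<lambda>\<omega>. \<Sum>m<h - 1. \<alpha> m * D n (Suc (Suc r0)) (b + m) \<omega>))"

lemma block_decomposition:
  "\<exists>C K. 0 < C \<and> 0 < K \<and> (\<forall>n\<ge>n0. \<forall>b h e. e < h \<longrightarrow> b + h + r0 \<le> n \<longrightarrow> block_split C K n b h e)"
proof -
  obtain C where C: "0 < C" "\<And>n b h. n0 \<le> n \<Longrightarrow> 1 \<le> h \<Longrightarrow> b + h + r0 \<le> n \<Longrightarrow>
     msq M (block_avg n b h) \<le> C * (real n powr (2 - 2 * \<beta>) * real h powr (- (2 - 2 * \<beta>)))"
    using msq_block_avg_le by blast
  obtain C1 where C1: "0 < C1" "\<And>n k. n0 \<le> n \<Longrightarrow> k + Suc r0 \<le> n \<Longrightarrow>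
     msq M (D n (Suc r0) k) \<le> C1 * real n powr (2 - 2 * \<beta>)"
    using msq_D_Suc_r0 by blast
  define C' where "C' = 2 * C1 + 2 * C"
  define K where "K = gu * real (Suc (Suc r0))"
  have pos: "0 < C'" "0 < K" using C C1 gap_consts by (auto simp: C'_def K_def)
  have "block_split C' K n b h e"
    if n: "n0 \<le> n" "e < h" "b + h + r0 \<le> n" for n b h e
  proof -
    define A where "A = block_avg n b h"
    define R where "R = (\<lambda>\<omega>. D n (Suc r0) (b + e) \<omega> - A \<omega>)"
    define P where "P = real n powr (2 - 2 * \<beta>)"
    obtain \<alpha> where \<alpha>: "\<forall>m. \<bar>\<alpha> m\<bar> \<le> K / real n"
      "R = (\<lambda>\<omega>. \<Sum>m<h - 1. \<alpha> m * D n (Suc (Suc r0)) (b + m) \<omega>)"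
      using block_avg_deviation[OF n(1,3,2)] unfolding R_def A_def K_def by blast
    have sA: "sq_integrable M A" unfolding A_def by (rule sq_block_avg[OF n(1,3)])
    have sD: "sq_integrable M (D n (Suc r0) (b + e))" using n by (intro sq_D) auto
    have sR: "sq_integrable M R" unfolding R_def by (intro sq_integrable_diff sA sD)
    have h1: "real h powr (- (2 - 2 * \<beta>)) \<le> 1"
      using powr_mono2'[of "- (2 - 2 * \<beta>)" 1 "real h"] n beta by simp
    have mA: "msq M A \<le> C * (P * real h powr (- (2 - 2 * \<beta>)))"
      unfolding A_def P_def using n by (intro C(2)) auto
    also have "\<dots> \<le> C * (P * 1)"
      using C(1) h1 by (intro mult_left_mono) (auto simp: P_def)
    finally have mA1: "msq M A \<le> C * P" by simp
    have "msq M R \<le> 2 * msq M (D n (Suc r0) (b + e)) + 2 * msq M A"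
      unfolding R_def by (intro msq_diff_le sA sD)
    also have "\<dots> \<le> 2 * (C1 * P) + 2 * (C * P)"
      unfolding P_def using mA1 C1(2)[OF n(1), of "b + e"] n by (auto simp: P_def)
    finally have mR: "msq M R \<le> C' * P" by (simp add: C'_def algebra_simps)
    have "msq M A \<le> C' * (P * real h powr (- (2 - 2 * \<beta>)))"
    proof -
      have "C * (P * real h powr (- (2 - 2 * \<beta>))) \<le> C' * (P * real h powr (- (2 - 2 * \<beta>)))"
        using C C1 by (intro mult_right_mono) (auto simp: C'_def P_def)
      thus ?thesis using mA by linarith
    qed
    hence "sq_integrable M A \<and> sq_integrable M R \<and> D n (Suc r0) (b + e) = (\<lambda>\<omega>. A \<omega> + R \<omega>) \<and>
      msq M A \<le> C' * (P * real h powr (- (2 - 2 * \<beta>))) \<and> msq M R \<le> C' * P \<and>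
      (\<forall>m. \<bar>\<alpha> m\<bar> \<le> K / real n) \<and>
      R = (\<lambda>\<omega>. \<Sum>m<h - 1. \<alpha> m * D n (Suc (Suc r0)) (b + m) \<omega>)"
    proof (intro conjI)
      show "D n (Suc r0) (b + e) = (\<lambda>\<omega>. A \<omega> + R \<omega>)" by (simp add: R_def)
    qed (use sA sR mR \<alpha> in auto)
    thus ?thesis unfolding P_def block_split_def by blast
  qed
  thus ?thesis using pos by blast
qed

lemma sqrt_powr_prod:
  assumes "0 \<le> C"
  shows "sqrt ((C * (real n powr a * real h powr (- (2 * b)))) * (C * real n powr a)) =
           C * (real n powr a * real h powr (- b))"
proof -
  have "(C * (real n powr a * real h powr (- (2 * b)))) * (C * real n powr a) =
      (C * (real n powr a * real h powr (- b)))\<^sup>2"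
    by (simp add: power2_eq_square algebra_simps flip: powr_add)
  thus ?thesis using assms by simp
qed

text \<open>For \<open>p = 2\<close> the assumption controls the covariances of second differences only. Subtracting
  block averages of length comparable to \<open>\<bar>k - l\<bar>\<close> reduces to that case, and the averages
  themselves have small variance since they telescope.\<close>

lemma cov_D_Suc_r0:
  "\<exists>C>0. \<forall>n\<ge>n0. \<forall>k l. k + Suc r0 \<le> n \<longrightarrow> l + Suc r0 \<le> n \<longrightarrow>
     \<bar>cov M (D n (Suc r0) k) (D n (Suc r0) l)\<bar> \<le>
       C * (real n powr (2 - 2 * \<beta>) * (1 + \<bar>real k - real l\<bar>) powr (- (1 - \<beta>)))"
proof (cases "p = 1")
  case True
  have "r0 + p = Suc r0" "\<kappa> = 2 - 2 * \<beta>" unfolding \<kappa>_def using True by simp_all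
  then obtain C where C: "0 < C" "\<And>n k l. n0 \<le> n \<Longrightarrow> k + Suc r0 \<le> n \<Longrightarrow> l + Suc r0 \<le> n \<Longrightarrow>
     \<bar>cov M (D n (Suc r0) k) (D n (Suc r0) l)\<bar> \<le>
       C * (real n powr (2 - 2 * \<beta>) * (1 + \<bar>real k - real l\<bar>) powr (- (2 - 2 * \<beta>)))"
    using cov_D_base by auto
  have "(1 + \<bar>real k - real l\<bar>) powr (- (2 - 2 * \<beta>)) \<le> (1 + \<bar>real k - real l\<bar>) powr (- (1 - \<beta>))" for k l
    using beta by (intro powr_mono) auto
  hence "C * (real n powr (2 - 2 * \<beta>) * (1 + \<bar>real k - real l\<bar>) powr (- (2 - 2 * \<beta>))) \<le>
      C * (real n powr (2 - 2 * \<beta>) * (1 + \<bar>real k - real l\<bar>) powr (- (1 - \<beta>)))" for n k l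
    using C(1) by (intro mult_left_mono) auto
  thus ?thesis using C(1) by (intro exI[of _ C]) (auto intro: order_trans[OF C(2)])
next
  case False
  hence "p = 2" using p by simp
  hence keq: "\<kappa> = 4 - 2 * \<beta>" unfolding \<kappa>_def by simp
  obtain C2 where C2: "0 < C2" "\<And>n k l. n0 \<le> n \<Longrightarrow> k + Suc (Suc r0) \<le> n \<Longrightarrow> l + Suc (Suc r0) \<le> n \<Longrightarrow>
     \<bar>cov M (D n (Suc (Suc r0)) k) (D n (Suc (Suc r0)) l)\<bar> \<le>
       C2 * (real n powr (4 - 2 * \<beta>) * (1 + \<bar>real k - real l\<bar>) powr (- (4 - 2 * \<beta>)))"
    using cov_D_Suc_Suc_r0 unfolding keq by blast
  obtain C1 where C1: "0 < C1" "\<And>n k. n0 \<le> n \<Longrightarrow> k + Suc r0 \<le> n \<Longrightarrow>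
     msq M (D n (Suc r0) k) \<le> C1 * real n powr (2 - 2 * \<beta>)"
    using msq_D_Suc_r0 by blast
  obtain C0 K where C0': "0 < C0" "0 < K"
    "\<forall>n\<ge>n0. \<forall>b h e. e < h \<longrightarrow> b + h + r0 \<le> n \<longrightarrow> block_split C0 K n b h e"
    using block_decomposition by (elim exE conjE)
  have C0: "0 < C0" "0 < K"
    "n0 \<le> n \<Longrightarrow> e < h \<Longrightarrow> b + h + r0 \<le> n \<Longrightarrow> block_split C0 K n b h e" for n b h e
    using C0' by auto
  define Cm where "Cm = C0 + C1"
  have Cm: "0 < Cm" "C0 \<le> Cm" "C1 \<le> Cm" using C0 C1 by (auto simp: Cm_def)
  define E where "E = 2 * Cm * 8 powr (1 - \<beta>) + K\<^sup>2 * C2 * 2 powr (4 - 2 * \<beta>)"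
  define F where "F = C1 * 4 powr (1 - \<beta>)"
  have EF: "0 < E" "0 < F" using Cm C2 C1 C0 by (auto simp: E_def F_def intro!: add_pos_pos)
  have "\<bar>cov M (D n (Suc r0) k) (D n (Suc r0) l)\<bar> \<le>
       (E + F) * (real n powr (2 - 2 * \<beta>) * (1 + \<bar>real k - real l\<bar>) powr (- (1 - \<beta>)))"
    if n: "n0 \<le> n" "k + Suc r0 \<le> n" "l + Suc r0 \<le> n" and kl: "k \<le> l" for n k l
  proof (cases "k + 4 \<le> l")
    case False
    have "\<bar>cov M (D n (Suc r0) k) (D n (Suc r0) l)\<bar> \<le>
        sqrt ((C1 * real n powr (2 - 2 * \<beta>)) * (C1 * real n powr (2 - 2 * \<beta>)))"
      using n by (intro cov_abs_le sq_D C1) auto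
    also have "\<dots> = C1 * real n powr (2 - 2 * \<beta>) * 1" using C1(1) by simp
    also have "\<dots> \<le> C1 * real n powr (2 - 2 * \<beta>) *
        (4 powr (1 - \<beta>) * (1 + \<bar>real k - real l\<bar>) powr (- (1 - \<beta>)))"
      using False kl C1(1) beta by (intro mult_left_mono one_le_powr_near) auto
    also have "\<dots> = F * (real n powr (2 - 2 * \<beta>) * (1 + \<bar>real k - real l\<bar>) powr (- (1 - \<beta>)))"
      by (simp add: F_def)
    also have "\<dots> \<le> (E + F) * (real n powr (2 - 2 * \<beta>) * (1 + \<bar>real k - real l\<bar>) powr (- (1 - \<beta>)))"
      using EF by (intro mult_right_mono) auto
    finally show ?thesis .
  next
    case True
    note npos = real_n_pos[OF n(1)]
    \<comment> \<open>With blocks of a quarter of the distance, all pairs of windows from the two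
      blocks remain separated by about half of it.\<close>
    define h where "h = (l - k) div 4"
    define d where "d = 1 + \<bar>real k - real l\<bar>"
    define P where "P = real n powr (2 - 2 * \<beta>)"
    have h: "1 \<le> h" "4 * h \<le> l - k" "l - k < 4 * h + 4" using True by (auto simp: h_def)

    have "k + 4 * h \<le> l" "l + 1 \<le> k + 8 * h" using h True by linarith+
    hence "real (k + 4 * h) \<le> real l" "real (l + 1) \<le> real (k + 8 * h)"
      by (simp_all only: of_nat_le_iff)
    hence h4: "4 * real h \<le> real l - real k" "1 + real l - real k \<le> 8 * real h" by simp_all
    have dr: "d = 1 + real l - real k" using True by (simp add: d_def)
    have hd: "d / 8 \<le> real h" "real h \<le> d" "1 \<le> d" using h4 h(1) unfolding dr by simp_all
    \<comment> \<open>The block of \<open>k\<close> starts at \<open>k\<close> and that of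
      \<open>l\<close> ends at \<open>l\<close>. Both extend inwards, hence stay within the
      admissible indices.\<close>
    define b' where "b' = l + 1 - h"
    have b': "b' + (h - 1) = l" using h True by (simp add: b'_def)
    have "k + h + r0 \<le> n" using n h True by linarith
    hence "block_split C0 K n k h 0" using C0(3)[OF n(1), of 0 h k] h by auto
    then obtain A R \<alpha> where AR: "sq_integrable M A" "sq_integrable M R" "D n (Suc r0) k = (\<lambda>\<omega>. A \<omega> + R \<omega>)"
      "msq M A \<le> C0 * (P * real h powr (- (2 - 2 * \<beta>)))" "msq M R \<le> C0 * P"
      "\<forall>m. \<bar>\<alpha> m\<bar> \<le> K / real n" "R = (\<lambda>\<omega>. \<Sum>m<h - 1. \<alpha> m * D n (Suc (Suc r0)) (k + m) \<omega>)"
      unfolding P_def block_split_def add_0_right by (elim exE conjE)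
    have "b' + h + r0 \<le> n" using n h True by (simp add: b'_def)
    hence "block_split C0 K n b' h (h - 1)" using C0(3)[OF n(1), of "h - 1" h b'] h by auto
    then obtain A' R' \<alpha>' where AR': "sq_integrable M A'" "sq_integrable M R'" "D n (Suc r0) l = (\<lambda>\<omega>. A' \<omega> + R' \<omega>)"
      "msq M A' \<le> C0 * (P * real h powr (- (2 - 2 * \<beta>)))" "msq M R' \<le> C0 * P"
      "\<forall>m. \<bar>\<alpha>' m\<bar> \<le> K / real n" "R' = (\<lambda>\<omega>. \<Sum>m<h - 1. \<alpha>' m * D n (Suc (Suc r0)) (b' + m) \<omega>)"
      unfolding P_def block_split_def b' by (elim exE conjE)
    have P0: "0 \<le> P" by (simp add: P_def)
    have le1: "C0 * (P * real h powr (- (2 - 2 * \<beta>))) \<le> Cm * (P * real h powr (- (2 * (1 - \<beta>))))"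
    proof -
      have "2 * (1 - \<beta>) = 2 - 2 * \<beta>" by simp
      thus ?thesis using Cm P0 by (simp only:, intro mult_right_mono) auto
    qed
    have le2: "C0 * P \<le> Cm * P" "C1 * P \<le> Cm * P" using Cm P0 by (auto intro: mult_right_mono)
    have sl: "sq_integrable M (D n (Suc r0) l)" using n by (intro sq_D) auto
    define hb where "hb = real h powr (- (1 - \<beta>))"
    \<comment> \<open>The terms that contain an average are bounded by Cauchy-Schwarz, where only
      the square root of its second moment appears: this produces the exponent
      \<open>1 - \<beta>\<close>. For the two deviations the covariances of second differences are
      used.\<close>
    have "cov M (D n (Suc r0) k) (D n (Suc r0) l) = cov M A (D n (Suc r0) l) + cov M R (D n (Suc r0) l)"
      using cov_diff_left[OF sq_integrable_add[OF AR(1,2)] AR(1) sl] unfolding AR(3) by simp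
    also have "cov M R (D n (Suc r0) l) = cov M R A' + cov M R R'"
      using cov_diff_right[OF sq_integrable_add[OF AR'(1,2)] AR'(1) AR(2)] unfolding AR'(3) by simp
    finally have split: "cov M (D n (Suc r0) k) (D n (Suc r0) l) =
        cov M A (D n (Suc r0) l) + (cov M R A' + cov M R R')" .
    have "\<bar>cov M A (D n (Suc r0) l)\<bar> \<le> sqrt ((Cm * (P * real h powr (- (2 * (1 - \<beta>))))) * (Cm * P))"
      using AR(4) C1(2)[OF n(1,3)] le1 le2 by (intro cov_abs_le AR sl) (auto simp: P_def)
    also have "\<dots> = Cm * (P * hb)"
      unfolding P_def hb_def using Cm by (intro sqrt_powr_prod) auto
    finally have t1: "\<bar>cov M A (D n (Suc r0) l)\<bar> \<le> Cm * (P * hb)" .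
    have "\<bar>cov M A' R\<bar> \<le> sqrt ((Cm * (P * real h powr (- (2 * (1 - \<beta>))))) * (Cm * P))"
      using AR'(4) AR(5) le1 le2 by (intro cov_abs_le AR AR') auto
    also have "\<dots> = Cm * (P * hb)"
      unfolding P_def hb_def using Cm by (intro sqrt_powr_prod) auto
    finally have t2: "\<bar>cov M R A'\<bar> \<le> Cm * (P * hb)" by (simp add: cov_commute)
    define Q where "Q = C2 * (real n powr (4 - 2 * \<beta>) * (d / 2) powr (- (4 - 2 * \<beta>)))"
    \<comment> \<open>At most \<open>d * d\<close> pairs, each with coefficients of order
      \<open>1 / n\<close> and a covariance of order
      \<open>real n powr (4 - 2 * \<beta>) * d powr (- (4 - 2 * \<beta>))\<close>; the total decays
      even like \<open>d powr (2 * \<beta> - 2)\<close>.\<close>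
    have "\<bar>cov M R R'\<bar> \<le> real (card {..<h - 1}) * real (card {..<h - 1}) * (K / real n * (K / real n) * Q)"
      unfolding AR(7) AR'(7)
    proof (rule cov_lincomb_abs_le)
      fix i j assume ij: "i \<in> {..<h - 1}" "j \<in> {..<h - 1}"
      have "\<bar>cov M (D n (Suc (Suc r0)) (k + i)) (D n (Suc (Suc r0)) (b' + j))\<bar> \<le>
          C2 * (real n powr (4 - 2 * \<beta>) * (1 + \<bar>real (k + i) - real (b' + j)\<bar>) powr (- (4 - 2 * \<beta>)))"
        using ij n h True b' by (intro C2(2)) auto
      also have "(1 + \<bar>real (k + i) - real (b' + j)\<bar>) powr (- (4 - 2 * \<beta>)) \<le> (d / 2) powr (- (4 - 2 * \<beta>))"
      proof (rule powr_mono2')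
        have "b' + h = l + 1" "i + 1 \<le> h" using h True ij by (auto simp: b'_def)
        hence "real (b' + h) = real (l + 1)" "real (i + 1) \<le> real h" by (simp_all only: of_nat_le_iff)
        hence "d / 2 \<le> 1 + (real (b' + j) - real (k + i))" using h4 unfolding dr by simp
        also have "\<dots> \<le> 1 + \<bar>real (k + i) - real (b' + j)\<bar>" by simp
        finally show "d / 2 \<le> 1 + \<bar>real (k + i) - real (b' + j)\<bar>" .
      qed (use beta hd in auto)
      finally show "\<bar>cov M (D n (Suc (Suc r0)) (k + i)) (D n (Suc (Suc r0)) (b' + j))\<bar> \<le> Q"
        using C2(1) by (simp add: Q_def mult_left_mono)
    qed (use AR(6) AR'(6) C0(2) C2(1) npos n h True in \<open>auto simp: Q_def b'_def intro!: sq_D\<close>)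
    also have "\<dots> \<le> d * d * (K / real n * (K / real n) * Q)"
      using hd h C2(1) C0(2) by (intro mult_right_mono mult_mono) (auto simp: Q_def)
    also have "\<dots> = K\<^sup>2 * C2 * 2 powr (4 - 2 * \<beta>) * ((real n powr (4 - 2 * \<beta>) / (real n)\<^sup>2) * (d\<^sup>2 * d powr (- (4 - 2 * \<beta>))))"
    proof -
      have "(d / 2) powr (- (4 - 2 * \<beta>)) = 2 powr (4 - 2 * \<beta>) * d powr (- (4 - 2 * \<beta>))"
        by (rule powr_divide_minus)
      thus ?thesis by (simp add: Q_def power2_eq_square)
    qed
    also have "real n powr (4 - 2 * \<beta>) / (real n)\<^sup>2 = P"
      using n_powr_simps[OF npos, of "2 - 2 * \<beta>"] npos by (simp add: P_def field_simps)
    also have "d\<^sup>2 * d powr (- (4 - 2 * \<beta>)) = d powr (2 * \<beta> - 2)"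
      using hd powr_add[of d 2 "- (4 - 2 * \<beta>)"] by simp
    also have "K\<^sup>2 * C2 * 2 powr (4 - 2 * \<beta>) * (P * d powr (2 * \<beta> - 2)) \<le>
        K\<^sup>2 * C2 * 2 powr (4 - 2 * \<beta>) * (P * d powr (- (1 - \<beta>)))"
      using hd beta C2 C0 P0 by (intro mult_left_mono powr_mono) auto
    finally have t3: "\<bar>cov M R R'\<bar> \<le> K\<^sup>2 * C2 * 2 powr (4 - 2 * \<beta>) * (P * d powr (- (1 - \<beta>)))" .
    have "hb \<le> (d / 8) powr (- (1 - \<beta>))"
      unfolding hb_def using hd beta by (intro powr_mono2') auto
    also have "\<dots> = 8 powr (1 - \<beta>) * d powr (- (1 - \<beta>))"
      by (rule powr_divide_minus)
    finally have "Cm * (P * hb) \<le> Cm * (P * (8 powr (1 - \<beta>) * d powr (- (1 - \<beta>))))"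
      using Cm P0 by (intro mult_left_mono) auto
    hence "\<bar>cov M (D n (Suc r0) k) (D n (Suc r0) l)\<bar> \<le>
        2 * (Cm * (P * (8 powr (1 - \<beta>) * d powr (- (1 - \<beta>))))) +
        K\<^sup>2 * C2 * 2 powr (4 - 2 * \<beta>) * (P * d powr (- (1 - \<beta>)))"
      using t1 t2 t3 unfolding split by linarith
    also have "\<dots> = E * (P * d powr (- (1 - \<beta>)))"
      by (simp add: E_def algebra_simps)
    also have "\<dots> \<le> (E + F) * (P * d powr (- (1 - \<beta>)))"
      using EF P0 by (intro mult_right_mono) auto
    finally show ?thesis by (simp add: P_def d_def)
  qed
  hence "\<bar>cov M (D n (Suc r0) k) (D n (Suc r0) l)\<bar> \<le>
       (E + F) * (real n powr (2 - 2 * \<beta>) * (1 + \<bar>real k - real l\<bar>) powr (- (1 - \<beta>)))"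
    if n: "n0 \<le> n" "k + Suc r0 \<le> n" "l + Suc r0 \<le> n" for n k l
    using that by (metis abs_minus_commute cov_commute nat_le_linear)
  thus ?thesis using EF by (intro exI[of _ "E + F"]) auto
qed

end

section \<open>Nondegeneracy of the divided differences of order \<open>r0 + 2\<close>\<close>

lemma sum_powr_le:
  assumes "0 < b" "b \<le> 1"
  shows "(\<Sum>j=1..n. real j powr (b - 1)) \<le> real n powr b / b"
proof (induction n)
  case (Suc n)
  have "b * real (Suc n) powr (b - 1) \<le> real (Suc n) powr b - real n powr b"
  proof (cases "n = 0")
    case False
    have "\<exists>z. real n < z \<and> z < real (Suc n) \<and>
        real (Suc n) powr b - real n powr b = (real (Suc n) - real n) * (b * z powr (b - 1))"
    proof (rule MVT2)
      fix x assume "real n \<le> x" "x \<le> real (Suc n)"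
      hence "0 < x" using False by (metis gr0I less_le_trans of_nat_0_less_iff)
      thus "((\<lambda>x. x powr b) has_real_derivative b * x powr (b - 1)) (at x)"
        by (rule has_real_derivative_powr)
    qed simp
    then obtain z where z: "real n < z" "z < real (Suc n)"
      "real (Suc n) powr b - real n powr b = b * z powr (b - 1)" by auto
    have "real (Suc n) powr (b - 1) \<le> z powr (b - 1)"
      using z assms by (intro powr_mono2') auto
    thus ?thesis using z assms by simp
  qed (use assms in simp)
  hence "real (Suc n) powr (b - 1) \<le> real (Suc n) powr b / b - real n powr b / b"
    using assms by (simp add: field_simps)
  thus ?case using Suc by simp
qed simp

text \<open>Each distance from \<open>i\<close> occurs at most twice, once on either side.\<close>

lemma sum_distance_le:
  fixes g :: "nat \<Rightarrow> real"
  assumes S: "finite S" "\<And>d. d \<in> S \<Longrightarrow> 0 \<le> g d" and J: "finite J"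
    and dist: "\<And>j. j \<in> J \<Longrightarrow> j \<noteq> i \<Longrightarrow> nat \<bar>int i - int j\<bar> \<in> S"
  shows "(\<Sum>j\<in>J - {i}. g (nat \<bar>int i - int j\<bar>)) \<le> 2 * (\<Sum>d\<in>S. g d)"
proof -
  define f where "f j = nat \<bar>int i - int j\<bar>" for j
  have half: "(\<Sum>j\<in>B. g (f j)) \<le> (\<Sum>d\<in>S. g d)" if "B \<subseteq> J - {i}" "inj_on f B" for B
  proof -
    have "(\<Sum>j\<in>B. g (f j)) = (\<Sum>d\<in>f ` B. g d)"
      using that(2) by (simp add: sum.reindex)
    also have "\<dots> \<le> (\<Sum>d\<in>S. g d)"
      using that dist S by (intro sum_mono2) (auto simp: f_def)
    finally show ?thesis .
  qed
  have "(\<Sum>j\<in>J - {i}. g (f j)) = (\<Sum>j\<in>{j\<in>J. j < i}. g (f j)) + (\<Sum>j\<in>{j\<in>J. i < j}. g (f j))"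
  proof -
    have eq: "J - {i} = {j\<in>J. j < i} \<union> {j\<in>J. i < j}" by auto
    show ?thesis unfolding eq by (rule sum.union_disjoint) (use J in auto)
  qed
  also have "\<dots> \<le> (\<Sum>d\<in>S. g d) + (\<Sum>d\<in>S. g d)"
    by (intro add_mono half) (auto simp: inj_on_def f_def)
  finally show ?thesis by (simp add: f_def)
qed

text \<open>A decreasing function is at each multiple of \<open>q\<close> at most its average over
  the \<open>q\<close> indices that end there. Thinning out indices to distance \<open>q\<close>
  thus divides row sums by \<open>q\<close>.\<close>

lemma sum_multiples_le:
  fixes g :: "nat \<Rightarrow> real"
  assumes "antimono_on {1..} g"
  shows "real q * (\<Sum>m=1..M. g (m * q)) \<le> (\<Sum>i=1..M * q. g i)"
proof (induction M)
  case (Suc M)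
  have "real q * g (Suc M * q) = (\<Sum>i=M * q + 1..Suc M * q. g (Suc M * q))" by simp
  also have "\<dots> \<le> (\<Sum>i=M * q + 1..Suc M * q. g i)"
    using assms by (intro sum_mono) (auto simp: monotone_on_def)
  finally have "real q * g (Suc M * q) \<le> (\<Sum>i=M * q + 1..Suc M * q. g i)" .
  moreover have "(\<Sum>i=1..Suc M * q. g i) = (\<Sum>i=1..M * q. g i) + (\<Sum>i=M * q + 1..Suc M * q. g i)"
    using sum.ub_add_nat[of 1 "M * q" g q] by (simp add: add.commute)
  ultimately show ?case using Suc by (simp add: distrib_left)
qed simp

context sampled_process
begin

text \<open>Over \<open>h\<close> gaps the derivative \<open>Y\<close> moves by at least a multiple
  of \<open>(h / n) powr (2 * \<beta>)\<close> in mean square, whereas its approximation by divided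
  differences has an error independent of \<open>h\<close>. A sufficiently large \<open>h\<close>,
  fixed once and for all, makes the increment prevail.\<close>

lemma msq_block_avg_ge:
  "\<exists>h \<eta> N. 1 \<le> h \<and> 0 < \<eta> \<and> n0 \<le> N \<and> (\<forall>n\<ge>N. \<forall>k. k + h + r0 \<le> n \<longrightarrow>
     \<eta> * real n powr (2 - 2 * \<beta>) \<le> msq M (block_avg n k h))"
proof -
  obtain C where C: "0 < C" "\<And>n k. n0 \<le> n \<Longrightarrow> k + r0 \<le> n \<Longrightarrow>
     msq M (\<lambda>\<omega>. fact r0 * D n r0 k \<omega> - Y (t n k) \<omega>) \<le> C * real n powr (- (2 * \<beta>))"
    using msq_D_approx_Y by blast
  define f :: real where "f = fact r0"
  have f: "1 \<le> f" by (simp add: f_def fact_ge_1)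
  \<comment> \<open>The part \<open>8 * C\<close> pays for the two approximation errors, and
    \<open>2 * f\<^sup>2\<close> is what then remains for the increment of the divided
    differences.\<close>
  define L where "L = (8 * C + 2 * f\<^sup>2) / c1"
  have L: "0 < L" using C f holder_consts by (auto simp: L_def intro!: divide_pos_pos add_pos_pos)
  obtain h where h: "L powr (1 / (2 * \<beta>)) / gl + 1 < real h" using reals_Archimedean2 by blast
  have "0 \<le> L powr (1 / (2 * \<beta>)) / gl" using gap_consts by simp
  hence h1: "1 \<le> h" using h by linarith
  have "L powr (1 / (2 * \<beta>)) / gl \<le> real h" using h by linarith
  hence "L powr (1 / (2 * \<beta>)) \<le> gl * real h" using gap_consts by (simp add: field_simps)
  hence "(L powr (1 / (2 * \<beta>))) powr (2 * \<beta>) \<le> (gl * real h) powr (2 * \<beta>)"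
    using beta by (intro powr_mono2) auto
  hence "L \<le> (gl * real h) powr (2 * \<beta>)" using beta L by (simp add: powr_powr)
  hence c1L: "8 * C + 2 * f\<^sup>2 \<le> c1 * (gl * real h) powr (2 * \<beta>)"
    using holder_consts by (simp add: L_def field_simps)
  obtain N0 where N0: "gu * real h / h0 < real N0" using reals_Archimedean2 by blast
  define a where "a = real h * gu * real (Suc r0)"
  have a: "0 < a" using h1 gap_consts by (simp add: a_def)
  have "1 / a\<^sup>2 * real n powr (2 - 2 * \<beta>) \<le> msq M (block_avg n k h)"
    if n: "max n0 N0 \<le> n" "k + h + r0 \<le> n" for n k
  proof -
    have n0n: "n0 \<le> n" and N0n: "N0 \<le> n" using n by auto
    note pos = real_n_pos[OF n0n]
    define Q where "Q = real n powr (- (2 * \<beta>))"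
    define E where "E j \<omega> = f * D n r0 j \<omega> - Y (t n j) \<omega>" for j \<omega>
    define \<Delta> where "\<Delta> = (\<lambda>\<omega>. D n r0 (k + h) \<omega> - D n r0 k \<omega>)"
    have sE: "sq_integrable M (E j)" if "j + r0 \<le> n" for j
      unfolding E_def using that n0n
      by (intro sq_integrable_diff sq_integrable_cmult sq_D sq_Y design_mem) auto
    have mE: "msq M (E j) \<le> C * Q" if "j + r0 \<le> n" for j
      using C(2)[OF n0n that] by (simp add: E_def[abs_def] f_def Q_def)
    have s\<Delta>: "sq_integrable M \<Delta>"
      unfolding \<Delta>_def using n n0n by (intro sq_integrable_diff sq_D) auto
    have gb: "gl * real h / real n \<le> t n (k + h) - t n k" "t n (k + h) - t n k \<le> gu * real h / real n"
      using gap_bounds[OF n0n, of k "k + h"] n by auto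
    have glh: "0 \<le> gl * real h / real n" using gap_consts by simp
    have "gu * real h / h0 \<le> real n" using N0 N0n by simp
    hence "gu * real h / real n \<le> h0" using pos holder_consts by (simp add: field_simps)
    hence near: "\<bar>t n (k + h) - t n k\<bar> \<le> h0" using gb glh by linarith
    have "(8 * C + 2 * f\<^sup>2) * Q \<le> c1 * (gl * real h) powr (2 * \<beta>) * Q"
      using c1L by (intro mult_right_mono) (auto simp: Q_def)
    also have "\<dots> = c1 * (gl * real h / real n) powr (2 * \<beta>)"
      unfolding Q_def by (simp add: powr_divide powr_minus_divide)
    also have "\<dots> \<le> c1 * \<bar>t n (k + h) - t n k\<bar> powr (2 * \<beta>)"
      using gb glh beta holder_consts by (intro mult_left_mono powr_mono2) auto
    also have "\<dots> \<le> msq M (\<lambda>\<omega>. Y (t n (k + h)) \<omega> - Y (t n k) \<omega>)"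
      using n n0n near by (intro holder_lower design_mem) auto
    also have "\<dots> = msq M (\<lambda>\<omega>. f * \<Delta> \<omega> - (E (k + h) \<omega> - E k \<omega>))"
      by (simp add: E_def \<Delta>_def algebra_simps)
    also have "\<dots> \<le> 2 * msq M (\<lambda>\<omega>. f * \<Delta> \<omega>) + 2 * msq M (\<lambda>\<omega>. E (k + h) \<omega> - E k \<omega>)"
      using n by (intro msq_diff_le sq_integrable_cmult sq_integrable_diff s\<Delta> sE) auto
    also have "msq M (\<lambda>\<omega>. E (k + h) \<omega> - E k \<omega>) \<le> 2 * msq M (E (k + h)) + 2 * msq M (E k)"
      using n by (intro msq_diff_le sE) auto
    also have "\<dots> \<le> 4 * (C * Q)" using mE[of k] mE[of "k + h"] n by simp
    finally have "(8 * C + 2 * f\<^sup>2) * Q \<le> 2 * (f\<^sup>2 * msq M \<Delta>) + 2 * (4 * (C * Q))"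
      unfolding msq_cmult by simp
    hence "f\<^sup>2 * Q \<le> f\<^sup>2 * msq M \<Delta>" by (simp add: algebra_simps)
    hence \<Delta>Q: "Q \<le> msq M \<Delta>" using f by simp
    have S: "0 < block_span n k h" using block_span_pos[OF n0n n(2) h1] .
    have "block_span n k h \<le> a / real n"
      using block_span_bounds(2)[OF n0n n(2)] by (simp add: a_def mult.assoc)
    hence "inverse (a / real n) \<le> inverse (block_span n k h)" using S by (intro le_imp_inverse_le)
    hence "(inverse (a / real n))\<^sup>2 \<le> (inverse (block_span n k h))\<^sup>2"
      using a pos by (intro power_mono) auto
    hence "(inverse (a / real n))\<^sup>2 * Q \<le> (inverse (block_span n k h))\<^sup>2 * msq M \<Delta>"
      using \<Delta>Q by (intro mult_mono) (auto simp: Q_def)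
    also have "\<dots> = msq M (block_avg n k h)"
      unfolding block_avg_def msq_cmult \<Delta>_def ..
    also have "(inverse (a / real n))\<^sup>2 * Q = 1 / a\<^sup>2 * ((real n)\<^sup>2 * Q)"
      by (simp add: power_divide)
    also have "(real n)\<^sup>2 * Q = real n powr (2 - 2 * \<beta>)"
      unfolding Q_def n_powr_simps[OF pos] by simp
    finally show ?thesis .
  qed
  thus ?thesis using h1 a
    by (intro exI[of _ h] exI[of _ "1 / a\<^sup>2"] exI[of _ "max n0 N0"]) auto
qed

text \<open>If all second differences in a long window were small, the first differences would be
  nearly constant there; averages over long blocks show that this constant is small, which
  contradicts the lower bound for averages over short blocks. This exploits \<open>\<beta> < 1\<close> and spares
  the computation of the limiting variance.\<close>

lemma msq_D_Suc_Suc_r0_window: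
  "\<exists>h \<epsilon> N. 0 < \<epsilon> \<and> n0 \<le> N \<and> (\<forall>n\<ge>N. \<forall>k. k + h + Suc (Suc r0) \<le> n \<longrightarrow>
     (\<exists>j\<le>h. \<epsilon> * real n powr (4 - 2 * \<beta>) \<le> msq M (D n (Suc (Suc r0)) (k + j))))"
proof -
  obtain h1 \<eta> N where ge: "1 \<le> h1" "0 < \<eta>" "n0 \<le> N"
    "\<forall>n\<ge>N. \<forall>k. k + h1 + r0 \<le> n \<longrightarrow> \<eta> * real n powr (2 - 2 * \<beta>) \<le> msq M (block_avg n k h1)"
    using msq_block_avg_ge by (elim exE conjE)
  obtain C where C: "0 < C" "\<And>n b h. n0 \<le> n \<Longrightarrow> 1 \<le> h \<Longrightarrow> b + h + r0 \<le> n \<Longrightarrow>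
     msq M (block_avg n b h) \<le> C * (real n powr (2 - 2 * \<beta>) * real h powr (- (2 - 2 * \<beta>)))"
    using msq_block_avg_le by blast
  define a where "a = gu * real (Suc (Suc r0))"
  have a: "0 < a" using gap_consts by (simp add: a_def)
  have "(\<lambda>h. real h powr (- (2 - 2 * \<beta>))) \<longlonglongrightarrow> 0"
    using beta by (intro tendsto_neg_powr filterlim_real_sequentially) auto
  hence "\<forall>\<^sub>F h in sequentially. real h powr (- (2 - 2 * \<beta>)) < \<eta> / (16 * C)"
    using ge C by (intro order_tendstoD) auto
  hence "\<forall>\<^sub>F h in sequentially. real h powr (- (2 - 2 * \<beta>)) < \<eta> / (16 * C) \<and> h1 \<le> h"
    using eventually_ge_at_top by (rule eventually_conj)
  then obtain h where h: "real h powr (- (2 - 2 * \<beta>)) < \<eta> / (16 * C)" "h1 \<le> h"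
    by (auto simp: eventually_at_top_linorder)
  have hC: "4 * (C * real h powr (- (2 - 2 * \<beta>))) \<le> \<eta> / 4"
    using h(1) C(1) by (simp add: field_simps)
  have hpos: "1 \<le> h" using h ge by simp
  \<comment> \<open>The contradiction takes the form \<open>\<eta> \<le> 4 * Z + 6 * B\<close>, with
    \<open>Z\<close> from the long average and \<open>B\<close> from the deviations. The length
    \<open>h\<close> makes \<open>4 * Z\<close> at most \<open>\<eta> / 4\<close>, and this choice
    makes \<open>6 * B\<close> equal to \<open>\<eta> / 4\<close>.\<close>
  define \<epsilon> where "\<epsilon> = \<eta> / (24 * (real h)\<^sup>2 * a\<^sup>2)"
  have \<epsilon>: "0 < \<epsilon>" using ge hpos a by (simp add: \<epsilon>_def)
  have h\<epsilon>: "6 * ((real h)\<^sup>2 * a\<^sup>2 * \<epsilon>) = \<eta> / 4" using hpos a by (simp add: \<epsilon>_def)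
  have "\<exists>j\<le>h. \<epsilon> * real n powr (4 - 2 * \<beta>) \<le> msq M (D n (Suc (Suc r0)) (k + j))"
    if n: "N \<le> n" "k + h + Suc (Suc r0) \<le> n" for n k
  proof (rule ccontr)
    assume "\<not> ?thesis"
    hence small: "msq M (D n (Suc (Suc r0)) (k + j)) \<le> \<epsilon> * real n powr (4 - 2 * \<beta>)" if "j \<le> h" for j
      using that by (meson not_le less_imp_le)
    have n0n: "n0 \<le> n" using n ge by simp
    note pos = real_n_pos[OF n0n]
    define P where "P = real n powr (2 - 2 * \<beta>)"
    have P: "0 < P" using pos by (simp add: P_def)
    \<comment> \<open>The short and the long block both start at \<open>k\<close>, so this variable
      is compared with either average.\<close>
    define D1 where "D1 = D n (Suc r0) k"
    have sD1: "sq_integrable M D1" unfolding D1_def using n n0n by (intro sq_D) auto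
    have savg: "sq_integrable M (block_avg n k g)" if "g \<le> h" for g
      using n n0n that by (intro sq_block_avg) auto
    have dev: "msq M (\<lambda>\<omega>. D1 \<omega> - block_avg n k g \<omega>) \<le> (real h)\<^sup>2 * a\<^sup>2 * \<epsilon> * P"
      if g: "1 \<le> g" "g \<le> h" for g
    proof -
      have "k + g + r0 \<le> n" "0 < g" using n g by auto
      then obtain \<alpha> where \<alpha>: "\<forall>m. \<bar>\<alpha> m\<bar> \<le> a / real n"
        "(\<lambda>\<omega>. D1 \<omega> - block_avg n k g \<omega>) = (\<lambda>\<omega>. \<Sum>m<g - 1. \<alpha> m * D n (Suc (Suc r0)) (k + m) \<omega>)"
        using block_avg_deviation[OF n0n, of k g 0] unfolding a_def D1_def add_0_right by blast
      have "(\<Sum>m<g - 1. \<bar>\<alpha> m\<bar>) \<le> (\<Sum>m<g - 1. a / real n)"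
        using \<alpha>(1) by (intro sum_mono) auto
      also have "\<dots> = real (g - 1) * (a / real n)" by simp
      also have "\<dots> \<le> real h * (a / real n)"
        using g a pos by (intro mult_right_mono) auto
      finally have "(\<Sum>m<g - 1. \<bar>\<alpha> m\<bar>)\<^sup>2 \<le> (real h * (a / real n))\<^sup>2"
        by (intro power_mono sum_nonneg) auto
      hence "(\<Sum>m<g - 1. \<bar>\<alpha> m\<bar>)\<^sup>2 * (\<epsilon> * real n powr (4 - 2 * \<beta>)) \<le>
          (real h * (a / real n))\<^sup>2 * (\<epsilon> * real n powr (4 - 2 * \<beta>))"
        using \<epsilon> by (intro mult_right_mono) auto
      moreover have "msq M (\<lambda>\<omega>. D1 \<omega> - block_avg n k g \<omega>) \<le>
          (\<Sum>m<g - 1. \<bar>\<alpha> m\<bar>)\<^sup>2 * (\<epsilon> * real n powr (4 - 2 * \<beta>))"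
        unfolding \<alpha>(2) using g n n0n by (intro msq_sum_le sq_D small) auto
      ultimately have "msq M (\<lambda>\<omega>. D1 \<omega> - block_avg n k g \<omega>) \<le>
          (real h * (a / real n))\<^sup>2 * (\<epsilon> * real n powr (4 - 2 * \<beta>))" by linarith
      also have "real n powr (4 - 2 * \<beta>) = (real n)\<^sup>2 * P"
        unfolding P_def n_powr_simps[OF pos] by simp
      also have "(real h * (a / real n))\<^sup>2 * (\<epsilon> * ((real n)\<^sup>2 * P)) = (real h)\<^sup>2 * a\<^sup>2 * \<epsilon> * P"
        using pos by (simp add: power_mult_distrib power_divide)
      finally show ?thesis .
    qed
    define B where "B = (real h)\<^sup>2 * a\<^sup>2 * \<epsilon>"
    define Z where "Z = C * real h powr (- (2 - 2 * \<beta>))"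
    have ah: "msq M (block_avg n k h) \<le> Z * P"
      using C(2)[OF n0n hpos, of k] n by (simp add: Z_def P_def mult_ac)
    have "msq M D1 = msq M (\<lambda>\<omega>. (D1 \<omega> - block_avg n k h \<omega>) + block_avg n k h \<omega>)" by simp
    also have "\<dots> \<le> 2 * msq M (\<lambda>\<omega>. D1 \<omega> - block_avg n k h \<omega>) + 2 * msq M (block_avg n k h)"
      by (intro msq_add_le sq_integrable_diff sD1 savg) auto
    also have "\<dots> \<le> 2 * (B * P) + 2 * (Z * P)"
      using dev[OF hpos] ah by (simp add: B_def)
    finally have D1: "msq M D1 \<le> 2 * (B * P) + 2 * (Z * P)" .
    have "\<eta> * P \<le> msq M (block_avg n k h1)"
      using ge(4) n h by (auto simp: P_def)
    also have "\<dots> = msq M (\<lambda>\<omega>. D1 \<omega> - (D1 \<omega> - block_avg n k h1 \<omega>))" by simp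
    also have "\<dots> \<le> 2 * msq M D1 + 2 * msq M (\<lambda>\<omega>. D1 \<omega> - block_avg n k h1 \<omega>)"
      using h by (intro msq_diff_le sq_integrable_diff sD1 savg) auto
    also have "\<dots> \<le> 2 * (2 * (B * P) + 2 * (Z * P)) + 2 * (B * P)"
      using dev[OF ge(1) h(2), folded B_def] D1 by (intro add_mono mult_left_mono) auto
    also have "\<dots> = (4 * Z + 6 * B) * P" by (simp add: algebra_simps)
    also have "\<dots> \<le> (\<eta> / 4 + \<eta> / 4) * P"
      using hC h\<epsilon> P by (intro mult_right_mono add_mono) (auto simp: Z_def B_def)
    finally have "\<eta> * P \<le> (\<eta> / 4 + \<eta> / 4) * P" .
    hence "\<eta> \<le> \<eta> / 4 + \<eta> / 4" using P by (simp only: mult_le_cancel_right_pos)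
    thus False using ge(2) by simp
  qed
  thus ?thesis using \<epsilon> ge(3) by (intro exI[of _ h] exI[of _ \<epsilon>] exI[of _ N]) auto
qed

text \<open>The definition of a Gaussian process speaks of sums over finite sets of times, each time
  once. The divided differences share nodes, so their combinations are first rewritten within the
  span \<open>sp\<close> of the observations.\<close>

lemma gaussian_rv_D_sum:
  assumes n: "n0 \<le> n" and fin: "finite A" and idx: "\<And>i. i \<in> A \<Longrightarrow> \<tau> i + r \<le> n"
  shows "gaussian_rv M (\<lambda>\<omega>. \<Sum>i\<in>A. c i * D n r (\<tau> i) \<omega>)"
proof -
  define J where "J = t n ` {0..n}"
  define sp where "sp = {U. \<exists>a. U = (\<lambda>\<omega>. \<Sum>s\<in>J. a s * X s \<omega>)}"
  have J: "finite J" "J \<subseteq> {0..T}" using design_mem[OF n] by (auto simp: J_def)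
  have lin: "(\<lambda>\<omega>. \<Sum>i\<in>B. b i * U i \<omega>) \<in> sp" if "\<And>i. i \<in> B \<Longrightarrow> U i \<in> sp"
    for B b and U :: "nat \<Rightarrow> 'a \<Rightarrow> real"
  proof -
    have "\<forall>i\<in>B. \<exists>a. U i = (\<lambda>\<omega>. \<Sum>s\<in>J. a s * X s \<omega>)" using that by (simp add: sp_def)
    from bchoice[OF this] obtain a where a: "\<forall>i\<in>B. U i = (\<lambda>\<omega>. \<Sum>s\<in>J. a i s * X s \<omega>)" ..
    have "(\<lambda>\<omega>. \<Sum>i\<in>B. b i * U i \<omega>) = (\<lambda>\<omega>. \<Sum>s\<in>J. (\<Sum>i\<in>B. b i * a i s) * X s \<omega>)"
    proof
      fix \<omega>
      have "(\<Sum>i\<in>B. b i * U i \<omega>) = (\<Sum>i\<in>B. \<Sum>s\<in>J. b i * a i s * X s \<omega>)"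
        by (intro sum.cong refl) (simp add: a sum_distrib_left mult.assoc)
      also have "\<dots> = (\<Sum>s\<in>J. \<Sum>i\<in>B. b i * a i s * X s \<omega>)" by (rule sum.swap)
      finally show "(\<Sum>i\<in>B. b i * U i \<omega>) = (\<Sum>s\<in>J. (\<Sum>i\<in>B. b i * a i s) * X s \<omega>)"
        by (simp add: sum_distrib_right)
    qed
    thus ?thesis unfolding sp_def mem_Collect_eq by (rule exI[of _ "\<lambda>s. \<Sum>i\<in>B. b i * a i s"])
  qed
  have X: "X s \<in> sp" if "s \<in> J" for s
    unfolding sp_def using that J
    by (auto intro!: exI[of _ "\<lambda>u. if u = s then 1 else 0"] simp: if_distrib[of "\<lambda>x. x * _"] cong: if_cong)
  have DD: "D n r k \<in> sp" if "k + r \<le> n" for k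
    unfolding div_diff_rv_eq_sum using that by (intro lin X) (auto simp: J_def)
  \<comment> \<open>Closure of \<open>sp\<close> under combinations is stated for natural indices,
    hence the enumeration of \<open>A\<close>.\<close>
  obtain f :: "nat \<Rightarrow> _" and m where f: "bij_betw f {0..<m} A"
    using ex_bij_betw_nat_finite[OF fin] by blast
  have "(\<lambda>\<omega>. \<Sum>i\<in>{0..<m}. c (f i) * D n r (\<tau> (f i)) \<omega>) \<in> sp"
    using f idx by (intro lin DD) (auto simp: bij_betw_def)
  moreover have "(\<Sum>i\<in>{0..<m}. c (f i) * D n r (\<tau> (f i)) \<omega>) = (\<Sum>i\<in>A. c i * D n r (\<tau> i) \<omega>)" for \<omega>
    using sum.reindex_bij_betw[OF f, of "\<lambda>i. c i * D n r (\<tau> i) \<omega>"] .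
  ultimately have "(\<lambda>\<omega>. \<Sum>i\<in>A. c i * D n r (\<tau> i) \<omega>) \<in> sp" by simp
  hence "\<exists>a. (\<lambda>\<omega>. \<Sum>i\<in>A. c i * D n r (\<tau> i) \<omega>) = (\<lambda>\<omega>. \<Sum>s\<in>J. a s * X s \<omega>)"
    unfolding sp_def mem_Collect_eq .
  then obtain a where "(\<lambda>\<omega>. \<Sum>i\<in>A. c i * D n r (\<tau> i) \<omega>) = (\<lambda>\<omega>. \<Sum>s\<in>J. a s * X s \<omega>)" ..
  thus ?thesis using gaussian J unfolding gaussian_process_def by simp
qed

end

section \<open>Deviations of the mean squares\<close>

context sampled_process
begin

text \<open>At order \<open>r0 + 1\<close> the factor \<open>real n powr (2 - 2 * \<beta>)\<close>
  meets the sum of \<open>d powr (\<beta> - 1)\<close>, which is of order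
  \<open>real n powr \<beta>\<close>. At lower orders the entries are bounded and a row is at most
  of order \<open>n\<close>, which is smaller since \<open>2 - \<beta> > 1\<close>.\<close>

lemma cov_D_row_sum:
  assumes "r \<le> Suc r0"
  shows "\<exists>C>0. \<forall>n\<ge>n0. \<forall>k. k + r \<le> n \<longrightarrow>
     (\<Sum>l\<in>{0..n - r}. \<bar>cov M (D n r k) (D n r l)\<bar>) \<le> C * real n powr (2 - \<beta>)"
proof (cases "r \<le> r0")
  case True
  obtain C where C: "0 < C" "\<And>n k. n0 \<le> n \<Longrightarrow> k + r \<le> n \<Longrightarrow> msq M (D n r k) \<le> C"
    using msq_D_le_const[OF True] by blast
  have "(\<Sum>l\<in>{0..n - r}. \<bar>cov M (D n r k) (D n r l)\<bar>) \<le> (2 * C) * real n powr (2 - \<beta>)"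
    if n: "n0 \<le> n" "k + r \<le> n" for n k
  proof -
    have n1: "1 \<le> real n" using n n0 by simp
    have "(\<Sum>l\<in>{0..n - r}. \<bar>cov M (D n r k) (D n r l)\<bar>) \<le> (\<Sum>l\<in>{0..n - r}. sqrt (C * C))"
      using n by (intro sum_mono cov_abs_le sq_D C) auto
    also have "\<dots> = real (n - r + 1) * C" using C by simp
    also have "\<dots> \<le> (2 * real n) * C" using C n1 n by (intro mult_right_mono) auto
    also have "\<dots> = 2 * C * real n powr 1" using n1 by simp
    also have "\<dots> \<le> 2 * C * real n powr (2 - \<beta>)"
      using C n1 beta by (intro mult_left_mono powr_mono) auto
    finally show ?thesis .
  qed
  thus ?thesis using C by (intro exI[of _ "2 * C"]) auto
next
  case False
  hence r: "r = Suc r0" using assms by simp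
  obtain C where C: "0 < C" "\<And>n k l. n0 \<le> n \<Longrightarrow> k + Suc r0 \<le> n \<Longrightarrow> l + Suc r0 \<le> n \<Longrightarrow>
     \<bar>cov M (D n (Suc r0) k) (D n (Suc r0) l)\<bar> \<le>
       C * (real n powr (2 - 2 * \<beta>) * (1 + \<bar>real k - real l\<bar>) powr (- (1 - \<beta>)))"
    using cov_D_Suc_r0 by blast
  define C' where "C' = C * (1 + 2 / \<beta>)"
  have "(\<Sum>l\<in>{0..n - r}. \<bar>cov M (D n r k) (D n r l)\<bar>) \<le> C' * real n powr (2 - \<beta>)"
    if n: "n0 \<le> n" "k + r \<le> n" for n k
  proof -
    have n1: "1 \<le> real n" using n n0 by simp
    define g where "g d = (1 + real d) powr (- (1 - \<beta>))" for d :: nat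
    have "(\<Sum>l\<in>{0..n - r}. g (nat \<bar>int k - int l\<bar>)) =
        g 0 + (\<Sum>l\<in>{0..n - r} - {k}. g (nat \<bar>int k - int l\<bar>))"
      using n sum.remove[of "{0..n - r}" k "\<lambda>l. g (nat \<bar>int k - int l\<bar>)"] by auto
    also have "(\<Sum>l\<in>{0..n - r} - {k}. g (nat \<bar>int k - int l\<bar>)) \<le> 2 * (\<Sum>d\<in>{1..n}. g d)"
      using n by (intro sum_distance_le) (auto simp: g_def)
    also have "(\<Sum>d\<in>{1..n}. g d) \<le> (\<Sum>d\<in>{1..n}. real d powr (\<beta> - 1))"
    proof (intro sum_mono)
      fix d assume "d \<in> {1..n}"
      hence "(1 + real d) powr (\<beta> - 1) \<le> real d powr (\<beta> - 1)"
        using beta by (intro powr_mono2') auto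
      thus "g d \<le> real d powr (\<beta> - 1)" by (simp add: g_def)
    qed
    also have "\<dots> \<le> real n powr \<beta> / \<beta>" using beta by (intro sum_powr_le) auto
    also have "g 0 \<le> real n powr \<beta>" using n1 beta by (simp add: g_def ge_one_powr_ge_zero)
    finally have sum: "(\<Sum>l\<in>{0..n - r}. g (nat \<bar>int k - int l\<bar>)) \<le> (1 + 2 / \<beta>) * real n powr \<beta>"
      by (simp add: distrib_right)
    have "(\<Sum>l\<in>{0..n - r}. \<bar>cov M (D n r k) (D n r l)\<bar>) \<le>
        (\<Sum>l\<in>{0..n - r}. C * (real n powr (2 - 2 * \<beta>) * g (nat \<bar>int k - int l\<bar>)))"
    proof (intro sum_mono)
      fix l assume "l \<in> {0..n - r}"
      hence l: "l + Suc r0 \<le> n" using n r by auto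
      have "real (nat \<bar>int k - int l\<bar>) = \<bar>real k - real l\<bar>" by simp
      thus "\<bar>cov M (D n r k) (D n r l)\<bar> \<le> C * (real n powr (2 - 2 * \<beta>) * g (nat \<bar>int k - int l\<bar>))"
        using C(2)[OF n(1) _ l, of k] n unfolding r g_def by simp
    qed
    also have "\<dots> = C * (real n powr (2 - 2 * \<beta>) * (\<Sum>l\<in>{0..n - r}. g (nat \<bar>int k - int l\<bar>)))"
      by (simp add: sum_distrib_left)
    also have "\<dots> \<le> C * (real n powr (2 - 2 * \<beta>) * ((1 + 2 / \<beta>) * real n powr \<beta>))"
      using C sum by (intro mult_left_mono) auto
    also have "\<dots> = C' * (real n powr (2 - 2 * \<beta>) * real n powr \<beta>)"
      by (simp add: C'_def)
    also have "real n powr (2 - 2 * \<beta>) * real n powr \<beta> = real n powr (2 - \<beta>)"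
      by (simp flip: powr_add)
    finally show ?thesis .
  qed
  moreover have "0 < C'" using C beta by (auto simp: C'_def intro!: mult_pos_pos add_pos_pos)
  ultimately show ?thesis by blast
qed

lemma D_upper_tail:
  assumes "r \<le> Suc r0"
  shows "\<exists>C>0. \<forall>n\<ge>n0. r \<le> n \<longrightarrow> (\<forall>y.
     prob {\<omega> \<in> space M. y \<le> (\<Sum>k=0..n - r. (D n r k \<omega>)\<^sup>2)} \<le>
       exp (real (n - r + 1) / 2 - (y / 2 - real (n - r + 1) * C) / (C * real n powr (2 - \<beta>))))"
proof -
  obtain C1 where C1: "0 < C1" "\<And>n k. n0 \<le> n \<Longrightarrow> k + r \<le> n \<Longrightarrow>
     (\<Sum>l\<in>{0..n - r}. \<bar>cov M (D n r k) (D n r l)\<bar>) \<le> C1 * real n powr (2 - \<beta>)"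
    using cov_D_row_sum[OF assms] by blast
  obtain C2 where C2: "0 < C2" "\<And>n k. n0 \<le> n \<Longrightarrow> k + r \<le> n \<Longrightarrow> \<bar>expectation (D n r k)\<bar> \<le> C2"
    using expectation_D_bounded[OF assms] by blast
  \<comment> \<open>One constant for rows and means: a quarter of it dominates the row sums, which
    cancels the 4 in the tail bound, and the whole dominates the squared means.\<close>
  define C where "C = 4 * C1 + C2\<^sup>2"
  have C: "0 < C" "C1 \<le> C / 4" "C2\<^sup>2 \<le> C" using C1 by (auto simp: C_def add_pos_nonneg)
  have "prob {\<omega> \<in> space M. y \<le> (\<Sum>k\<in>{0..n - r}. (D n r k \<omega>)\<^sup>2)} \<le>
       exp (real (card {0..n - r}) / 2 - (y / 2 - real (card {0..n - r}) * C) / (4 * (C / 4 * real n powr (2 - \<beta>))))"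
    if n: "n0 \<le> n" "r \<le> n" for n y
  proof (rule gaussian_sum_squares_upper_tail)
    show "gaussian_rv M (\<lambda>\<omega>. \<Sum>k\<in>{0..n - r}. c k * D n r k \<omega>)" for c
      using n by (intro gaussian_rv_D_sum) auto
    fix k assume "k \<in> {0..n - r}"
    hence k: "k + r \<le> n" using n by auto
    have "C1 * real n powr (2 - \<beta>) \<le> C / 4 * real n powr (2 - \<beta>)"
      using C by (intro mult_right_mono) auto
    thus "(\<Sum>l\<in>{0..n - r}. \<bar>cov M (D n r k) (D n r l)\<bar>) \<le> C / 4 * real n powr (2 - \<beta>)"
      using C1(2)[OF n(1) k] by linarith
    have "(expectation (D n r k))\<^sup>2 \<le> C2\<^sup>2"
      using C2(2)[OF n(1) k] C2(1) by (simp add: abs_le_square_iff[symmetric])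
    thus "(expectation (D n r k))\<^sup>2 \<le> C" using C by linarith
  qed (use C real_n_pos[OF n(1)] in auto)
  thus ?thesis using C by (intro exI[of _ C]) auto
qed

text \<open>Up to constants, a bound for the off-diagonal row sums at order \<open>r0 + 2\<close>,
  divided by the order of the variances.\<close>

definition decay_sum :: "nat \<Rightarrow> real" where
  "decay_sum n = (\<Sum>j=1..n. real j powr (- \<kappa>))"

text \<open>Distances within a residue class modulo \<open>q\<close> are multiples of
  \<open>q\<close>, so the row sum of the class is \<open>q\<close> times smaller than the full
  one.\<close>

lemma coset_row_sum:
  assumes q: "1 \<le> q" and I: "I \<le> n" and i: "i < I"
  shows "(\<Sum>j\<in>{j. j < I \<and> j mod q = i mod q} - {i}. \<bar>real i - real j\<bar> powr (- \<kappa>)) \<le>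
           2 * (decay_sum n / real q)"
proof -
  define g where "g d = real d powr (- \<kappa>)" for d :: nat
  define m where "m = I div q"
  define S where "S = (\<lambda>m. m * q) ` {1..m}"
  have inj: "inj_on (\<lambda>m. m * q) {1..m}" using q by (auto simp: inj_on_def)
  have "(\<Sum>j\<in>{j. j < I \<and> j mod q = i mod q} - {i}. g (nat \<bar>int i - int j\<bar>)) \<le> 2 * (\<Sum>d\<in>S. g d)"
  proof (rule sum_distance_le)
    fix j assume "j \<in> {j. j < I \<and> j mod q = i mod q}" "j \<noteq> i"
    hence j: "j < I" "j mod q = i mod q" "j \<noteq> i" by auto
    have "int q dvd int i - int j"
      using j(2) by (metis mod_eq_dvd_iff zmod_int)
    hence "int q dvd int (nat \<bar>int i - int j\<bar>)" by simp
    hence "q dvd nat \<bar>int i - int j\<bar>" by (simp only: int_dvd_int_iff)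
    then obtain x where x: "nat \<bar>int i - int j\<bar> = x * q" by (metis dvd_def mult.commute)
    have "nat \<bar>int i - int j\<bar> \<le> I" "0 < nat \<bar>int i - int j\<bar>" using i j by auto
    hence "x * q \<le> I" "0 < x * q" unfolding x .
    hence "x \<in> {1..m}" using q by (auto simp: m_def less_eq_div_iff_mult_less_eq Suc_le_eq)
    thus "nat \<bar>int i - int j\<bar> \<in> S" unfolding x S_def by blast
  qed (auto simp: S_def g_def)
  also have "(\<Sum>d\<in>S. g d) = (\<Sum>x=1..m. g (x * q))"
    unfolding S_def by (subst sum.reindex[OF inj]) simp
  also have "\<dots> \<le> decay_sum n / real q"
  proof -
    have "antimono_on {1..} g"
      using kappa_pos by (auto simp: monotone_on_def g_def intro!: powr_mono2')
    from sum_multiples_le[OF this, of q m]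
    have "real q * (\<Sum>x=1..m. g (x * q)) \<le> (\<Sum>d=1..m * q. g d)" .
    also have "\<dots> \<le> (\<Sum>d=1..n. g d)"
    proof (rule sum_mono2)
      have "m * q \<le> I" by (simp add: m_def)
      thus "{1..m * q} \<subseteq> {1..n}" using I by auto
    qed (auto simp: g_def)
    finally show ?thesis using q by (simp add: decay_sum_def g_def field_simps)
  qed
  finally show ?thesis by (simp add: g_def)
qed

lemma card_coset_ge:
  assumes "a < q"
  shows "I div q \<le> card {i. i < I \<and> i mod q = (a :: nat)}"
proof -
  have "(\<lambda>x. x * q + a) ` {..<I div q} \<subseteq> {i. i < I \<and> i mod q = a}"
  proof safe
    fix x assume "x < I div q"
    hence "Suc x \<le> I div q" by simp
    hence "Suc x * q \<le> I div q * q" by (rule mult_le_mono1)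
    also have "\<dots> \<le> I" by simp
    finally show "x * q + a < I" using assms by simp
  qed (use assms in simp)
  hence "card ((\<lambda>x. x * q + a) ` {..<I div q}) \<le> card {i. i < I \<and> i mod q = a}"
    by (intro card_mono) auto
  moreover have "inj_on (\<lambda>x. x * q + a) {..<I div q}" using assms by (auto simp: inj_on_def)
  ultimately show ?thesis by (simp add: card_image)
qed

text \<open>One index of large variance is selected in each window, and the selected indices are split
  into \<open>q\<close> residue classes. Within a class the covariance matrix is diagonally dominant as soon as
  \<open>q\<close> is a large multiple of \<^const>\<open>decay_sum\<close>; and if the whole sum of squares is at most \<open>y\<close>,
  some class contributes at most \<open>y / q\<close>.\<close>

lemma D_lower_tail:
  "\<exists>w \<epsilon> C N. 1 \<le> w \<and> 0 < \<epsilon> \<and> 0 < C \<and> n0 \<le> N \<and> (\<forall>n\<ge>N. \<forall>q\<ge>1. C * decay_sum n \<le> real q \<longrightarrow> (\<forall>y.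
     prob {\<omega> \<in> space M. (\<Sum>k=0..n - Suc (Suc r0). (D n (Suc (Suc r0)) k \<omega>)\<^sup>2) \<le> y} \<le>
       real q * exp (8 * y / (real q * \<epsilon> * real n powr (4 - 2 * \<beta>)) -
         real ((n - Suc (Suc r0)) div w div q) / 4)))"
proof -
  define r where "r = Suc (Suc r0)"
  obtain h \<epsilon> N1 where win: "0 < \<epsilon>" "n0 \<le> N1" "\<forall>n\<ge>N1. \<forall>k. k + h + Suc (Suc r0) \<le> n \<longrightarrow>
     (\<exists>j\<le>h. \<epsilon> * real n powr (4 - 2 * \<beta>) \<le> msq M (D n (Suc (Suc r0)) (k + j)))"
    using msq_D_Suc_Suc_r0_window by (elim exE conjE)
  obtain Cm where Cm: "0 < Cm" "\<And>n k. n0 \<le> n \<Longrightarrow> k + r \<le> n \<Longrightarrow> \<bar>expectation (D n r k)\<bar> \<le> Cm * real n"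
    using expectation_D_Suc_Suc_r0 unfolding r_def by blast
  obtain Cc where Cc: "0 < Cc" "\<And>n k l. n0 \<le> n \<Longrightarrow> k + r \<le> n \<Longrightarrow> l + r \<le> n \<Longrightarrow>
     \<bar>cov M (D n r k) (D n r l)\<bar> \<le>
       Cc * (real n powr (4 - 2 * \<beta>) * (1 + \<bar>real k - real l\<bar>) powr (- \<kappa>))"
    using cov_D_Suc_Suc_r0 unfolding r_def by blast
  define w where "w = Suc h"
  \<comment> \<open>From some size on, 32 times the squared means stays below
    \<open>\<epsilon> * V\<close>. This leaves variances of at least half of
    \<open>\<epsilon> * V\<close>, and the means then use up no more than half of the exponent
    \<open>c / 2\<close> of the tail bound.\<close>
  have "filterlim (\<lambda>n. real n powr (2 - 2 * \<beta>)) at_top sequentially"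
    using beta by real_asymp
  hence "\<forall>\<^sub>F n in sequentially. 32 * Cm\<^sup>2 / \<epsilon> \<le> real n powr (2 - 2 * \<beta>)"
    by (simp add: filterlim_at_top)
  then obtain N2 where N2: "\<And>n. N2 \<le> n \<Longrightarrow> 32 * Cm\<^sup>2 / \<epsilon> \<le> real n powr (2 - 2 * \<beta>)"
    by (auto simp: eventually_at_top_linorder)
  \<comment> \<open>Exactly what diagonal dominance requires:
    \<open>2 * Cc * V * decay_sum n / q\<close> must not exceed \<open>d / 2\<close>, which is
    \<open>\<epsilon> * V / 4\<close>.\<close>
  define C where "C = 8 * Cc / \<epsilon>"
  have C: "0 < C" using Cc win by (simp add: C_def)
  have "prob {\<omega> \<in> space M. (\<Sum>k=0..n - r. (D n r k \<omega>)\<^sup>2) \<le> y} \<le>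
       real q * exp (8 * y / (real q * \<epsilon> * real n powr (4 - 2 * \<beta>)) - real ((n - r) div w div q) / 4)"
    if n: "max N1 N2 \<le> n" and q: "1 \<le> q" "C * decay_sum n \<le> real q" for n q y
  proof -
    have n0n: "n0 \<le> n" and N1n: "N1 \<le> n" and N2n: "N2 \<le> n" using n win by auto
    note pos = real_n_pos[OF n0n]
    define V where "V = real n powr (4 - 2 * \<beta>)"
    have V: "0 < V" using pos by (simp add: V_def)
    have V2: "V = (real n)\<^sup>2 * real n powr (2 - 2 * \<beta>)"
      unfolding V_def n_powr_simps[OF pos] by simp
    have "32 * Cm\<^sup>2 \<le> \<epsilon> * real n powr (2 - 2 * \<beta>)"
      using N2[OF N2n] win by (simp add: field_simps)
    hence "(real n)\<^sup>2 * (32 * Cm\<^sup>2) \<le> (real n)\<^sup>2 * (\<epsilon> * real n powr (2 - 2 * \<beta>))"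
      by (intro mult_left_mono) auto
    hence meanV: "32 * (Cm * real n)\<^sup>2 \<le> \<epsilon> * V" by (simp add: V2 power_mult_distrib mult_ac)
    define I where "I = (n - r) div w"
    have "\<exists>j\<le>h. \<epsilon> * V \<le> msq M (D n r (i * w + j))" if "i < I" for i
    proof -
      have "Suc i * w \<le> I * w" using that by (intro mult_le_mono1) simp
      also have "\<dots> \<le> n - r" by (simp add: I_def)
      finally have "Suc i * w \<le> n - r" .
      moreover have "0 < Suc i * w" by (simp add: w_def)
      ultimately have "i * w + h + r \<le> n" by (simp add: w_def)
      thus ?thesis using win(3) N1n unfolding V_def r_def by blast
    qed
    then obtain j where j: "\<And>i. i < I \<Longrightarrow> j i \<le> h \<and> \<epsilon> * V \<le> msq M (D n r (i * w + j i))" by metis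
    define k where "k i = i * w + j i" for i
    have kr: "k i + r \<le> n" if "i < I" for i
    proof -
      have "Suc i * w \<le> I * w" using that by (intro mult_le_mono1) simp
      also have "\<dots> \<le> n - r" by (simp add: I_def)
      finally have "Suc i * w \<le> n - r" .
      moreover have "k i < Suc i * w" using j[OF that] by (simp add: k_def w_def)
      ultimately show ?thesis by linarith
    qed
    have k_less: "i' - i + k i \<le> k i' + 1 \<and> k i < k i'" if ii: "i < i'" "i' < I" for i i'
    proof -
      obtain e where e: "i' = Suc (i + e)" using less_imp_Suc_add[OF ii(1)] by blast
      have "k i' = i * w + w + e * w + j i'" by (simp add: k_def e algebra_simps)
      moreover have "k i \<le> i * w + h" using j[of i] ii by (simp add: k_def)
      moreover have "e \<le> e * w" by (simp add: w_def)
      ultimately show ?thesis by (simp add: e w_def)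
    qed
    have k_inj: "inj_on k {..<I}"
      by (rule inj_onI) (metis k_less lessThan_iff less_irrefl nat_neq_iff)
    \<comment> \<open>The covariance bound contains \<open>1 + \<bar>k i - k i'\<bar>\<close>, so
      the decay may be measured by the numbers of the windows, and residue classes of these numbers
      can be used whatever index was selected inside a window.\<close>
    have k_dist: "\<bar>real i - real i'\<bar> \<le> 1 + \<bar>real (k i) - real (k i')\<bar>" if "i < I" "i' < I" for i i'
    proof -
      have *: "\<bar>real i - real i'\<bar> \<le> 1 + \<bar>real (k i) - real (k i')\<bar>" if "i < i'" "i' < I" for i i'
      proof -
        have "real (i' - i + k i) \<le> real (k i' + 1)" using k_less[OF that] by (simp only: of_nat_le_iff)
        thus ?thesis using that by (simp add: of_nat_diff)
      qed
      show ?thesis using *[of i i'] *[of i' i] that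
        by (cases i i' rule: linorder_cases) (auto simp: abs_minus_commute)
    qed
    define A where "A a = {i. i < I \<and> i mod q = a}" for a
    have finA: "finite (A a)" for a by (simp add: A_def)
    define U where "U i = D n r (k i)" for i
    define d where "d = \<epsilon> / 2 * V"
    have d: "0 < d" using win V by (simp add: d_def)
    have measU[measurable]: "U i \<in> borel_measurable M" if "i < I" for i
      unfolding U_def using sq_D[OF n0n kr[OF that]] by (simp add: sq_integrable_def)
    have cls: "prob {\<omega> \<in> space M. (\<Sum>i\<in>A a. (U i \<omega>)\<^sup>2) \<le> y / real q} \<le>
        exp (8 * y / (real q * \<epsilon> * V) - real (I div q) / 4)" if a: "a < q" for a
    proof -
      define c where "c = real (card (A a))"
      have "prob {\<omega> \<in> space M. (\<Sum>i\<in>A a. (U i \<omega>)\<^sup>2) \<le> y / real q} \<le>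
          exp (4 * (y / real q + c * (Cm * real n)\<^sup>2) / d - c / 2)"
        unfolding c_def
      proof (rule gaussian_sum_squares_lower_tail[OF finA _ _ d])
        show "gaussian_rv M (\<lambda>\<omega>. \<Sum>i\<in>A a. c i * U i \<omega>)" for c
          unfolding U_def using kr by (intro gaussian_rv_D_sum n0n finA) (auto simp: A_def)
        fix i assume "i \<in> A a"
        hence i: "i < I" "i mod q = a" by (auto simp: A_def)
        have m: "(expectation (U i))\<^sup>2 \<le> (Cm * real n)\<^sup>2"
          using Cm(2)[OF n0n kr[OF i(1)]] Cm(1) pos unfolding U_def
          by (simp add: abs_le_square_iff[symmetric])
        thus "(expectation (U i))\<^sup>2 \<le> (Cm * real n)\<^sup>2" .
        have "\<epsilon> * V \<le> msq M (U i)" using j[OF i(1)] by (simp add: U_def k_def)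
        moreover have "0 \<le> (Cm * real n)\<^sup>2" by simp
        ultimately show "d \<le> cov M (U i) (U i)"
          unfolding cov_self d_def using m meanV by linarith
        have "(\<Sum>j\<in>A a - {i}. \<bar>cov M (U i) (U j)\<bar>) \<le>
            (\<Sum>j\<in>A a - {i}. Cc * V * \<bar>real i - real j\<bar> powr (- \<kappa>))"
        proof (intro sum_mono)
          fix j assume "j \<in> A a - {i}"
          hence jj: "j < I" "j \<noteq> i" by (auto simp: A_def)
          have "\<bar>cov M (U i) (U j)\<bar> \<le> Cc * (V * (1 + \<bar>real (k i) - real (k j)\<bar>) powr (- \<kappa>))"
            unfolding U_def V_def using kr i jj n0n by (intro Cc(2)) auto
          also have "(1 + \<bar>real (k i) - real (k j)\<bar>) powr (- \<kappa>) \<le> \<bar>real i - real j\<bar> powr (- \<kappa>)"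
            using k_dist[OF i(1) jj(1)] jj kappa_pos by (intro powr_mono2') auto
          finally show "\<bar>cov M (U i) (U j)\<bar> \<le> Cc * V * \<bar>real i - real j\<bar> powr (- \<kappa>)"
            using Cc(1) V by (simp add: mult_left_mono mult.assoc)
        qed
        also have "\<dots> = Cc * V * (\<Sum>j\<in>A a - {i}. \<bar>real i - real j\<bar> powr (- \<kappa>))"
          by (simp add: sum_distrib_left)
        also have "\<dots> \<le> Cc * V * (2 * (decay_sum n / real q))"
        proof -
          have "I \<le> n" unfolding I_def by (meson diff_le_self div_le_dividend order_trans)
          thus ?thesis using coset_row_sum[OF q(1) _ i(1), of n] Cc V i
            unfolding A_def by (intro mult_left_mono) auto
        qed
        also have "\<dots> \<le> d / 2"
        proof -
          have "8 * Cc * decay_sum n \<le> \<epsilon> * real q" using q(2) win by (simp add: C_def field_simps)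
          hence "V * (8 * Cc * decay_sum n) \<le> V * (\<epsilon> * real q)" using V by (intro mult_left_mono) auto
          thus ?thesis using q(1) by (simp add: d_def field_simps)
        qed
        finally show "(\<Sum>j\<in>A a - {i}. \<bar>cov M (U i) (U j)\<bar>) \<le> d / 2" .
      qed
      also have "\<dots> \<le> exp (8 * y / (real q * \<epsilon> * V) - real (I div q) / 4)"
      proof (subst exp_le_cancel_iff)
        have c: "real (I div q) \<le> c" unfolding c_def A_def using card_coset_ge[OF a] by simp
        have "4 * (c * (Cm * real n)\<^sup>2) / d \<le> c / 4"
        proof -
          have "c * (32 * (Cm * real n)\<^sup>2) \<le> c * (\<epsilon> * V)"
            using meanV by (intro mult_left_mono) (auto simp: c_def)
          thus ?thesis using d by (simp add: d_def field_simps)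
        qed
        moreover have "4 * (y / real q) / d = 8 * y / (real q * \<epsilon> * V)"
          using win V q by (simp add: d_def field_simps)
        ultimately show "4 * (y / real q + c * (Cm * real n)\<^sup>2) / d - c / 2 \<le>
            8 * y / (real q * \<epsilon> * V) - real (I div q) / 4"
          using c by (simp add: distrib_left add_divide_distrib)
      qed
      finally show ?thesis .
    qed
    have "prob {\<omega> \<in> space M. (\<Sum>k=0..n - r. (D n r k \<omega>)\<^sup>2) \<le> y} \<le>
        prob (\<Union>a\<in>{..<q}. {\<omega> \<in> space M. (\<Sum>i\<in>A a. (U i \<omega>)\<^sup>2) \<le> y / real q})"
    proof (intro finite_measure_mono subsetI)
      fix \<omega> assume "\<omega> \<in> {\<omega> \<in> space M. (\<Sum>k=0..n - r. (D n r k \<omega>)\<^sup>2) \<le> y}"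
      hence \<omega>: "\<omega> \<in> space M" "(\<Sum>k=0..n - r. (D n r k \<omega>)\<^sup>2) \<le> y" by auto
      have "(\<Sum>a<q. \<Sum>i\<in>A a. (U i \<omega>)\<^sup>2) = (\<Sum>i<I. (U i \<omega>)\<^sup>2)"
      proof -
        have "(\<Sum>a<q. \<Sum>i\<in>{i. i \<in> {..<I} \<and> i mod q = a}. (U i \<omega>)\<^sup>2) = (\<Sum>i<I. (U i \<omega>)\<^sup>2)"
          using q by (intro sum.group) auto
        thus ?thesis by (simp add: A_def)
      qed
      also have "\<dots> = (\<Sum>x\<in>k ` {..<I}. (D n r x \<omega>)\<^sup>2)"
        using k_inj by (simp add: sum.reindex U_def)
      also have "\<dots> \<le> (\<Sum>k=0..n - r. (D n r k \<omega>)\<^sup>2)"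
        using kr by (intro sum_mono2) (auto simp: le_diff_conv2 add_le_imp_le_diff)
      finally have le: "(\<Sum>a<q. \<Sum>i\<in>A a. (U i \<omega>)\<^sup>2) \<le> y" using \<omega> by simp
      have "\<exists>a<q. (\<Sum>i\<in>A a. (U i \<omega>)\<^sup>2) \<le> y / real q"
      proof (rule ccontr)
        assume "\<not> ?thesis"
        hence "(\<Sum>a<q. y / real q) < (\<Sum>a<q. \<Sum>i\<in>A a. (U i \<omega>)\<^sup>2)"
          using q by (intro sum_strict_mono) (auto simp: not_le lessThan_empty_iff)
        thus False using le q by simp
      qed
      thus "\<omega> \<in> (\<Union>a\<in>{..<q}. {\<omega> \<in> space M. (\<Sum>i\<in>A a. (U i \<omega>)\<^sup>2) \<le> y / real q})"
        using \<omega> by auto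
    qed (auto simp: A_def)
    also have "\<dots> \<le> (\<Sum>a<q. prob {\<omega> \<in> space M. (\<Sum>i\<in>A a. (U i \<omega>)\<^sup>2) \<le> y / real q})"
      by (intro finite_measure_subadditive_finite) (auto simp: A_def)
    also have "\<dots> \<le> (\<Sum>a<q. exp (8 * y / (real q * \<epsilon> * V) - real (I div q) / 4))"
      by (intro sum_mono cls) auto
    finally show ?thesis by (simp add: V_def I_def)
  qed
  thus ?thesis unfolding r_def[symmetric] using win C
    by (intro exI[of _ w] exI[of _ \<epsilon>] exI[of _ C] exI[of _ "max N1 N2"]) (auto simp: w_def)
qed

end

section \<open>Error probabilities of the estimator\<close>

lemma rate_eq: "rate C \<beta> p n = C * rate 1 \<beta> p n"
  by (simp add: rate_def)

lemma rate_one_le: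
  assumes "0 < \<beta>" "\<beta> < 1"
  shows "\<forall>\<^sub>F n in sequentially. rate 1 \<beta> p n \<le> real n"
proof -
  consider "p \<noteq> 1" | "p = 1" "\<beta> < 1/2" | "p = 1" "\<beta> = 1/2" | "p = 1" "1/2 < \<beta>" by linarith
  thus ?thesis
  proof cases
    case 3
    have "\<forall>\<^sub>F n in sequentially. real n / ln (real n) \<le> real n" by real_asymp
    thus ?thesis by eventually_elim (simp add: rate_def 3)
  next
    case 4
    have "\<forall>\<^sub>F n in sequentially. real n powr (2 - 2 * \<beta>) \<le> real n"
      using eventually_ge_at_top[of 1]
    proof eventually_elim
      case (elim n)
      have "real n powr (2 - 2 * \<beta>) \<le> real n powr 1" using elim 4 by (intro powr_mono) auto
      thus ?case using elim by simp
    qed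
    thus ?thesis by eventually_elim (use 4 assms in \<open>simp add: rate_def\<close>)
  qed (use assms in \<open>simp_all add: rate_def\<close>)
qed

text \<open>Every rate dominates the logarithm, so a factor \<open>n\<close> in front of the
  exponential can be absorbed by a smaller constant.\<close>

lemma ln_le_rate_one:
  assumes "0 < \<beta>" "\<beta> < 1" "0 < a"
  shows "\<forall>\<^sub>F n in sequentially. ln (real n) \<le> a * rate 1 \<beta> p n"
proof -
  consider "p \<noteq> 1" | "p = 1" "\<beta> < 1/2" | "p = 1" "\<beta> = 1/2" | "p = 1" "1/2 < \<beta>" by linarith
  moreover have "\<forall>\<^sub>F n in sequentially. ln (real n) \<le> a * real n" using assms(3) by real_asymp
  moreover have "\<forall>\<^sub>F n in sequentially. ln (real n) \<le> a * (real n / ln (real n))"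
    using assms(3) by real_asymp
  moreover have "\<forall>\<^sub>F n in sequentially. ln (real n) \<le> a * real n powr (2 - 2 * \<beta>)"
    using assms by real_asymp
  ultimately show ?thesis
    using assms by cases (simp_all add: rate_def)
qed

context sampled_process
begin

section \<open>Comparison of the rate with the decay sum\<close>

lemma decay_sum_bounds:
  assumes "1 \<le> n"
  shows "1 \<le> decay_sum n" "decay_sum n \<le> real n"
proof -
  have "(\<Sum>j\<in>{1::nat}. real j powr (- \<kappa>)) \<le> decay_sum n"
    unfolding decay_sum_def using assms by (intro sum_mono2) auto
  thus "1 \<le> decay_sum n" by simp
  have "decay_sum n \<le> (\<Sum>j=1..n. 1)"
    unfolding decay_sum_def
  proof (intro sum_mono)
    fix j assume "j \<in> {1..n}"
    thus "real j powr (- \<kappa>) \<le> 1" using powr_mono2'[of "- \<kappa>" 1 "real j"] kappa_pos by simp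
  qed
  thus "decay_sum n \<le> real n" by simp
qed

text \<open>The three regimes of the rate are those of the partial sums of
  \<open>j powr (- \<kappa>)\<close>: convergent for \<open>\<kappa> > 1\<close>, logarithmic for
  \<open>\<kappa> = 1\<close>, and of order \<open>real n powr (2 * \<beta> - 1)\<close> for
  \<open>p = 1\<close> and \<open>\<beta> > 1/2\<close>.\<close>

lemma rate_le_decay:
  "\<exists>c>0. \<forall>\<^sub>F n in sequentially. c * rate 1 \<beta> p n \<le> real n / decay_sum n"
proof -
  have red: "?thesis" if S: "0 < S" and ev: "\<forall>\<^sub>F n in sequentially. rate 1 \<beta> p n * decay_sum n \<le> S * real n" for S
  proof -
    have "\<forall>\<^sub>F n in sequentially. (1 / S) * rate 1 \<beta> p n \<le> real n / decay_sum n"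
      using ev eventually_ge_at_top[of 1]
    proof eventually_elim
      case (elim n)
      have "0 < decay_sum n" using decay_sum_bounds(1)[OF elim(2)] by simp
      thus ?case using elim(1) S by (simp add: field_simps)
    qed
    thus ?thesis using S by (intro exI[of _ "1 / S"]) auto
  qed
  consider "1 < \<kappa>" | "p = 1" "\<beta> = 1/2" | "p = 1" "1/2 < \<beta>"
  proof (cases "p = 1")
    case True
    hence "\<kappa> = 2 - 2 * \<beta>" unfolding \<kappa>_def by simp
    thus thesis using that True by argo
  next
    case False
    hence "p = 2" using p by simp
    hence "\<kappa> = 4 - 2 * \<beta>" unfolding \<kappa>_def by simp
    thus thesis using that(1) beta by simp
  qed
  thus ?thesis
  proof cases
    case 1
    have "summable (\<lambda>j. real j powr (- \<kappa>))" using 1 by (simp add: summable_real_powr_iff)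
    hence S: "decay_sum n \<le> (\<Sum>j. real j powr (- \<kappa>))" for n
      unfolding decay_sum_def by (intro sum_le_suminf) auto
    show ?thesis
    proof (rule red)
      show "0 < (\<Sum>j. real j powr (- \<kappa>))" using S[of 1] decay_sum_bounds(1)[of 1] by simp
      show "\<forall>\<^sub>F n in sequentially. rate 1 \<beta> p n * decay_sum n \<le> (\<Sum>j. real j powr (- \<kappa>)) * real n"
        using rate_one_le[OF beta, of p] eventually_ge_at_top[of 1]
      proof eventually_elim
        case (elim n)
        have "0 \<le> decay_sum n" using decay_sum_bounds(1)[OF elim(2)] by simp
        hence "rate 1 \<beta> p n * decay_sum n \<le> real n * decay_sum n" using elim by (intro mult_right_mono)
        also have "\<dots> \<le> real n * (\<Sum>j. real j powr (- \<kappa>))" using S by (intro mult_left_mono) auto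
        finally show ?case by (simp add: mult.commute)
      qed
    qed
  next
    case 2
    have k: "\<kappa> = 1" unfolding \<kappa>_def using 2 by simp
    have le: "decay_sum n \<le> 1 + ln (real n)" if "1 \<le> n" for n
      unfolding decay_sum_def k using that
    proof (induction n rule: dec_induct)
      case (step n)
      have "1 / (real n + 1) \<le> ln ((real n + 1) / real n)"
        using ln_le_minus_one[of "real n / (real n + 1)"] step
        by (simp add: ln_div field_simps)
      thus ?case using step by (simp add: ln_div powr_minus_divide add.commute)
    qed simp
    have ev: "\<forall>\<^sub>F n in sequentially. 1 \<le> ln (real n)" by real_asymp
    show ?thesis
    proof (rule red)
      show "\<forall>\<^sub>F n in sequentially. rate 1 \<beta> p n * decay_sum n \<le> 2 * real n"
        using ev eventually_ge_at_top[of 1]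
      proof eventually_elim
        case (elim n)
        have "decay_sum n \<le> 2 * ln (real n)" using le[of n] elim by simp
        hence "real n / ln (real n) * decay_sum n \<le> real n / ln (real n) * (2 * ln (real n))"
          using elim by (intro mult_left_mono) auto
        also have "\<dots> = 2 * real n"
        proof -
          have "ln (real n) \<noteq> 0" using elim(1) by linarith
          thus ?thesis by (metis mult.left_commute nonzero_eq_divide_eq)
        qed
        finally show ?case by (simp add: rate_def 2)
      qed
    qed simp
  next
    case 3
    have k: "\<kappa> = 2 - 2 * \<beta>" unfolding \<kappa>_def using 3 by simp
    have le: "decay_sum n \<le> real n powr (2 * \<beta> - 1) / (2 * \<beta> - 1)" for n
      unfolding decay_sum_def k using sum_powr_le[of "2 * \<beta> - 1" n] 3(2) beta by simp
    show ?thesis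
    proof (rule red)
      show "\<forall>\<^sub>F n in sequentially. rate 1 \<beta> p n * decay_sum n \<le> 1 / (2 * \<beta> - 1) * real n"
        using eventually_ge_at_top[of 1]
      proof eventually_elim
        case (elim n)
        have "real n powr (2 - 2 * \<beta>) * decay_sum n \<le>
            real n powr (2 - 2 * \<beta>) * (real n powr (2 * \<beta> - 1) / (2 * \<beta> - 1))"
          using le by (intro mult_left_mono) auto
        also have "\<dots> = (real n powr (2 - 2 * \<beta>) * real n powr (2 * \<beta> - 1)) / (2 * \<beta> - 1)" by simp
        also have "real n powr (2 - 2 * \<beta>) * real n powr (2 * \<beta> - 1) = real n"
          using elim by (simp flip: powr_add)
        finally show ?case using 3 beta by (simp add: rate_def)
      qed
      show "0 < 1 / (2 * \<beta> - 1)" using 3 by simp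
    qed
  qed
qed

section \<open>Probabilities of crossing the threshold\<close>

lemma mean_sq_div_diff_eq:
  "mean_sq_div_diff (t n) n 1 r (\<lambda>s. X s \<omega>) = (\<Sum>k=0..n - r. (D n r k \<omega>)\<^sup>2) / real (n - r + 1)"
  by (simp add: mean_sq_div_diff_def div_diff_rv_def)

lemma measurable_mean_sq [measurable]:
  assumes "n0 \<le> n" "r \<le> n"
  shows "(\<lambda>\<omega>. mean_sq_div_diff (t n) n 1 r (\<lambda>s. X s \<omega>)) \<in> borel_measurable M"
proof -
  have "D n r k \<in> borel_measurable M" if "k \<in> {0..n - r}" for k
    using sq_D[OF assms(1), of k r] that assms by (auto simp: sq_integrable_def)
  thus ?thesis unfolding mean_sq_div_diff_eq by measurable
qed

text \<open>The threshold exceeds the largest row sum, of order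
  \<open>real n powr (2 - \<beta>)\<close>, by a diverging factor. The sum of squares would thus
  have to exceed a large multiple of \<open>n\<close> row sums, which has probability of order
  \<open>exp (- n)\<close> in every regime.\<close>

lemma upper_deviation_prob:
  assumes b: "threshold_seq b" and r: "r \<le> Suc r0"
  shows "(\<lambda>n. prob {\<omega> \<in> space M. (real n)\<^sup>2 * b n \<le> mean_sq_div_diff (t n) n 1 r (\<lambda>s. X s \<omega>)})
    \<in> O(\<lambda>n. exp (- real n))"
proof -
  obtain C where C: "0 < C" "\<forall>n\<ge>n0. r \<le> n \<longrightarrow> (\<forall>y.
     prob {\<omega> \<in> space M. y \<le> (\<Sum>k=0..n - r. (D n r k \<omega>)\<^sup>2)} \<le>
       exp (real (n - r + 1) / 2 - (y / 2 - real (n - r + 1) * C) / (C * real n powr (2 - \<beta>))))"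
    using D_upper_tail[OF r] by (elim exE conjE)
  \<comment> \<open>The threshold condition is taken at \<open>\<beta> / 2\<close>, since
    \<open>n\<^sup>2 * b n\<close> divided by \<open>real n powr (2 - \<beta>)\<close> is
    \<open>real n powr \<beta> * b n\<close>. The factor 5 below is halved in the tail bound and
    loses 1 to the means; the remaining 3/2 outweighs the 1/2 of the prefactor by exactly 1.\<close>
  have "filterlim (\<lambda>n. real n powr (2 * (\<beta> / 2)) * b n) at_top sequentially"
    using b beta unfolding threshold_seq_def by (elim conjE allE[of _ "\<beta> / 2"]) auto
  hence "\<forall>\<^sub>F n in sequentially. 5 * C \<le> real n powr (2 * (\<beta> / 2)) * b n"
    by (simp only: filterlim_at_top)
  hence "\<forall>\<^sub>F n in sequentially.
      prob {\<omega> \<in> space M. (real n)\<^sup>2 * b n \<le> mean_sq_div_diff (t n) n 1 r (\<lambda>s. X s \<omega>)} \<le>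
        exp (real r) * exp (- real n)"
    using eventually_ge_at_top[of "n0 + r"]
  proof eventually_elim
    case (elim n)
    hence n: "n0 \<le> n" "r \<le> n" by auto
    note pos = real_n_pos[OF n(1)]
    define N where "N = real (n - r + 1)"
    have N: "0 < N" "real n - real r \<le> N" using n by (auto simp: N_def)
    define y where "y = N * ((real n)\<^sup>2 * b n)"
    define Q where "Q = real n powr (2 - \<beta>)"
    have Q1: "1 \<le> Q" unfolding Q_def using n n0 beta by (intro ge_one_powr_ge_zero) auto
    have "5 * C \<le> real n powr \<beta> * b n" using elim by simp
    hence "5 * C * Q \<le> (real n powr \<beta> * b n) * Q" using Q1 by (intro mult_right_mono) auto
    also have "\<dots> = (real n powr \<beta> * Q) * b n" by simp
    also have "real n powr \<beta> * Q = (real n)\<^sup>2" using pos by (simp add: Q_def flip: powr_add)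
    finally have "5 * C * Q \<le> (real n)\<^sup>2 * b n" .
    hence "N * (5 * C * Q) \<le> y" using N by (simp add: y_def)
    moreover have "N * C * 1 \<le> N * C * Q" using N C(1) Q1 by (intro mult_left_mono) auto
    ultimately have "3 / 2 * N * (C * Q) \<le> y / 2 - N * C" by (simp add: algebra_simps)
    hence ex: "3 / 2 * N \<le> (y / 2 - N * C) / (C * Q)"
      using C(1) Q1 by (simp add: pos_le_divide_eq)
    have "{\<omega> \<in> space M. (real n)\<^sup>2 * b n \<le> mean_sq_div_diff (t n) n 1 r (\<lambda>s. X s \<omega>)} =
        {\<omega> \<in> space M. y \<le> (\<Sum>k=0..n - r. (D n r k \<omega>)\<^sup>2)}"
      unfolding mean_sq_div_diff_eq y_def N_def[symmetric] using N(1) by (simp add: field_simps)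
    hence "prob {\<omega> \<in> space M. (real n)\<^sup>2 * b n \<le> mean_sq_div_diff (t n) n 1 r (\<lambda>s. X s \<omega>)} \<le>
        exp (N / 2 - (y / 2 - N * C) / (C * Q))"
      using C(2) n unfolding N_def Q_def by auto
    also have "\<dots> \<le> exp (real r + - real n)"
      unfolding exp_le_cancel_iff using ex N(2) by linarith
    finally show ?case by (simp only: exp_add)
  qed
  thus ?thesis by (intro bigoI[of _ "exp (real r)"]) simp
qed

lemma lower_deviation_prob:
  assumes b: "threshold_seq b"
  shows "\<exists>K c. 0 < c \<and> (\<forall>\<^sub>F n in sequentially.
    prob {\<omega> \<in> space M. mean_sq_div_diff (t n) n 1 (Suc (Suc r0)) (\<lambda>s. X s \<omega>) < (real n)\<^sup>2 * b n} \<le>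
      K * real n * exp (- (c * (real n / decay_sum n))))"
proof -
  define r where "r = Suc (Suc r0)"
  obtain w \<epsilon> C N where tail: "1 \<le> w" "0 < \<epsilon>" "0 < C" "n0 \<le> N"
    "\<forall>n\<ge>N. \<forall>q\<ge>1. C * decay_sum n \<le> real q \<longrightarrow> (\<forall>y.
     prob {\<omega> \<in> space M. (\<Sum>k=0..n - Suc (Suc r0). (D n (Suc (Suc r0)) k \<omega>)\<^sup>2) \<le> y} \<le>
       real q * exp (8 * y / (real q * \<epsilon> * real n powr (4 - 2 * \<beta>)) -
         real ((n - Suc (Suc r0)) div w div q) / 4))"
    using D_lower_tail by (elim exE conjE)
  \<comment> \<open>Rounding up and adding 1 gives \<open>q \<le> C * decay_sum n + 2\<close>, and
    \<open>decay_sum n \<ge> 1\<close> turns this into a multiple.\<close>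
  define C' where "C' = C + 2"
  have C': "0 < C'" using tail by (simp add: C'_def)
  \<comment> \<open>The ratio of the threshold to the order
    \<open>real n powr (4 - 2 * \<beta>)\<close> of the second moments. Below
    \<open>\<epsilon> / (128 * w)\<close> the term with \<open>y\<close> is at most
    \<open>n / (16 * w * q)\<close>, half of what the number of indices contributes up to a
    constant.\<close>
  define z where "z n = real n powr (- 2 * (1 - \<beta>)) * b n" for n
  have "z \<longlonglongrightarrow> 0" using b beta unfolding threshold_seq_def z_def by auto
  hence "\<forall>\<^sub>F n in sequentially. z n < \<epsilon> / (128 * real w)"
    using tail by (intro order_tendstoD) auto
  hence "\<forall>\<^sub>F n in sequentially.
    prob {\<omega> \<in> space M. mean_sq_div_diff (t n) n 1 r (\<lambda>s. X s \<omega>) < (real n)\<^sup>2 * b n} \<le>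
      C' * exp (1 / 4) * real n * exp (- (1 / (16 * real w * C') * (real n / decay_sum n)))"
    using eventually_ge_at_top[of "N + 2 * r + 2 * w"]
  proof eventually_elim
    case (elim n)
    hence n: "N \<le> n" "n0 \<le> n" "r \<le> n" "2 * r + 2 * w \<le> n" "1 \<le> n" using tail by auto
    note pos = real_n_pos[OF n(2)]
    have bpos: "0 < b n" using b n by (simp add: threshold_seq_def)
    define V where "V = real n powr (4 - 2 * \<beta>)"
    have V: "0 < V" using pos by (simp add: V_def)
    note ds = decay_sum_bounds[OF n(5)]
    \<comment> \<open>As few classes as diagonal dominance permits, since each class then retains as
      many indices as possible; the added 1 ensures \<open>1 \<le> q\<close>.\<close>
    define q where "q = nat \<lceil>C * decay_sum n\<rceil> + 1"
    have q1: "1 \<le> q" by (simp add: q_def)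
    have Cd: "0 \<le> C * decay_sum n" using tail ds by simp
    have qle: "C * decay_sum n \<le> real q" unfolding q_def using Cd by linarith
    have "real q \<le> C * decay_sum n + 2" unfolding q_def using Cd by linarith
    hence qC: "real q \<le> C' * decay_sum n" using ds by (simp add: C'_def distrib_right)
    define y where "y = real (n - r + 1) * ((real n)\<^sup>2 * b n)"
    have "real (n - r + 1) \<le> real n" using n by (simp add: r_def)
    hence "y \<le> real n * ((real n)\<^sup>2 * b n)" unfolding y_def using bpos by (intro mult_right_mono) auto
    also have "(real n)\<^sup>2 * b n = V * z n"
    proof -
      have "V * real n powr (- 2 * (1 - \<beta>)) = real n powr 2" by (simp add: V_def flip: powr_add)
      thus ?thesis using pos by (simp add: z_def)
    qed
    finally have yz: "y \<le> real n * (V * z n)" .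
    define I where "I = (n - r) div w"
    have I: "real n / (2 * real w) \<le> real I"
    proof -
      have "n - r < w * Suc I" unfolding I_def using tail(1) by (simp add: dividend_less_times_div)
      hence "n < w * I + w + r" by simp
      hence "n \<le> 2 * (w * I)" using n(4) by linarith
      hence "real n \<le> real (2 * (w * I))" by (simp only: of_nat_le_iff)
      thus ?thesis using tail(1) by (simp add: field_simps)
    qed
    have Iq: "real I / real q - 1 \<le> real (I div q)"
    proof -
      have "I < q * Suc (I div q)" using q1 by (simp add: dividend_less_times_div)
      hence "real I < real (q * Suc (I div q))" by (simp only: of_nat_less_iff)
      thus ?thesis using q1 by (simp add: field_simps)
    qed
    have "{\<omega> \<in> space M. mean_sq_div_diff (t n) n 1 r (\<lambda>s. X s \<omega>) < (real n)\<^sup>2 * b n} \<subseteq>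
        {\<omega> \<in> space M. (\<Sum>k=0..n - r. (D n r k \<omega>)\<^sup>2) \<le> y}"
      unfolding mean_sq_div_diff_eq y_def by (auto simp: field_simps)
    moreover have "{\<omega> \<in> space M. (\<Sum>k=0..n - r. (D n r k \<omega>)\<^sup>2) \<le> y} \<in> sets M"
    proof -
      have "D n r k \<in> borel_measurable M" if "k \<in> {0..n - r}" for k
        using sq_D[OF n(2), of k r] that n by (auto simp: sq_integrable_def)
      thus ?thesis by measurable
    qed
    ultimately have "prob {\<omega> \<in> space M. mean_sq_div_diff (t n) n 1 r (\<lambda>s. X s \<omega>) < (real n)\<^sup>2 * b n} \<le>
        prob {\<omega> \<in> space M. (\<Sum>k=0..n - r. (D n r k \<omega>)\<^sup>2) \<le> y}"
      by (rule finite_measure_mono)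
    also have "\<dots> \<le> real q * exp (8 * y / (real q * \<epsilon> * V) - real (I div q) / 4)"
      using tail(5) n(1) q1 qle unfolding r_def V_def I_def by blast
    also have "\<dots> \<le> C' * real n * exp (1 / 4 - 1 / (16 * real w * C') * (real n / decay_sum n))"
    proof (intro mult_mono)
      show "real q \<le> C' * real n"
        using qC ds(2) C' by (meson mult_left_mono less_imp_le order_trans)
      have "8 * y / (real q * \<epsilon> * V) \<le> 8 * (real n * (V * z n)) / (real q * \<epsilon> * V)"
        using yz q1 tail V by (intro divide_right_mono) auto
      also have "\<dots> = real n / real q * (8 / \<epsilon> * z n)" using V by simp
      also have "\<dots> \<le> real n / real q * (8 / \<epsilon> * (\<epsilon> / (128 * real w)))"
        using elim(1) tail by (intro mult_left_mono) auto
      also have "\<dots> = (real n / real q) / (16 * real w)" using tail by simp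
      finally have A: "8 * y / (real q * \<epsilon> * V) \<le> (real n / real q) / (16 * real w)" .
      have B': "(real n / (2 * real w)) / real q \<le> real I / real q"
        using I by (intro divide_right_mono) auto
      have B: "2 * ((real n / real q) / (16 * real w)) - 1 / 4 \<le> real (I div q) / 4"
      proof -
        have "2 * ((real n / real q) / (16 * real w)) = (real n / (2 * real w)) / real q / 4"
          using tail(1) q1 by (simp add: field_simps)
        moreover have "a' - 1 / 4 \<le> u / 4" if "a' = b' / 4" "b' \<le> c'" "c' - 1 \<le> u" for a' b' c' u :: real
          using that by linarith
        ultimately show ?thesis using B' Iq by blast
      qed
      have "real n / (C' * decay_sum n) \<le> real n / real q"
        using qC q1 by (intro divide_left_mono mult_pos_pos) (use C' ds in auto)
      hence "(real n / (C' * decay_sum n)) / (16 * real w) \<le> (real n / real q) / (16 * real w)"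
        by (intro divide_right_mono) auto
      also have "(real n / (C' * decay_sum n)) / (16 * real w) = 1 / (16 * real w * C') * (real n / decay_sum n)"
        by simp
      finally have S: "1 / (16 * real w * C') * (real n / decay_sum n) \<le> (real n / real q) / (16 * real w)" .
      show "exp (8 * y / (real q * \<epsilon> * V) - real (I div q) / 4) \<le>
          exp (1 / 4 - 1 / (16 * real w * C') * (real n / decay_sum n))"
      proof (subst exp_le_cancel_iff)
        have "u - v \<le> 1 / 4 - s" if "s \<le> x" "u \<le> x" "2 * x - 1 / 4 \<le> v" for u v s x :: real
          using that by linarith
        from this[OF S A B]
        show "8 * y / (real q * \<epsilon> * V) - real (I div q) / 4 \<le>
            1 / 4 - 1 / (16 * real w * C') * (real n / decay_sum n)" .
      qed
    qed (use C' in auto)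
    also have "\<dots> = C' * exp (1 / 4) * real n * exp (- (1 / (16 * real w * C') * (real n / decay_sum n)))"
    proof -
      have e: "exp (1 / 4 - x) = exp (1 / 4) * exp (- x)" for x :: real
        using exp_add[of "1 / 4" "- x"] by simp
      show ?thesis unfolding e by (simp only: mult_ac)
    qed
    finally show ?case .
  qed
  thus ?thesis unfolding r_def using tail(1) C'
    by (intro exI[of _ "C' * exp (1 / 4)"] exI[of _ "1 / (16 * real w * C')"]) auto
qed

text \<open>A measurable event outside which the estimator is exact. It involves only the orders up
  to \<open>r0 + 2\<close>, whatever \<open>m n\<close> is; for \<open>r0 = 0\<close> the union is
  empty. Bounding by this event avoids a discussion of the measurability of the estimator
  itself.\<close>

definition misfit_event :: "(nat \<Rightarrow> real) \<Rightarrow> nat \<Rightarrow> 'a set" where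
  "misfit_event b n =
     {\<omega> \<in> space M. mean_sq_div_diff (t n) n 1 (Suc (Suc r0)) (\<lambda>s. X s \<omega>) < (real n)\<^sup>2 * b n} \<union>
     (\<Union>r\<in>{2..Suc r0}. {\<omega> \<in> space M. (real n)\<^sup>2 * b n \<le> mean_sq_div_diff (t n) n 1 r (\<lambda>s. X s \<omega>)})"

lemma misfit_event_measurable:
  assumes "n0 \<le> n" "Suc (Suc r0) \<le> n"
  shows "misfit_event b n \<in> sets M"
proof -
  note [measurable] = measurable_mean_sq[OF assms(1)]
  have "{\<omega> \<in> space M. (real n)\<^sup>2 * b n \<le> mean_sq_div_diff (t n) n 1 r (\<lambda>s. X s \<omega>)} \<in> sets M"
    if "r \<le> n" for r using that by measurable
  moreover have "{\<omega> \<in> space M. mean_sq_div_diff (t n) n 1 (Suc (Suc r0)) (\<lambda>s. X s \<omega>) < (real n)\<^sup>2 * b n} \<in> sets M"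
    using assms(2) by measurable
  ultimately show ?thesis unfolding misfit_event_def using assms(2) by (intro sets.Un sets.finite_UN) auto
qed

text \<open>Orders beyond \<open>r0 + 2\<close> cannot interfere because a minimum is taken, and the
  search reaches \<open>r0 + 2\<close> by the condition on \<open>m n\<close>.\<close>

lemma r0_hat_eq:
  assumes "\<omega> \<in> space M" "\<omega> \<notin> misfit_event b n" "int (Suc (Suc r0)) \<le> m n"
  shows "r0_hat t m b l0 n (\<lambda>s. X s \<omega>) = real r0"
proof -
  define S where "S = {r::nat. 2 \<le> r \<and> int r \<le> m n \<and>
    (real n)\<^sup>2 * b n \<le> mean_sq_div_diff (t n) n 1 r (\<lambda>s. X s \<omega>)}"
  have "finite S" by (rule finite_subset[of _ "{..nat (m n)}"]) (auto simp: S_def)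
  moreover have mem: "Suc (Suc r0) \<in> S"
    using assms by (auto simp: S_def misfit_event_def not_less)
  moreover have "Suc (Suc r0) \<le> r" if "r \<in> S" for r
  proof (rule ccontr)
    assume "\<not> ?thesis"
    hence "r \<in> {2..Suc r0}" using that by (auto simp: S_def)
    thus False using that assms(1,2) unfolding S_def misfit_event_def by blast
  qed
  ultimately have "Min S = Suc (Suc r0)" by (intro Min_eqI)
  moreover have "r0_hat t m b l0 n (\<lambda>s. X s \<omega>) = (if S = {} then l0 else real (Min S) - 2)"
    by (simp only: r0_hat_def S_def Let_def)
  ultimately show ?thesis using mem by auto
qed

text \<open>A deterministic bound for the error on the exceptional event. It is quadratic in
  \<open>m n\<close>; the third power matches the stated rate and is larger because
  \<open>1 \<le> m n\<close>, which also lets \<open>l0\<close> and \<open>r0\<close> be absorbed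
  into the factor.\<close>

lemma r0_hat_error_le:
  assumes "1 \<le> m n"
  shows "(r0_hat t m b l0 n x - real r0)\<^sup>2 \<le> (\<bar>l0\<bar> + real r0 + 1)\<^sup>2 * real_of_int (m n) ^ 3"
proof -
  define S where "S = {r::nat. 2 \<le> r \<and> int r \<le> m n \<and> (real n)\<^sup>2 * b n \<le> mean_sq_div_diff (t n) n 1 r x}"
  define v where "v = r0_hat t m b l0 n x"
  define k where "k = real_of_int (m n)"
  have k: "1 \<le> k" using assms by (simp add: k_def)
  have fin: "finite S" by (rule finite_subset[of _ "{..nat (m n)}"]) (auto simp: S_def)
  have v: "v = (if S = {} then l0 else real (Min S) - 2)"
    by (simp only: v_def r0_hat_def S_def Let_def)
  have "\<bar>v\<bar> \<le> \<bar>l0\<bar> + k"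
  proof (cases "S = {}")
    case True
    thus ?thesis using k by (simp add: v)
  next
    case False
    hence "Min S \<in> S" using fin by simp
    hence "2 \<le> Min S" "int (Min S) \<le> m n" by (auto simp: S_def)
    hence "2 \<le> real (Min S)" "real_of_int (int (Min S)) \<le> k"
      by (simp, simp only: k_def of_int_le_iff)
    hence "2 \<le> real (Min S)" "real (Min S) \<le> k" by simp_all
    thus ?thesis using False by (simp add: v)
  qed
  hence "\<bar>v - real r0\<bar> \<le> \<bar>l0\<bar> * 1 + real r0 * 1 + 1 * k" by simp
  also have "\<dots> \<le> \<bar>l0\<bar> * k + real r0 * k + 1 * k" using k by (intro add_mono mult_left_mono) auto
  also have "\<dots> = (\<bar>l0\<bar> + real r0 + 1) * k" by (simp add: distrib_right)
  finally have "\<bar>v - real r0\<bar>\<^sup>2 \<le> ((\<bar>l0\<bar> + real r0 + 1) * k)\<^sup>2" by (intro power_mono) auto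
  hence "(v - real r0)\<^sup>2 \<le> (\<bar>l0\<bar> + real r0 + 1)\<^sup>2 * k ^ 2" by (simp add: power_mult_distrib)
  also have "\<dots> \<le> (\<bar>l0\<bar> + real r0 + 1)\<^sup>2 * k ^ 3"
    using k by (intro mult_left_mono power_increasing) auto
  finally show ?thesis by (simp add: v_def k_def)
qed

lemma misfit_event_prob:
  assumes b: "threshold_seq b"
  shows "\<exists>C1>0. (\<lambda>n. prob (misfit_event b n)) \<in> O(\<lambda>n. exp (- rate C1 \<beta> p n))"
proof -
  define F where "F n r = {\<omega> \<in> space M. (real n)\<^sup>2 * b n \<le> mean_sq_div_diff (t n) n 1 r (\<lambda>s. X s \<omega>)}" for n r
  define L where "L n = {\<omega> \<in> space M. mean_sq_div_diff (t n) n 1 (Suc (Suc r0)) (\<lambda>s. X s \<omega>) < (real n)\<^sup>2 * b n}" for n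
  obtain K c where low: "0 < c" "\<forall>\<^sub>F n in sequentially.
      prob (L n) \<le> K * real n * exp (- (c * (real n / decay_sum n)))"
    using lower_deviation_prob[OF b] unfolding L_def by (elim exE conjE)
  obtain c' where c': "0 < c'" "\<forall>\<^sub>F n in sequentially. c' * rate 1 \<beta> p n \<le> real n / decay_sum n"
    using rate_le_decay by (elim exE conjE)
  \<comment> \<open>Half of the exponent is spent on the factor \<open>n\<close> in front of the
    exponential.\<close>
  define a where "a = c * c' / 2"
  have a: "0 < a" using low c' by (simp add: a_def)
  \<comment> \<open>The upper deviations provide \<open>exp (- n)\<close> only, and the rate with
    constant 1 is eventually at most \<open>n\<close>.\<close>
  define C1 where "C1 = min 1 a"
  have C1: "0 < C1" "C1 \<le> 1" "C1 \<le> a" using a by (auto simp: C1_def)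
  have rate_nonneg: "\<forall>\<^sub>F n in sequentially. 0 \<le> rate 1 \<beta> p n"
    using ln_le_rate_one[OF beta zero_less_one, of p] eventually_ge_at_top[of 1]
    by eventually_elim (simp, metis ln_ge_zero of_nat_1 of_nat_mono order_trans One_nat_def)
  have L_bound: "(\<lambda>n. prob (L n)) \<in> O(\<lambda>n. exp (- rate C1 \<beta> p n))"
  proof (rule bigoI[of _ "\<bar>K\<bar>"])
    show "\<forall>\<^sub>F n in sequentially. norm (prob (L n)) \<le> \<bar>K\<bar> * norm (exp (- rate C1 \<beta> p n))"
      using low(2) c'(2) ln_le_rate_one[OF beta a, of p] rate_nonneg eventually_ge_at_top[of 1]
    proof eventually_elim
      case (elim n)
      have n: "0 < real n" using elim by simp
      define R where "R = rate 1 \<beta> p n"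
      have "c * (c' * R) \<le> c * (real n / decay_sum n)"
        using elim(2) low(1) by (intro mult_left_mono) (auto simp: R_def)
      hence "2 * (a * R) \<le> c * (real n / decay_sum n)" by (simp add: a_def)
      moreover have "ln (real n) \<le> a * R" using elim(3) by (simp add: R_def)
      moreover have "C1 * R \<le> a * R" using C1 elim(4) by (intro mult_right_mono) (auto simp: R_def)
      ultimately have ex: "ln (real n) + - (c * (real n / decay_sum n)) \<le> - (C1 * R)" by linarith
      have "prob (L n) \<le> K * real n * exp (- (c * (real n / decay_sum n)))" by (rule elim(1))
      also have "\<dots> \<le> \<bar>K\<bar> * (real n * exp (- (c * (real n / decay_sum n))))"
        using n by (simp add: mult.assoc mult_right_mono)
      also have "real n * exp (- (c * (real n / decay_sum n))) = exp (ln (real n) + - (c * (real n / decay_sum n)))"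
        using n by (simp only: exp_add exp_ln)
      also have "\<bar>K\<bar> * \<dots> \<le> \<bar>K\<bar> * exp (- (C1 * R))"
        using ex by (intro mult_left_mono) auto
      finally show ?case by (simp add: R_def rate_eq[of C1])
    qed
  qed
  have F_bound: "(\<lambda>n. prob (F n r)) \<in> O(\<lambda>n. exp (- rate C1 \<beta> p n))" if "r \<in> {2..Suc r0}" for r
  proof -
    have "(\<lambda>n. prob (F n r)) \<in> O(\<lambda>n. exp (- real n))"
      unfolding F_def using that by (intro upper_deviation_prob b) auto
    moreover have "(\<lambda>n. exp (- real n)) \<in> O(\<lambda>n. exp (- rate C1 \<beta> p n))"
    proof (rule bigoI[of _ 1])
      show "\<forall>\<^sub>F n in sequentially. norm (exp (- real n)) \<le> 1 * norm (exp (- rate C1 \<beta> p n))"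
        using rate_one_le[OF beta, of p] rate_nonneg
      proof eventually_elim
        case (elim n)
        have "C1 * rate 1 \<beta> p n \<le> 1 * rate 1 \<beta> p n" using C1 elim by (intro mult_right_mono) auto
        thus ?case using elim by (simp add: rate_eq[of C1])
      qed
    qed
    ultimately show ?thesis by (rule landau_o.big_trans)
  qed
  have sum: "(\<lambda>n. prob (L n) + (\<Sum>r\<in>{2..Suc r0}. prob (F n r))) \<in> O(\<lambda>n. exp (- rate C1 \<beta> p n))"
    by (intro sum_in_bigo L_bound big_sum_in_bigo F_bound)
  have "(\<lambda>n. prob (misfit_event b n)) \<in> O(\<lambda>n. prob (L n) + (\<Sum>r\<in>{2..Suc r0}. prob (F n r)))"
  proof (rule bigoI[of _ 1])
    show "\<forall>\<^sub>F n in sequentially. norm (prob (misfit_event b n)) \<le>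
        1 * norm (prob (L n) + (\<Sum>r\<in>{2..Suc r0}. prob (F n r)))"
      using eventually_ge_at_top[of "n0 + Suc (Suc r0)"]
    proof eventually_elim
      case (elim n)
      have meas: "(\<lambda>\<omega>. mean_sq_div_diff (t n) n 1 r (\<lambda>s. X s \<omega>)) \<in> borel_measurable M"
        if "r \<le> Suc (Suc r0)" for r
        using elim that by (intro measurable_mean_sq) auto
      have Fm: "F n r \<in> sets M" if "r \<in> {2..Suc r0}" for r
        unfolding F_def using meas[of r] that by auto
      have Lm: "L n \<in> sets M" unfolding L_def using meas[of "Suc (Suc r0)"] by auto
      have "prob (misfit_event b n) = prob (L n \<union> (\<Union>r\<in>{2..Suc r0}. F n r))"
        by (simp add: misfit_event_def L_def F_def)
      also have "\<dots> \<le> prob (L n) + prob (\<Union>r\<in>{2..Suc r0}. F n r)"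
        using Fm Lm by (intro measure_Un_le sets.finite_UN) auto
      also have "prob (\<Union>r\<in>{2..Suc r0}. F n r) \<le> (\<Sum>r\<in>{2..Suc r0}. prob (F n r))"
        using Fm by (intro finite_measure_subadditive_finite) auto
      finally show ?case by (simp add: sum_nonneg)
    qed
  qed
  hence "(\<lambda>n. prob (misfit_event b n)) \<in> O(\<lambda>n. exp (- rate C1 \<beta> p n))"
    using sum by (rule landau_o.big_trans)
  thus ?thesis using C1 by blast
qed

theorem r0_hat_consistent:
  assumes b: "threshold_seq b" and m: "max_order_seq r0 m"
  shows "\<exists>C1>0.
    (\<lambda>n. prob {\<omega> \<in> space M. r0_hat t m b l0 n (\<lambda>s. X s \<omega>) \<noteq> real r0})
      \<in> O(\<lambda>n. exp (- rate C1 \<beta> p n)) \<and>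
    (\<lambda>n. \<integral>\<omega>. (r0_hat t m b l0 n (\<lambda>s. X s \<omega>) - real r0)\<^sup>2 \<partial>M)
      \<in> O(\<lambda>n. (real_of_int (m n)) ^ 3 * exp (- rate C1 \<beta> p n))"
proof -
  obtain C1 where C1: "0 < C1" "(\<lambda>n. prob (misfit_event b n)) \<in> O(\<lambda>n. exp (- rate C1 \<beta> p n))"
    using misfit_event_prob[OF b] by (elim exE conjE)
  have "\<forall>\<^sub>F n in sequentially. int (Suc (Suc r0)) \<le> m n"
    using m unfolding max_order_seq_def
  proof (elim conjE disjE exE)
    assume "filterlim m at_top sequentially"
    thus ?thesis by (simp add: filterlim_at_top)
  next
    fix B assume "r0 \<le> B" "\<forall>\<^sub>F n in sequentially. m n = int B + 2"
    thus ?thesis by (auto elim!: eventually_mono)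
  qed
  moreover have "\<forall>\<^sub>F n in sequentially. m n \<le> int n" using m by (simp add: max_order_seq_def)
  ultimately have ev: "\<forall>\<^sub>F n in sequentially. n0 \<le> n \<and> int (Suc (Suc r0)) \<le> m n \<and> Suc (Suc r0) \<le> n"
    using eventually_ge_at_top[of n0] by eventually_elim auto
  define Kc where "Kc = (\<bar>l0\<bar> + real r0 + 1)\<^sup>2"
  have "(\<lambda>n. prob {\<omega> \<in> space M. r0_hat t m b l0 n (\<lambda>s. X s \<omega>) \<noteq> real r0}) \<in> O(\<lambda>n. prob (misfit_event b n))"
  proof (rule bigoI[of _ 1])
    show "\<forall>\<^sub>F n in sequentially. norm (prob {\<omega> \<in> space M. r0_hat t m b l0 n (\<lambda>s. X s \<omega>) \<noteq> real r0}) \<le>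
        1 * norm (prob (misfit_event b n))"
      using ev
    proof eventually_elim
      case (elim n)
      have "{\<omega> \<in> space M. r0_hat t m b l0 n (\<lambda>s. X s \<omega>) \<noteq> real r0} \<subseteq> misfit_event b n"
        using r0_hat_eq[of _ b n m l0] elim by auto
      thus ?case using misfit_event_measurable[of n b] elim by (auto intro: finite_measure_mono)
    qed
  qed
  hence 1: "(\<lambda>n. prob {\<omega> \<in> space M. r0_hat t m b l0 n (\<lambda>s. X s \<omega>) \<noteq> real r0}) \<in> O(\<lambda>n. exp (- rate C1 \<beta> p n))"
    using C1(2) by (rule landau_o.big_trans)
  have "(\<lambda>n. \<integral>\<omega>. (r0_hat t m b l0 n (\<lambda>s. X s \<omega>) - real r0)\<^sup>2 \<partial>M) \<in>
      O(\<lambda>n. real_of_int (m n) ^ 3 * prob (misfit_event b n))"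
  proof (rule bigoI[of _ Kc])
    show "\<forall>\<^sub>F n in sequentially. norm (\<integral>\<omega>. (r0_hat t m b l0 n (\<lambda>s. X s \<omega>) - real r0)\<^sup>2 \<partial>M) \<le>
        Kc * norm (real_of_int (m n) ^ 3 * prob (misfit_event b n))"
      using ev
    proof eventually_elim
      case (elim n)
      define k where "k = real_of_int (m n) ^ 3"
      have k: "0 \<le> k" using elim by (simp add: k_def)
      have E: "misfit_event b n \<in> sets M" using elim by (intro misfit_event_measurable) auto
      \<comment> \<open>\<open>integral_mono'\<close> asks for integrability of the larger function
        only; a non-integrable left-hand side has integral 0.\<close>
      have "(\<integral>\<omega>. (r0_hat t m b l0 n (\<lambda>s. X s \<omega>) - real r0)\<^sup>2 \<partial>M) \<le>
          (\<integral>\<omega>. Kc * k * indicator (misfit_event b n) \<omega> \<partial>M)"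
      proof (rule integral_mono')
        show "integrable M (\<lambda>\<omega>. Kc * k * indicator (misfit_event b n) \<omega>)"
          using E by (intro integrable_mult_right integrable_real_indicator) (auto simp: emeasure_eq_measure)
        fix \<omega> assume \<omega>: "\<omega> \<in> space M"
        show "(r0_hat t m b l0 n (\<lambda>s. X s \<omega>) - real r0)\<^sup>2 \<le> Kc * k * indicator (misfit_event b n) \<omega>"
        proof (cases "\<omega> \<in> misfit_event b n")
          case True
          thus ?thesis using r0_hat_error_le[of m n b l0 "\<lambda>s. X s \<omega>"] elim by (simp add: Kc_def k_def)
        next
          case False
          thus ?thesis using r0_hat_eq[OF \<omega> False, of m l0] elim by simp
        qed
      next
        show "0 \<le> Kc * k * indicator (misfit_event b n) \<omega>" for \<omega>
          using k by (simp add: Kc_def)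
      qed
      also have "\<dots> = Kc * (k * prob (misfit_event b n))"
        using E by simp
      finally show ?case using k by (simp add: k_def abs_mult)
    qed
  qed
  moreover have "(\<lambda>n. real_of_int (m n) ^ 3 * prob (misfit_event b n)) \<in>
      O(\<lambda>n. real_of_int (m n) ^ 3 * exp (- rate C1 \<beta> p n))"
    by (intro landau_o.big.mult landau_o.big_refl C1(2))
  ultimately have 2: "(\<lambda>n. \<integral>\<omega>. (r0_hat t m b l0 n (\<lambda>s. X s \<omega>) - real r0)\<^sup>2 \<partial>M) \<in>
      O(\<lambda>n. real_of_int (m n) ^ 3 * exp (- rate C1 \<beta> p n))"
    by (rule landau_o.big_trans)
  show ?thesis using C1(1) 1 2 by blast
qed

end

theorem theorem3p1:
  fixes M :: "'a measure" and X :: "real \<Rightarrow> 'a \<Rightarrow> real" and T \<beta>0 l0 :: real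
    and p r0 :: nat and \<psi> :: "real \<Rightarrow> real" and \<delta> b :: "nat \<Rightarrow> real"
    and t :: "nat \<Rightarrow> nat \<Rightarrow> real" and m :: "nat \<Rightarrow> int"
  assumes "prob_space M"
    and "0 < T"
    and "gaussian_process M {0..T} X"
    and "p \<in> {1, 2}"
    and "regularity M T X p r0 \<beta>0"
    and "regular_design T \<psi> \<delta> t"
    and "design_assumption T \<psi>"
    and "max_order_seq r0 m"
    and "threshold_seq b"
    and "l0 \<notin> \<nat>"
  shows "\<exists>C1>0.
    (\<lambda>n. measure M {\<omega> \<in> space M. r0_hat t m b l0 n (\<lambda>s. X s \<omega>) \<noteq> real r0})
      \<in> O(\<lambda>n. exp (- rate C1 \<beta>0 p n)) \<and>
    (\<lambda>n. \<integral>\<omega>. (r0_hat t m b l0 n (\<lambda>s. X s \<omega>) - real r0)\<^sup>2 \<partial>M)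
      \<in> O(\<lambda>n. (real_of_int (m n)) ^ 3 * exp (- rate C1 \<beta>0 p n))"
proof -
  interpret prob_space M by fact
  obtain Y d0 G Dp where reg: "has_nth_qm_deriv M {0..T} r0 X Y" "0 < \<beta>0" "\<beta>0 < 1"
    "continuous_on {0..T} d0" "\<forall>t\<in>{0..T}. 0 < d0 t"
    "((\<lambda>h. SUP (s, t) \<in> {(s, t). s \<in> {0..T} \<and> t \<in> {0..T} \<and> \<bar>s - t\<bar> \<le> h \<and> s \<noteq> t}.
        ereal \<bar>(\<integral>\<omega>. (Y s \<omega> - Y t \<omega>)\<^sup>2 \<partial>M) / \<bar>s - t\<bar> powr (2 * \<beta>0) - d0 t\<bar>) \<longlongrightarrow> 0) (at_right 0)"
    "has_mixed_deriv_off_diag {0..T} (r0 + p) (r0 + p) (cov_fun M X) G" "0 < Dp"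
    "\<forall>s\<in>{0..T}. \<forall>t\<in>{0..T}. s \<noteq> t \<longrightarrow> \<bar>G s t\<bar> \<le> Dp * \<bar>s - t\<bar> powr (- (2 * real p - 2 * \<beta>0))"
    "Ck_on (r0 + 1) (mean_fun M X) {0..T}"
    using assms(5) unfolding regularity_def by (elim exE conjE)
  have sqX: "sq_integrable M (X s)" if "s \<in> {0..T}" for s
    by (rule gaussian_rv_sq_integrable[OF gaussian_process_imp_gaussian_rv[OF assms(3) that]])
  have sqY: "sq_integrable M (Y s)" if "s \<in> {0..T}" for s
    using has_nth_qm_deriv_sq_integrable[OF reg(1) sqX that] by simp
  obtain c1 c2 h0 where h: "0 < c1" "0 < c2" "0 < h0"
    "\<forall>s\<in>{0..T}. \<forall>t\<in>{0..T}. \<bar>s - t\<bar> \<le> h0 \<longrightarrow>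
      c1 * \<bar>s - t\<bar> powr (2 * \<beta>0) \<le> msq M (\<lambda>\<omega>. Y s \<omega> - Y t \<omega>) \<and>
      msq M (\<lambda>\<omega>. Y s \<omega> - Y t \<omega>) \<le> c2 * \<bar>s - t\<bar> powr (2 * \<beta>0)"
    using holder_two_sided[OF assms(2) reg(4-6)] by (elim exE conjE)
  \<comment> \<open>The upper Hoelder bound is made global here, with \<open>c\<close> in place of
    \<open>c2\<close>.\<close>
  have "\<exists>c. 0 < c \<and> (\<forall>s\<in>{0..T}. \<forall>t\<in>{0..T}.
      msq M (\<lambda>\<omega>. Y s \<omega> - Y t \<omega>) \<le> c * \<bar>s - t\<bar> powr (2 * \<beta>0))"
    by (rule holder_global[OF assms(2) h(3) reg(2) h(2) sqY]) (use h(4) in auto)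
  then obtain c where c: "0 < c" "\<forall>s\<in>{0..T}. \<forall>t\<in>{0..T}.
      msq M (\<lambda>\<omega>. Y s \<omega> - Y t \<omega>) \<le> c * \<bar>s - t\<bar> powr (2 * \<beta>0)"
    by (elim exE conjE)
  obtain gl gu where g: "0 < gl" "0 < gu" "\<forall>\<^sub>F n in sequentially. \<forall>k<n.
      gl / real n \<le> t n (Suc k) - t n k \<and> t n (Suc k) - t n k \<le> gu / real n"
    using regular_design_gaps[OF assms(6,2)] by (elim exE conjE)
  obtain N where N: "\<forall>n\<ge>N. \<forall>k<n.
      gl / real n \<le> t n (Suc k) - t n k \<and> t n (Suc k) - t n k \<le> gu / real n"
    using g(3) unfolding eventually_at_top_linorder by (elim exE)
  \<comment> \<open>The maximum with 1 keeps to the sizes for which the design is specified and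
    divisions by \<open>real n\<close> are meaningful.\<close>
  interpret sampled_process M X Y T \<beta>0 c1 c h0 gl gu Dp r0 p "max 1 N" G t
  proof unfold_locales
    show "t n k \<in> {0..T}" if "max 1 N \<le> n" "k \<le> n" for n k
      using regular_design_mem[OF assms(6)] that by auto
    show "strict_mono_on {0..n} (t n)" if "max 1 N \<le> n" for n
      using assms(6) that by (auto simp: regular_design_def)
  qed (use assms reg h c g N in auto)
  show ?thesis by (rule r0_hat_consistent[OF assms(9,8)])
qed

end
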